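(* Consider the overlaid primary and secondary networks on the unit square operating under the primary and secondary protocols described in the context. The delay-throughput tradeoff for the primary network, relating its packet delay $D_p(n)$ to its throughput per S-D pair $\lambda_p(n)$, is $$D_p(n)=\Theta\left(n\lambda_p(n)\right),\quad\text{for }\lambda_p(n)=O\left(\frac{1}{\sqrt{n\log n}}\right).$$
   Context: W.h.p. means with probability tending to 1 as $n\to\infty$. $O,\Omega,\Theta$ have their usual asymptotic meaning; $\log$ is the natural logarithm in the cell sizes. Network model. Primary nodes form a Poisson point process of density $n$ on the unit square and secondary nodes a Poisson point process of density $m=n^\beta$, $\beta>1$. Nodes of each network are randomly grouped into one-to-one source-destination (S-D) pairs. The channel power gain at distance $r$ is $g(r)=r^{-\alpha}$, $\alpha>2$, with noise power $N_0$ and unit bandwidth. An active transmitter (TX)/receiver (RX) pair at distance $d$ with transmit power $P$ has rate $\log\left(1+\frac{P g(d)}{N_0+I}\right)$, where $I$ is the total interference at the RX from all other active TXs of both networks (a TX of power $P'$ at distance $r$ contributes $P'g(r)$). Primary protocol. The unit square is divided into square primary cells of area $a_p=\frac{k_1\log n}{n}$, $k_1\ge1$, grouped into clusters of $25$ ($5\times5$) cells. Time is split into TDMA frames of 25 slots, each of constant length $t_p$; in each slot one cell per cluster is active, cells taking turns in round-robin fashion, with the same pattern in all clusters. The data path of an S-D pair is the horizontal line (HDP) followed by the vertical line (VDP) connecting source to destination. In each cell one node is the designated relay node (nodes take turns). When a cell is active, its slot is divided into packet slots, one for each data path passing through or originating from the cell: the relay transmits one packet for each path passing through the cell, then each source in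 the cell transmits one packet. Each packet goes to the relay node of the neighboring cell along the data path, or directly to the destination if that is the next hop (the destination may be in the same or a neighboring cell). Received packets are buffered and sent in the next active slot of the cell. TX power is $P_0a_p^{\alpha/2}$, $P_0$ constant. Secondary protocol. Same construction with square secondary cells of area $a_s=\frac{k_2\log m}{m}$, $k_2=k_1\ge1$, clusters of 25 cells, 25-slot TDMA, horizontal-then-vertical data paths, relay nodes, and TX power $P_1a_s^{\alpha/2}$, $P_1$ constant; one secondary TDMA frame has the duration $t_p$ of one primary slot. Around each primary cell containing an active primary TX there is a preservation region, a square of $M^2$ secondary cells, $M=\lfloor 3\sqrt{a_p/a_s}\rfloor+2$, in which no secondary node may transmit (but may receive). A relay node in a preservation region buffers packets until the region is cleared and its cell is active. Fluid model: the packet size scales proportionally to the throughput (arbitrarily small as the density grows), so that each packet arriving at a cell is sent at the next transmission opportunity of that cell. Throughput. For a network with $n_t$ nodes, the throughput per S-D pair $\lambda(n_t)$ is the average data rate that each source can transmit to its destination w.h.p. in multi-hop fashion under the given scheduling scheme, i.e. $p\left(\min_{1\le i\le n_t/2}\liminf_{t\to\infty}\frac1tM_i(t)\ge\lambda(n_t)\right)\to1$ as $n_t\to\infty$, where $M_i(t)$ is the number of bits S-D pair $i$ transmitted in $t$ time slots. For the primary network it is written $\lambda_p(n)$. Delay. The delay $D_i(j)$ of packet $j$ of S-D pair $i$ is the time from departure from the source to arrival at the destination; $D_i=\limsup_{k\to\infty}\frac1k\sum_{j=1}^kD_i(j)$; and the packet delay is $D(n_t)=\frac{2}{n_t}\sum_{i=1}^{n_t/2}E[D_i]$.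 For the primary network it is written $D_p(n)$. *)

theory Defs
  imports "HOL-Probability.Probability" "HOL-Library.Landau_Symbols"
begin

section \<open>Parameters\<close>

text \<open>
  The field \<open>cell_const\<close> is $k_1 = k_2$. It may vary with the primary density $n$, because moving
  along the tradeoff curve means changing the cell size. A constant is a special case.
  The fields \<open>order_p\<close> and \<open>order_s\<close> give the round-robin order: they send the position of a
  cell inside its $5 \times 5$ cluster to the index of the slot (of 25) in which it is active.
\<close>

record overlay =
  path_loss :: real                  \<comment> \<open>$\alpha$\<close>
  density_exp :: real                \<comment> \<open>$\beta$\<close>
  noise :: real                      \<comment> \<open>$N_0$\<close>
  power_p :: real                    \<comment> \<open>$P_0$\<close>
  power_s :: real                    \<comment> \<open>$P_1$\<close>
  slot_len :: real                   \<comment> \<open>$t_p$\<close>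
  cell_const :: "nat \<Rightarrow> real"
  order_p :: "nat \<times> nat \<Rightarrow> nat"
  order_s :: "nat \<times> nat \<Rightarrow> nat"

definition is_cluster_order :: "(nat \<times> nat \<Rightarrow> nat) \<Rightarrow> bool" where
  "is_cluster_order ord \<longleftrightarrow> bij_betw ord ({..<5} \<times> {..<5}) {..<25}"

section \<open>Random networks\<close>

text \<open>
  A Poisson point process of density $d$ on the unit square: a Poisson number of i.i.d. uniform
  points. Since the labels carry no information about the positions, pairing by consecutive
  labels (source $2i$, destination $2i+1$) is a uniformly random pairing of the points.
  If the number of nodes is odd, one node remains unpaired.
\<close>

type_synonym point = "real \<times> real"
type_synonym net = "nat \<times> (nat \<Rightarrow> point)"
type_synonym cell = "nat \<times> nat"

definition poisson_net :: "real \<Rightarrow> net measure" where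
  "poisson_net d =
     measure_pmf (poisson_pmf d) \<Otimes>\<^sub>M
     (\<Pi>\<^sub>M i\<in>UNIV. uniform_measure lborel ({0..<1} \<times> {0..<1}))"

definition secondary_density :: "overlay \<Rightarrow> nat \<Rightarrow> real" where
  "secondary_density p n = real n powr density_exp p"

definition overlay_space :: "overlay \<Rightarrow> nat \<Rightarrow> (net \<times> net) measure" where
  "overlay_space p n = poisson_net (real n) \<Otimes>\<^sub>M poisson_net (secondary_density p n)"

text \<open>
  Inner probability tending to 1; for measurable events this is the usual notion.
\<close>
definition whp :: "(nat \<Rightarrow> 'a measure) \<Rightarrow> (nat \<Rightarrow> 'a \<Rightarrow> bool) \<Rightarrow> bool" where
  "whp M Q \<longleftrightarrow>
     (\<exists>E. (\<forall>n. E n \<in> sets (M n) \<and> (\<forall>\<omega>\<in>E n. Q n \<omega>)) \<and>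
          (\<lambda>n. measure (M n) (E n)) \<longlonglongrightarrow> 1)"

definition num_pairs :: "net \<Rightarrow> nat" where
  "num_pairs w = fst w div 2"

definition pos :: "net \<Rightarrow> nat \<Rightarrow> point" where
  "pos w u = snd w u"

section \<open>Cells, data paths and packet slots (both networks)\<close>

text \<open>
  The number of cells per side is rounded down so that the cells tile the unit square. The cell
  area is thus $k \log d / d$ with $k \ge 1$ rounded up to the next value for which the cells tile.
\<close>

definition cells_per_side :: "real \<Rightarrow> real \<Rightarrow> nat" where
  "cells_per_side k d = nat \<lfloor>1 / sqrt (k * ln d / d)\<rfloor>"

definition cell_area :: "nat \<Rightarrow> real" where
  "cell_area q = 1 / (real q)\<^sup>2"

definition qp :: "overlay \<Rightarrow> nat \<Rightarrow> nat" where
  "qp p n = cells_per_side (cell_const p n) (real n)"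

definition qs :: "overlay \<Rightarrow> nat \<Rightarrow> nat" where
  "qs p n = cells_per_side (cell_const p n) (secondary_density p n)"

definition cell_of :: "nat \<Rightarrow> point \<Rightarrow> cell" where
  "cell_of q z = (nat \<lfloor>real q * fst z\<rfloor>, nat \<lfloor>real q * snd z\<rfloor>)"

text \<open>\<open>steps a b\<close> runs from \<open>a\<close> (included) to \<open>b\<close> (excluded), in either direction.\<close>
definition steps :: "nat \<Rightarrow> nat \<Rightarrow> nat list" where
  "steps a b = (if a \<le> b then [a..<b] else rev [Suc b..<Suc a])"

text \<open>Cells met by the horizontal line from the source and then the vertical line to the destination.\<close>
definition hv_path :: "cell \<Rightarrow> cell \<Rightarrow> cell list" where
  "hv_path a b =
     map (\<lambda>x. (x, snd a)) (steps (fst a) (fst b)) @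
     map (\<lambda>y. (fst b, y)) (steps (snd a) (snd b)) @ [b]"

definition route :: "nat \<Rightarrow> net \<Rightarrow> nat \<Rightarrow> cell list" where
  "route q w i = hv_path (cell_of q (pos w (2 * i))) (cell_of q (pos w (2 * i + 1)))"

text \<open>
  A pair whose endpoints share a cell uses one direct hop. Otherwise the cell before the last one
  transmits directly to the destination, so the last cell does not transmit for this pair.
\<close>
definition hops :: "nat \<Rightarrow> net \<Rightarrow> nat \<Rightarrow> nat" where
  "hops q w i = max 1 (length (route q w i) - 1)"

definition through :: "nat \<Rightarrow> net \<Rightarrow> cell \<Rightarrow> nat list" where
  "through q w c = filter (\<lambda>i. c \<in> set (butlast (tl (route q w i)))) [0..<num_pairs w]"

definition originating :: "nat \<Rightarrow> net \<Rightarrow> cell \<Rightarrow> nat list" where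
  "originating q w c = filter (\<lambda>i. hd (route q w i) = c) [0..<num_pairs w]"

text \<open>The pairs served in an active slot of a cell, in order; each gets an equal share of the slot.\<close>
definition packet_slots :: "nat \<Rightarrow> net \<Rightarrow> cell \<Rightarrow> nat list" where
  "packet_slots q w c = through q w c @ originating q w c"

definition packet_index :: "nat \<Rightarrow> net \<Rightarrow> cell \<Rightarrow> nat \<Rightarrow> nat" where
  "packet_index q w c i = length (takeWhile (\<lambda>i'. i' \<noteq> i) (packet_slots q w c))"

definition nodes_in :: "nat \<Rightarrow> net \<Rightarrow> cell \<Rightarrow> nat list" where
  "nodes_in q w c = filter (\<lambda>u. cell_of q (pos w u) = c) [0..<fst w]"

text \<open>The relay on duty in turn \<open>r\<close>; meaningful only for nonempty cells.\<close>
definition relay :: "nat \<Rightarrow> net \<Rightarrow> cell \<Rightarrow> nat \<Rightarrow> nat" where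
  "relay q w c r = nodes_in q w c ! (r mod length (nodes_in q w c))"

text \<open>The node using packet slot number \<open>k\<close> of cell \<open>c\<close> in turn \<open>r\<close>.\<close>
definition sender :: "nat \<Rightarrow> net \<Rightarrow> cell \<Rightarrow> nat \<Rightarrow> nat \<Rightarrow> nat option" where
  "sender q w c r k =
     (if k < length (through q w c)
      then (if nodes_in q w c = [] then None else Some (relay q w c r))
      else Some (2 * (packet_slots q w c ! k)))"

definition tdma_slot :: "(nat \<times> nat \<Rightarrow> nat) \<Rightarrow> cell \<Rightarrow> nat" where
  "tdma_slot ord c = ord (fst c mod 5, snd c mod 5)"

text \<open>
  Nodes scheduled to transmit at time \<open>t\<close> when slots have length \<open>\<tau>\<close>; \<open>R c f\<close> is the relay turn
  of cell \<open>c\<close> in frame \<open>f\<close>. Packet slots are always used (also in the first few frames, before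
  the pipeline of packets is filled), so a scheduled node always creates interference.
\<close>
definition scheduled ::
  "(nat \<times> nat \<Rightarrow> nat) \<Rightarrow> nat \<Rightarrow> net \<Rightarrow> real \<Rightarrow> (cell \<Rightarrow> nat \<Rightarrow> nat) \<Rightarrow> real \<Rightarrow> nat set" where
  "scheduled ord q w \<tau> R t =
     {u. \<exists>c. let s = nat \<lfloor>t / \<tau>\<rfloor>; l = length (packet_slots q w c) in
          s mod 25 = tdma_slot ord c \<and> l > 0 \<and>
          sender q w c (R c (s div 25)) (nat \<lfloor>frac (t / \<tau>) * real l\<rfloor>) = Some u}"

section \<open>Preservation regions and active transmitters\<close>

definition primary_tx :: "overlay \<Rightarrow> nat \<Rightarrow> net \<Rightarrow> real \<Rightarrow> nat set" where
  "primary_tx p n w t = scheduled (order_p p) (qp p n) w (slot_len p) (\<lambda>c f. f) t"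

text \<open>$M = \lfloor 3\sqrt{a_p/a_s} \rfloor + 2$\<close>
definition region_cells :: "overlay \<Rightarrow> nat \<Rightarrow> nat" where
  "region_cells p n =
     nat \<lfloor>3 * sqrt (cell_area (qp p n) / cell_area (qs p n))\<rfloor> + 2"

definition cell_centre :: "nat \<Rightarrow> cell \<Rightarrow> point" where
  "cell_centre q c = ((real (fst c) + 1 / 2) / real q, (real (snd c) + 1 / 2) / real q)"

text \<open>
  The position \<open>z\<close> is preserved in primary slot \<open>T\<close>: it lies in the square of area $M^2 a_s$ centred at
  the centre of an active primary cell that has packets to transmit.
\<close>
definition preserved :: "overlay \<Rightarrow> nat \<Rightarrow> net \<Rightarrow> nat \<Rightarrow> point \<Rightarrow> bool" where
  "preserved p n w T z \<longleftrightarrow>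
     (\<exists>c. T mod 25 = tdma_slot (order_p p) c \<and> packet_slots (qp p n) w c \<noteq> [] \<and>
        (let h = real (region_cells p n) * sqrt (cell_area (qs p n)) / 2; b = cell_centre (qp p n) c
         in \<bar>fst z - fst b\<bar> \<le> h \<and> \<bar>snd z - snd b\<bar> \<le> h))"

text \<open>
  Relay turn of a secondary cell in secondary frame \<open>f\<close> (which coincides with primary slot \<open>f\<close>). A relay
  inside a preservation region keeps its buffered packets, hence also its turn, until the
  region is cleared and its cell is active.
\<close>
primrec secondary_turn :: "overlay \<Rightarrow> nat \<Rightarrow> net \<times> net \<Rightarrow> cell \<Rightarrow> nat \<Rightarrow> nat" where
  "secondary_turn p n \<omega> c 0 = 0"
| "secondary_turn p n \<omega> c (Suc f) =
     (let r = secondary_turn p n \<omega> c f in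
      if preserved p n (fst \<omega>) f (pos (snd \<omega>) (relay (qs p n) (snd \<omega>) c r)) then r else Suc r)"

definition secondary_tx :: "overlay \<Rightarrow> nat \<Rightarrow> net \<times> net \<Rightarrow> real \<Rightarrow> nat set" where
  "secondary_tx p n \<omega> t =
     {u \<in> scheduled (order_s p) (qs p n) (snd \<omega>) (slot_len p / 25) (secondary_turn p n \<omega>) t.
        \<not> preserved p n (fst \<omega>) (nat \<lfloor>t / slot_len p\<rfloor>) (pos (snd \<omega>) u)}"

section \<open>Rates\<close>

definition gain :: "overlay \<Rightarrow> real \<Rightarrow> real" where
  "gain p r = r powr (- path_loss p)"

definition tx_power_p :: "overlay \<Rightarrow> nat \<Rightarrow> real" where
  "tx_power_p p n = power_p p * cell_area (qp p n) powr (path_loss p / 2)"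

definition tx_power_s :: "overlay \<Rightarrow> nat \<Rightarrow> real" where
  "tx_power_s p n = power_s p * cell_area (qs p n) powr (path_loss p / 2)"

text \<open>Interference at primary node \<open>v\<close> receiving from primary node \<open>u\<close> at time \<open>t\<close>.\<close>
definition interference :: "overlay \<Rightarrow> nat \<Rightarrow> net \<times> net \<Rightarrow> nat \<Rightarrow> nat \<Rightarrow> real \<Rightarrow> real" where
  "interference p n \<omega> u v t =
     (\<Sum>x \<in> primary_tx p n (fst \<omega>) t - {u}.
        tx_power_p p n * gain p (dist (pos (fst \<omega>) x) (pos (fst \<omega>) v))) +
     (\<Sum>x \<in> secondary_tx p n \<omega> t.
        tx_power_s p n * gain p (dist (pos (snd \<omega>) x) (pos (fst \<omega>) v)))"

definition rate :: "overlay \<Rightarrow> nat \<Rightarrow> net \<times> net \<Rightarrow> nat \<Rightarrow> nat \<Rightarrow> real \<Rightarrow> real" where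
  "rate p n \<omega> u v t =
     log 2 (1 + tx_power_p p n * gain p (dist (pos (fst \<omega>) u) (pos (fst \<omega>) v))
                / (noise p + interference p n \<omega> u v t))"

section \<open>Journey of a primary packet\<close>

text \<open>
  Every source emits one packet per frame; packets and hops are counted from 0. \<open>hop_slot p n w i j k\<close>
  is the slot of hop \<open>k\<close> of packet \<open>j\<close> of pair \<open>i\<close>: every received packet is forwarded in the next
  active slot of the cell (fluid model).
\<close>

primrec hop_slot :: "overlay \<Rightarrow> nat \<Rightarrow> net \<Rightarrow> nat \<Rightarrow> nat \<Rightarrow> nat \<Rightarrow> nat" where
  "hop_slot p n w i j 0 = 25 * j + tdma_slot (order_p p) (route (qp p n) w i ! 0)"
| "hop_slot p n w i j (Suc k) =
     (LEAST T. T > hop_slot p n w i j k \<and>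
        T mod 25 = tdma_slot (order_p p) (route (qp p n) w i ! Suc k))"

definition hop_start :: "overlay \<Rightarrow> nat \<Rightarrow> net \<Rightarrow> nat \<Rightarrow> nat \<Rightarrow> nat \<Rightarrow> real" where
  "hop_start p n w i j k =
     (let c = route (qp p n) w i ! k in
      (real (hop_slot p n w i j k) +
       real (packet_index (qp p n) w c i) / real (length (packet_slots (qp p n) w c))) * slot_len p)"

definition hop_end :: "overlay \<Rightarrow> nat \<Rightarrow> net \<Rightarrow> nat \<Rightarrow> nat \<Rightarrow> nat \<Rightarrow> real" where
  "hop_end p n w i j k =
     hop_start p n w i j k +
     slot_len p / real (length (packet_slots (qp p n) w (route (qp p n) w i ! k)))"

text \<open>
  The node holding the packet before hop \<open>k\<close>. A cell's relay keeps its turn from just after one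
  active slot of the cell until the end of the next one, so the relay that receives a packet is the
  one that forwards it.
\<close>
definition holder :: "overlay \<Rightarrow> nat \<Rightarrow> net \<Rightarrow> nat \<Rightarrow> nat \<Rightarrow> nat \<Rightarrow> nat" where
  "holder p n w i j k =
     (if k = 0 then 2 * i
      else if k = hops (qp p n) w i then 2 * i + 1
      else relay (qp p n) w (route (qp p n) w i ! k) (hop_slot p n w i j k div 25))"

text \<open>
  A hop succeeds if the rate integrated over the packet slot is at least the packet size \<open>L\<close>.
  The nonemptiness condition says that the required relay exists.
\<close>
definition hop_ok :: "overlay \<Rightarrow> nat \<Rightarrow> net \<times> net \<Rightarrow> real \<Rightarrow> nat \<Rightarrow> nat \<Rightarrow> nat \<Rightarrow> bool" where
  "hop_ok p n \<omega> L i j k \<longleftrightarrow>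
     (Suc k < hops (qp p n) (fst \<omega>) i \<longrightarrow>
        nodes_in (qp p n) (fst \<omega>) (route (qp p n) (fst \<omega>) i ! Suc k) \<noteq> []) \<and>
     ennreal L \<le>
       (\<integral>\<^sup>+t\<in>{hop_start p n (fst \<omega>) i j k..<hop_end p n (fst \<omega>) i j k}.
          ennreal (rate p n \<omega> (holder p n (fst \<omega>) i j k) (holder p n (fst \<omega>) i j (Suc k)) t)
        \<partial>lborel)"

definition delivered :: "overlay \<Rightarrow> nat \<Rightarrow> net \<times> net \<Rightarrow> real \<Rightarrow> nat \<Rightarrow> nat \<Rightarrow> bool" where
  "delivered p n \<omega> L i j \<longleftrightarrow> (\<forall>k < hops (qp p n) (fst \<omega>) i. hop_ok p n \<omega> L i j k)"

section \<open>Throughput and delay of the primary network\<close>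

text \<open>$M_i(t)$: bits delivered for pair \<open>i\<close> within the first \<open>t\<close> slots, for packets of \<open>L\<close> bits.\<close>
definition bits :: "overlay \<Rightarrow> nat \<Rightarrow> net \<times> net \<Rightarrow> real \<Rightarrow> nat \<Rightarrow> nat \<Rightarrow> real" where
  "bits p n \<omega> L i t =
     L * real (card {j. delivered p n \<omega> L i j \<and>
                        hop_slot p n (fst \<omega>) i j (hops (qp p n) (fst \<omega>) i - 1) < t})"

text \<open>
  Throughput achieved w.h.p. by the scheme; the factor \<open>K\<close> makes the packet size proportional
  to the throughput.
\<close>
definition achievable :: "overlay \<Rightarrow> (nat \<Rightarrow> real) \<Rightarrow> bool" where
  "achievable p lam \<longleftrightarrow>
     (\<forall>\<^sub>F n in sequentially. lam n > 0) \<and>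
     (\<exists>K>0. whp (overlay_space p)
        (\<lambda>n \<omega>. (INF i\<in>{..<num_pairs (fst \<omega>)}.
                   liminf (\<lambda>t. ereal (bits p n \<omega> (K * lam n) i t / real t))) \<ge> ereal (lam n)))"

text \<open>
  Every function below an achievable one is achievable, too; the throughput of the scheme is the
  achievable function of largest order of growth (unique up to constant factors).
\<close>
definition is_primary_throughput :: "overlay \<Rightarrow> (nat \<Rightarrow> real) \<Rightarrow> bool" where
  "is_primary_throughput p lam \<longleftrightarrow>
     achievable p lam \<and> (\<forall>lam'. achievable p lam' \<longrightarrow> lam' \<in> O(lam))"

definition packet_delay :: "overlay \<Rightarrow> nat \<Rightarrow> net \<Rightarrow> nat \<Rightarrow> nat \<Rightarrow> real" where
  "packet_delay p n w i j = hop_end p n w i j (hops (qp p n) w i - 1) - hop_start p n w i j 0"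

definition pair_delay :: "overlay \<Rightarrow> nat \<Rightarrow> net \<Rightarrow> nat \<Rightarrow> ennreal" where
  "pair_delay p n w i = limsup (\<lambda>k. ennreal ((\<Sum>j<k. packet_delay p n w i j) / real k))"

text \<open>
  The primary scheme can run: there is a pair, and each cell contains a node to act as relay. This has
  probability tending to 1; packet delays are not defined outside this event.
\<close>
definition operable :: "overlay \<Rightarrow> nat \<Rightarrow> (net \<times> net) set" where
  "operable p n =
     {\<omega> \<in> space (overlay_space p n). num_pairs (fst \<omega>) > 0 \<and>
        (\<forall>c \<in> {..<qp p n} \<times> {..<qp p n}. nodes_in (qp p n) (fst \<omega>) c \<noteq> [])}"

text \<open>
  The number of pairs is random, so the average over the pairs is taken inside the expectation,
  which is conditional on \<open>operable\<close>.
\<close>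
definition primary_delay :: "overlay \<Rightarrow> nat \<Rightarrow> real" where
  "primary_delay p n =
     enn2real (\<integral>\<^sup>+\<omega>. (\<Sum>i<num_pairs (fst \<omega>). pair_delay p n (fst \<omega>) i)
                        / of_nat (num_pairs (fst \<omega>))
               \<partial>uniform_measure (overlay_space p n) (operable p n))"

end

theory Submission
  imports Defs "HOL-Real_Asymp.Real_Asymp"
begin

text \<open>
  Let \<open>q\<close> be the number of primary cells per side. Both quantities are governed by \<open>q\<close>: the delay is
  of order \<open>q\<close> and the throughput of order \<open>q / n\<close>, whatever the cell constant is.

  Every hop takes between 1 and 25 slots and a path has at most \<open>2 q\<close> hops. A constant fraction of the
  pairs has its source in the left and its destination in the right quarter of the square, so the
  mean delay is also at least of order \<open>q\<close>.

  A path through a cell has its source in the row or its destination in the column of the cell. These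
  strips contain \<open>O(n / q)\<close> nodes w.h.p. by a Chernoff bound, hence a packet slot lasts at least of
  order \<open>q / n\<close>. The rate within it is bounded below: other primary transmitters are at least five
  cells away from the sender, the preservation region keeps secondary ones at distance of half a secondary cell side
  from the receiver, and the interference is then dominated by a convergent lattice sum.

  Conversely, in the middle column each cell is crossed by at least of order \<open>n / q\<close> paths, and
  w.h.p. some source in the left half of a cell of this column sends to the right. Its first hop is not
  short, so its rate is bounded above, and only \<open>O(q / n)\<close> bits fit into its packet slot.
\<close>

subsection \<open>Events of probability tending to one\<close>

text \<open>Randomness enters only through counts of nodes or pairs in rectangles. These are
  measurable and have explicit exponential tails; slots, rates and deliveries are treated
  deterministically on the events so obtained. This fits \<open>whp\<close>, an inner probability,
  and spares the measurability of a \<open>liminf\<close> of bits.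

  The condition \<open>k \<ge> 1\<close> on the cell constant is exploited as
  \<open>q^2 * ln n \<le> n\<close>. It makes the union bound over all \<open>q^2\<close> cells
  converge, and it gives a strip the mean \<open>n / q \<ge> q\<close>, so that exponential errors
  beat the number of strips.

  The upper bound on the throughput meets an obstacle: the gain is unbounded at short distance, so
  two close nodes may pass a large packet through a short packet slot, and the load of a cell alone
  limits nothing. Since the throughput is a minimum over the pairs, one pair is enough whose first
  hop has at least half a cell side and starts in a heavily loaded cell.\<close>

lemma whp_conj:
  assumes M: "\<And>n. prob_space (M n)" and "whp M P" "whp M Q"
  shows "whp M (\<lambda>n \<omega>. P n \<omega> \<and> Q n \<omega>)"
proof -
  obtain E where E: "\<And>n. E n \<in> sets (M n)" "\<And>n \<omega>. \<omega> \<in> E n \<Longrightarrow> P n \<omega>"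
    "(\<lambda>n. measure (M n) (E n)) \<longlonglongrightarrow> 1" using assms(2) unfolding whp_def by blast
  obtain F where F: "\<And>n. F n \<in> sets (M n)" "\<And>n \<omega>. \<omega> \<in> F n \<Longrightarrow> Q n \<omega>"
    "(\<lambda>n. measure (M n) (F n)) \<longlonglongrightarrow> 1" using assms(3) unfolding whp_def by blast
  have low: "measure (M n) (E n) + measure (M n) (F n) - 1 \<le> measure (M n) (E n \<inter> F n)" for n
  proof -
    interpret prob_space "M n" by (rule M)
    have "measure (M n) (E n \<union> F n) = measure (M n) (E n) + measure (M n) (F n - E n)"
      using E(1) F(1) by (rule finite_measure_Union')
    moreover have "measure (M n) (F n - E n) = measure (M n) (F n) - measure (M n) (F n \<inter> E n)"
      using E(1) F(1) by (intro finite_measure_Diff')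
    moreover have "measure (M n) (E n \<union> F n) \<le> 1" by simp
    ultimately show ?thesis by (simp add: Int_commute)
  qed
  have "(\<lambda>n. measure (M n) (E n \<inter> F n)) \<longlonglongrightarrow> 1"
  proof (rule tendsto_sandwich)
    show "(\<lambda>n. measure (M n) (E n) + measure (M n) (F n) - 1) \<longlonglongrightarrow> 1"
      using tendsto_diff[OF tendsto_add[OF E(3) F(3)] tendsto_const[of 1]] by simp
    show "\<forall>\<^sub>F n in sequentially. measure (M n) (E n \<inter> F n) \<le> 1"
      using prob_space.prob_le_1[OF M] by simp
  qed (use low in auto)
  then show ?thesis
    unfolding whp_def using E F by (intro exI[of _ "\<lambda>n. E n \<inter> F n"]) auto
qed

lemma whp_mono:
  assumes "whp M P" and "\<forall>\<^sub>F n in sequentially. \<forall>\<omega>\<in>space (M n). P n \<omega> \<longrightarrow> Q n \<omega>"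
  shows "whp M Q"
proof -
  obtain E where E: "\<And>n. E n \<in> sets (M n)" "\<And>n \<omega>. \<omega> \<in> E n \<Longrightarrow> P n \<omega>"
    "(\<lambda>n. measure (M n) (E n)) \<longlonglongrightarrow> 1" using assms(1) unfolding whp_def by blast
  obtain n0 where n0: "\<And>n \<omega>. n \<ge> n0 \<Longrightarrow> \<omega> \<in> space (M n) \<Longrightarrow> P n \<omega> \<Longrightarrow> Q n \<omega>"
    using assms(2) unfolding eventually_sequentially by blast
  \<comment> \<open>\<open>whp\<close> asks for \<open>Q\<close> on the witness at every index, so
    the witness is emptied where the implication may fail; the limit of the measures is
    unaffected.\<close>
  define F where "F n = (if n \<ge> n0 then E n else {})" for n
  have "(\<lambda>n. measure (M n) (F n)) \<longlonglongrightarrow> 1"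
    using E(3) by (rule Lim_transform_eventually)
      (auto simp: F_def eventually_sequentially intro!: exI[of _ n0])
  moreover have "F n \<in> sets (M n)" for n using E(1) by (simp add: F_def)
  moreover have "Q n \<omega>" if "\<omega> \<in> F n" for n \<omega>
    using that E(2) n0 sets.sets_into_space[OF E(1)[of n]] by (auto simp: F_def split: if_splits)
  ultimately show ?thesis unfolding whp_def by blast
qed

text \<open>The complement of a measurable null set containing all exceptions is a witness, even if
  \<open>Q\<close> itself is not measurable.\<close>

lemma whp_AE:
  assumes M: "\<And>n. prob_space (M n)" and "\<And>n. AE \<omega> in M n. Q n \<omega>"
  shows "whp M Q"
proof -
  have "\<exists>E\<in>sets (M n). (\<forall>\<omega>\<in>E. Q n \<omega>) \<and> measure (M n) E = 1" for n
  proof -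
    interpret prob_space "M n" by (rule M)
    obtain N where N: "{\<omega> \<in> space (M n). \<not> Q n \<omega>} \<subseteq> N" "emeasure (M n) N = 0" "N \<in> sets (M n)"
      using assms(2)[of n] by (rule AE_E)
    have "measure (M n) (space (M n) - N) = 1"
      using N(2,3) by (subst prob_compl) (auto simp: measure_def)
    then show ?thesis using N by (intro bexI[of _ "space (M n) - N"]) auto
  qed
  then obtain E where "\<And>n. E n \<in> sets (M n) \<and> (\<forall>\<omega>\<in>E n. Q n \<omega>) \<and> measure (M n) (E n) = 1"
    by metis
  then show ?thesis unfolding whp_def by (intro exI[of _ E]) auto
qed

text \<open>The index set may grow with \<open>n\<close>: it will consist of all cells or all
  strips, so \<open>b\<close> has to decay faster than their number grows.\<close>

lemma whp_union_bound:
  assumes M: "\<And>n. prob_space (M n)" and fin: "\<And>n. finite (I n)"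
    and sets: "\<And>n i. {\<omega> \<in> space (M n). \<not> Q n i \<omega>} \<in> sets (M n)"
    and le: "\<forall>\<^sub>F n in sequentially. \<forall>i\<in>I n. measure (M n) {\<omega> \<in> space (M n). \<not> Q n i \<omega>} \<le> b n"
    and lim: "(\<lambda>n. real (card (I n)) * b n) \<longlonglongrightarrow> 0"
  shows "whp M (\<lambda>n \<omega>. \<forall>i\<in>I n. Q n i \<omega>)"
proof -
  define B where "B n = (\<Union>i\<in>I n. {\<omega> \<in> space (M n). \<not> Q n i \<omega>})" for n
  have B: "B n \<in> sets (M n)" for n
    unfolding B_def using fin sets by (intro sets.finite_UN) auto
  have le': "\<forall>\<^sub>F n in sequentially. measure (M n) (B n) \<le> real (card (I n)) * b n"
    using le
  proof eventually_elim
    case (elim n)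
    interpret prob_space "M n" by (rule M)
    have "measure (M n) (B n) \<le> (\<Sum>i\<in>I n. measure (M n) {\<omega> \<in> space (M n). \<not> Q n i \<omega>})"
      unfolding B_def using fin sets by (intro finite_measure_subadditive_finite) auto
    also have "\<dots> \<le> (\<Sum>i\<in>I n. b n)" using elim by (intro sum_mono) auto
    finally show ?case by simp
  qed
  have "(\<lambda>n. measure (M n) (B n)) \<longlonglongrightarrow> 0"
    by (rule tendsto_sandwich[OF _ le' tendsto_const lim]) simp
  then have "(\<lambda>n. 1 - measure (M n) (B n)) \<longlonglongrightarrow> 1 - 0" by (intro tendsto_intros)
  moreover have "1 - measure (M n) (B n) = measure (M n) (space (M n) - B n)" for n
    using prob_space.prob_compl[OF M B] by simp
  ultimately show ?thesis
    unfolding whp_def using B by (intro exI[of _ "\<lambda>n. space (M n) - B n"]) (auto simp: B_def)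
qed

lemma whp_single_bound:
  assumes "\<And>n. prob_space (M n)"
    and "\<And>n. {\<omega> \<in> space (M n). \<not> Q n \<omega>} \<in> sets (M n)"
    and "\<forall>\<^sub>F n in sequentially. measure (M n) {\<omega> \<in> space (M n). \<not> Q n \<omega>} \<le> b n"
    and "b \<longlonglongrightarrow> 0"
  shows "whp M Q"
  using whp_union_bound[of M "\<lambda>_. {()}" "\<lambda>n _. Q n" b] assms by simp

text \<open>A bound on a deterministic quantity such as \<open>lam n\<close> can be read off from a
  single outcome for each large \<open>n\<close>; this supplies the outcome.\<close>

lemma whp_eventually_ex:
  assumes "whp M Q"
  shows "\<forall>\<^sub>F n in sequentially. \<exists>\<omega>\<in>space (M n). Q n \<omega>"
proof -
  obtain E where E: "\<And>n. E n \<in> sets (M n)" "\<And>n \<omega>. \<omega> \<in> E n \<Longrightarrow> Q n \<omega>"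
    "(\<lambda>n. measure (M n) (E n)) \<longlonglongrightarrow> 1" using assms unfolding whp_def by blast
  have "\<forall>\<^sub>F n in sequentially. measure (M n) (E n) > 0"
    using E(3) by (rule order_tendstoD) simp
  then show ?thesis
  proof eventually_elim
    case (elim n)
    then have "E n \<noteq> {}" by auto
    then show ?case using E(2) sets.sets_into_space[OF E(1)[of n]] by auto
  qed
qed

lemma measure_pair_fst:
  assumes "prob_space M" "prob_space N" "E \<in> sets M"
  shows "measure (M \<Otimes>\<^sub>M N) (E \<times> space N) = measure M E"
proof -
  interpret N: prob_space N by fact
  interpret M: prob_space M by fact
  show ?thesis
    using assms(3) by (simp add: measure_def N.emeasure_pair_measure_Times N.emeasure_space_1)
qed

lemma whp_pair_fst:
  assumes "\<And>n. prob_space (M n)" "\<And>n. prob_space (N n)" and "whp M Q"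
  shows "whp (\<lambda>n. M n \<Otimes>\<^sub>M N n) (\<lambda>n \<omega>. Q n (fst \<omega>))"
proof -
  obtain E where E: "\<And>n. E n \<in> sets (M n)" "\<And>n \<omega>. \<omega> \<in> E n \<Longrightarrow> Q n \<omega>"
    "(\<lambda>n. measure (M n) (E n)) \<longlonglongrightarrow> 1" using assms(3) unfolding whp_def by blast
  then show ?thesis
    unfolding whp_def
    by (intro exI[of _ "\<lambda>n. E n \<times> space (N n)"])
      (auto simp: measure_pair_fst[OF assms(1,2)])
qed

subsection \<open>Poisson networks\<close>

abbreviation unit_square :: "point set" where
  "unit_square \<equiv> {0..<1} \<times> {0..<1}"

definition unif :: "point measure" where
  "unif = uniform_measure lborel unit_square"

lemma sets_unif [simp, measurable_cong]: "sets unif = sets borel"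
  by (simp add: unif_def)

lemma space_unif [simp]: "space unif = UNIV"
  by (simp add: unif_def)

abbreviation points :: "(nat \<Rightarrow> point) measure" where
  "points \<equiv> \<Pi>\<^sub>M i\<in>UNIV. unif"

lemma rect_in_borel [measurable]: "{a..<b} \<times> {c..<d} \<in> sets (borel :: point measure)"
  unfolding borel_prod[symmetric] by measurable

lemma emeasure_lborel_rect:
  assumes "a \<le> b" "c \<le> d"
  shows "emeasure lborel ({a..<b} \<times> {c..<d} :: point set) = ennreal ((b - a) * (d - c))"
  using assms by (subst lborel_prod[symmetric], subst lborel.emeasure_pair_measure_Times)
    (auto simp: ennreal_mult)

lemma prob_space_unif: "prob_space unif"
  unfolding unif_def by (rule prob_space_uniform_measure) (simp_all add: emeasure_lborel_rect)

interpretation unif: prob_space unif by (rule prob_space_unif)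

interpretation points: product_prob_space "\<lambda>_. unif" "UNIV :: nat set" ..

lemma measure_unif_rect:
  assumes "0 \<le> a" "a \<le> b" "b \<le> 1" "0 \<le> c" "c \<le> d" "d \<le> 1"
  shows "measure unif ({a..<b} \<times> {c..<d}) = (b - a) * (d - c)"
proof -
  have "unit_square \<inter> ({a..<b} \<times> {c..<d}) = {a..<b} \<times> {c..<d}" using assms by auto
  then have "emeasure unif ({a..<b} \<times> {c..<d}) = ennreal ((b - a) * (d - c))"
    using assms unfolding unif_def by (simp add: emeasure_lborel_rect divide_ennreal_def)
  then show ?thesis using assms by (simp add: measure_def)
qed

lemma AE_unif: "AE x in unif. x \<in> unit_square"
  unfolding unif_def by (rule AE_uniform_measureI) auto

lemma space_points [simp]: "space points = UNIV"
  by (simp add: space_PiM PiE_def)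

text \<open>Independence means that the joint law is the product of the marginals, and the joint map
  of all projections is the identity.\<close>

lemma indep_points: "points.indep_vars (\<lambda>_. unif) (\<lambda>i X. X i) UNIV"
proof -
  have "distr points points (\<lambda>X. \<lambda>i\<in>UNIV. X i) = points"
    by (simp add: restrict_UNIV distr_id2)
  moreover have "distr points unif (\<lambda>X. X i) = unif" for i
    by (rule points.PiM_component) simp
  ultimately show ?thesis
    by (subst points.indep_vars_iff_distr_eq_PiM) auto
qed

lemma nn_integral_points_component:
  assumes [measurable]: "h \<in> borel_measurable borel"
  shows "(\<integral>\<^sup>+X. h (X i) \<partial>points) = (\<integral>\<^sup>+x. h x \<partial>unif)"
  using assms by (subst (2) points.PiM_component[symmetric, of i], simp)
    (subst nn_integral_distr, auto)

lemma nn_integral_points_prod: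
  fixes h :: "point \<Rightarrow> ennreal"
  assumes [measurable]: "h \<in> borel_measurable borel"
  shows "(\<integral>\<^sup>+X. (\<Prod>u<N. h (X u)) \<partial>points) = (\<integral>\<^sup>+x. h x \<partial>unif) ^ N"
proof -
  have "points.indep_vars (\<lambda>_. borel) (\<lambda>i X. h (X i)) UNIV"
    by (rule points.indep_vars_compose2[OF indep_points]) measurable
  then have "points.indep_vars (\<lambda>_. borel) (\<lambda>i X. h (X i)) {..<N}"
    by (rule points.indep_vars_subset) simp
  then have "(\<integral>\<^sup>+X. (\<Prod>u<N. h (X u)) \<partial>points) = (\<Prod>u<N. \<integral>\<^sup>+X. h (X u) \<partial>points)"
    by (intro points.indep_vars_nn_integral) auto
  then show ?thesis by (simp add: nn_integral_points_component)
qed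

text \<open>Different pairs use disjoint index blocks \<open>{2 * i, 2 * i + 1}\<close>, and
  restrictions to disjoint blocks are independent.\<close>

lemma nn_integral_points_pair_prod:
  fixes h :: "point \<Rightarrow> point \<Rightarrow> ennreal"
  assumes [measurable]: "case_prod h \<in> borel_measurable (borel \<Otimes>\<^sub>M borel)"
    and I: "\<And>i. (\<integral>\<^sup>+X. h (X (2 * i)) (X (2 * i + 1)) \<partial>points) = I"
  shows "(\<integral>\<^sup>+X. (\<Prod>i<N. h (X (2 * i)) (X (2 * i + 1))) \<partial>points) = I ^ N"
proof -
  let ?K = "\<lambda>i::nat. {2 * i, 2 * i + 1}"
  have "points.indep_vars (\<lambda>j. PiM (?K j) (\<lambda>_. unif)) (\<lambda>j X. restrict (\<lambda>i. X i) (?K j)) {..<N}"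
    by (rule points.indep_vars_restrict[OF indep_points])
      (simp, unfold disjoint_family_on_def, safe, (simp | presburger)+)
  then have "points.indep_vars (\<lambda>_. borel)
      (\<lambda>j X. (\<lambda>Y. h (Y (2 * j)) (Y (2 * j + 1))) (restrict (\<lambda>i. X i) (?K j))) {..<N}"
    by (rule points.indep_vars_compose2) measurable
  then have "points.indep_vars (\<lambda>_. borel) (\<lambda>i X. h (X (2 * i)) (X (2 * i + 1))) {..<N}"
    by simp
  then have "(\<integral>\<^sup>+X. (\<Prod>i<N. h (X (2 * i)) (X (2 * i + 1))) \<partial>points) =
      (\<Prod>i<N. \<integral>\<^sup>+X. h (X (2 * i)) (X (2 * i + 1)) \<partial>points)"
    by (intro points.indep_vars_nn_integral) auto
  then show ?thesis by (simp only: I prod_constant card_lessThan)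
qed

lemma prob_points_pair:
  assumes "S \<in> sets borel" "T \<in> sets borel" "i \<noteq> j"
  shows "emeasure points {X. X i \<in> S \<and> X j \<in> T} = ennreal (measure unif S * measure unif T)"
proof -
  have "emeasure points {X\<in>space points. \<forall>k\<in>{i,j}. X k \<in> (if k = i then S else T)} =
     (\<Prod>k\<in>{i,j}. emeasure unif (if k = i then S else T))"
    using assms by (intro points.emeasure_PiM_Collect) auto
  moreover have "{X\<in>space points. \<forall>k\<in>{i,j}. X k \<in> (if k = i then S else T)} = {X. X i \<in> S \<and> X j \<in> T}"
    using assms by auto
  ultimately show ?thesis using assms(3)
    by (simp add: unif.emeasure_eq_measure ennreal_mult)
qed

text \<open>Two coordinates have joint law \<open>unif \<Otimes>\<^sub>M unif\<close>; each section
  of the diagonal is a single point, hence null, and Fubini's theorem applies.\<close>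

lemma AE_points_distinct:
  assumes "i \<noteq> j" shows "AE X in points. X i \<noteq> X j"
proof -
  have iv: "points.indep_var unif (\<lambda>X. X i) unif (\<lambda>X. X j)"
  proof -
    have "points.indep_var (PiM {i} (\<lambda>_. unif)) (\<lambda>X. restrict (\<lambda>k. X k) {i})
       (PiM {j} (\<lambda>_. unif)) (\<lambda>X. restrict (\<lambda>k. X k) {j})"
      using assms by (intro points.indep_var_restrict[OF indep_points]) auto
    then have "points.indep_var unif ((\<lambda>Y. Y i) \<circ> (\<lambda>X. restrict (\<lambda>k. X k) {i}))
       unif ((\<lambda>Y. Y j) \<circ> (\<lambda>X. restrict (\<lambda>k. X k) {j}))"
      by (rule points.indep_var_compose) auto
    then show ?thesis by (simp add: comp_def)
  qed
  then have eq: "distr points (unif \<Otimes>\<^sub>M unif) (\<lambda>X. (X i, X j)) = unif \<Otimes>\<^sub>M unif"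
    by (subst (asm) points.indep_var_distribution_eq) (simp add: points.PiM_component)
  have "AE y in unif. x \<noteq> y" for x
    unfolding unif_def
  proof (rule AE_uniform_measureI)
    have "AE y in lborel. y \<noteq> x" by (rule AE_lborel_singleton)
    then show "AE y in lborel. y \<in> unit_square \<longrightarrow> x \<noteq> y" by eventually_elim auto
  qed simp
  then have "AE x in unif. AE y in unif. fst (x, y) \<noteq> snd (x, y)" by simp
  then have "AE p in unif \<Otimes>\<^sub>M unif. fst p \<noteq> snd p"
  proof (rule pair_sigma_finite.AE_pair_measure[rotated 2])
    show "pair_sigma_finite unif unif" ..
    have "(\<lambda>p :: point \<times> point. fst p \<noteq> snd p) \<in> measurable (borel \<Otimes>\<^sub>M borel) (count_space UNIV)" by measurable
    moreover have "measurable (borel \<Otimes>\<^sub>M borel) (count_space UNIV :: bool measure) =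
        measurable (unif \<Otimes>\<^sub>M unif) (count_space UNIV)"
      by (intro measurable_cong_sets sets_pair_measure_cong) simp_all
    ultimately show "{x \<in> space (unif \<Otimes>\<^sub>M unif). fst x \<noteq> snd x} \<in> sets (unif \<Otimes>\<^sub>M unif)"
      by (simp add: pred_def)
  qed
  then have "AE p in distr points (unif \<Otimes>\<^sub>M unif) (\<lambda>X. (X i, X j)). fst p \<noteq> snd p"
    by (simp only: eq)
  then have "AE X in points. fst (X i, X j) \<noteq> snd (X i, X j)"
    by (rule AE_distrD[rotated]) auto
  then show ?thesis by simp
qed

lemma prob_space_poisson_net: "prob_space (poisson_net d)"
  unfolding poisson_net_def unif_def[symmetric]
  by (intro prob_space_pair prob_space_measure_pmf points.P.prob_space_axioms)

lemma prob_space_overlay: "prob_space (overlay_space p n)"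
  unfolding overlay_space_def by (intro prob_space_pair prob_space_poisson_net)

lemma space_poisson_net [simp]: "space (poisson_net d) = UNIV"
  by (simp add: poisson_net_def unif_def[symmetric] space_pair_measure)

text \<open>The number of nodes is discrete, so measurability has to be checked only for each fixed
  number.\<close>

lemma measurable_poisson_net:
  assumes "\<And>N. (\<lambda>X. f (N, X)) \<in> measurable points K"
  shows "f \<in> measurable (poisson_net d) K"
proof -
  have "f \<in> measurable (count_space UNIV \<Otimes>\<^sub>M points) K"
    using assms by (intro measurable_pair_measure_countable1) auto
  moreover have "measurable (poisson_net d) K = measurable (count_space UNIV \<Otimes>\<^sub>M points) K"
    unfolding poisson_net_def unif_def[symmetric] by (intro measurable_cong_sets sets_pair_measure_cong) simp_all
  ultimately show ?thesis by simp
qed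

lemma nn_integral_poisson_net:
  assumes "\<And>N. (\<lambda>X. f (N, X)) \<in> borel_measurable points"
  shows "(\<integral>\<^sup>+w. f w \<partial>poisson_net d) =
    (\<integral>\<^sup>+N. (\<integral>\<^sup>+X. f (N, X) \<partial>points) \<partial>measure_pmf (poisson_pmf d))"
  using measurable_poisson_net[of f borel d] assms unfolding poisson_net_def unif_def[symmetric]
  by (subst points.P.nn_integral_fst) auto

text \<open>The probability generating function of the Poisson law; all tail bounds below come from
  it.\<close>

lemma nn_integral_poisson_power:
  assumes "d > 0" "z \<ge> 0"
  shows "(\<integral>\<^sup>+N. ennreal z ^ N \<partial>measure_pmf (poisson_pmf d)) = ennreal (exp (d * (z - 1)))"
proof -
  have s: "(\<lambda>N. (d * z) ^ N / fact N) sums exp (d * z)"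
    using exp_converges[of "d * z"] by (simp add: field_simps)
  then have s': "(\<lambda>N. exp (- d) * ((d * z) ^ N / fact N)) sums (exp (- d) * exp (d * z))"
    by (rule sums_mult)
  have "(\<integral>\<^sup>+N. ennreal z ^ N \<partial>measure_pmf (poisson_pmf d)) =
     (\<Sum>N. ennreal (exp (- d) * ((d * z) ^ N / fact N)))"
    using assms unfolding nn_integral_measure_pmf nn_integral_count_space_nat
    by (simp add: ennreal_power ennreal_mult[symmetric] power_mult_distrib field_simps)
  also have "\<dots> = ennreal (exp (- d) * exp (d * z))"
    using assms s' by (subst suminf_ennreal2) (auto simp: sums_iff)
  finally show ?thesis by (simp add: exp_add[symmetric] algebra_simps)
qed

section \<open>Counts of nodes and pairs in given regions: generating functions and tail
  bounds\<close>

definition node_count :: "point set \<Rightarrow> net \<Rightarrow> nat" where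
  "node_count S w = card {u. u < fst w \<and> pos w u \<in> S}"

definition pair_count :: "point set \<Rightarrow> point set \<Rightarrow> net \<Rightarrow> nat" where
  "pair_count S T w = card {i. i < num_pairs w \<and> pos w (2 * i) \<in> S \<and> pos w (2 * i + 1) \<in> T}"

lemma measurable_node_count [measurable]:
  assumes [measurable]: "S \<in> sets borel"
  shows "node_count S \<in> measurable (poisson_net d) (count_space UNIV)"
  unfolding node_count_def pos_def
  by (rule measurable_poisson_net) simp

lemma measurable_pair_count [measurable]:
  assumes [measurable]: "S \<in> sets borel" "T \<in> sets borel"
  shows "pair_count S T \<in> measurable (poisson_net d) (count_space UNIV)"
  unfolding pair_count_def pos_def num_pairs_def
  by (rule measurable_poisson_net) simp

lemma prod_if_power_card:
  "(\<Prod>u<N::nat. if P u then a else (1::'a::comm_monoid_mult)) = a ^ card {u. u < N \<and> P u}"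
  by (subst prod.If_cases) (auto simp: lessThan_def Collect_conj_eq Int_commute)

lemma nn_integral_points_power_card:
  assumes [measurable]: "S \<in> sets borel" and "a \<ge> 0"
  shows "(\<integral>\<^sup>+X. ennreal a ^ card {u. u < N \<and> X u \<in> S} \<partial>points) =
    ennreal (1 + (a - 1) * measure unif S) ^ N"
proof -
  have "(\<integral>\<^sup>+x. (if x \<in> S then ennreal a else 1) \<partial>unif) =
    (\<integral>\<^sup>+x. ennreal a * indicator S x + indicator (space unif - S) x \<partial>unif)"
    by (intro nn_integral_cong) (auto simp: indicator_def)
  also have "\<dots> = ennreal a * emeasure unif S + emeasure unif (space unif - S)"
    by (subst nn_integral_add) (auto simp: nn_integral_cmult_indicator)
  also have "\<dots> = ennreal (a * measure unif S + (1 - measure unif S))"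
    using assms by (subst (2) unif.emeasure_eq_measure, subst unif.prob_compl)
      (auto simp: unif.emeasure_eq_measure ennreal_mult ennreal_plus)
  also have "a * measure unif S + (1 - measure unif S) = 1 + (a - 1) * measure unif S"
    by (simp add: algebra_simps)
  finally show ?thesis
    unfolding prod_if_power_card[symmetric]
    by (subst nn_integral_points_prod[where h="\<lambda>x. if x \<in> S then ennreal a else 1"]) auto
qed

text \<open>Given the number of nodes the count is binomial; averaging its generating function over
  the Poisson number gives that of a Poisson variable with mean
  \<open>d * measure unif S\<close>.\<close>

lemma node_count_mgf:
  assumes [measurable]: "S \<in> sets borel" and "a \<ge> 0" "d > 0"
  shows "(\<integral>\<^sup>+w. ennreal a ^ node_count S w \<partial>poisson_net d) =
    ennreal (exp (d * (a - 1) * measure unif S))"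
proof -
  have "0 \<le> 1 + (a - 1) * measure unif S"
  proof -
    have "0 \<le> a * measure unif S" using assms by simp
    then show ?thesis using unif.prob_le_1[of S] unfolding left_diff_distrib by linarith
  qed
  moreover have "(\<integral>\<^sup>+w. ennreal a ^ node_count S w \<partial>poisson_net d) =
    (\<integral>\<^sup>+N. ennreal (1 + (a - 1) * measure unif S) ^ N \<partial>measure_pmf (poisson_pmf d))"
    using assms unfolding node_count_def pos_def
    by (subst nn_integral_poisson_net) (auto simp: nn_integral_points_power_card)
  ultimately show ?thesis
    using assms by (simp add: nn_integral_poisson_power algebra_simps)
qed

text \<open>Markov's inequality, stated for any majorant of the indicator of
  \<open>A\<close>.\<close>

lemma (in prob_space) prob_le_of_nn_integral:
  fixes g :: "'a \<Rightarrow> ennreal"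
  assumes [measurable]: "g \<in> borel_measurable M" and A: "A \<in> sets M"
    and ge: "\<And>\<omega>. \<omega> \<in> A \<Longrightarrow> 1 \<le> g \<omega>" and le: "(\<integral>\<^sup>+\<omega>. g \<omega> \<partial>M) \<le> ennreal b" "0 \<le> b"
  shows "prob A \<le> b"
proof -
  have "emeasure M A = (\<integral>\<^sup>+\<omega>. indicator A \<omega> \<partial>M)" using A by simp
  also have "\<dots> \<le> (\<integral>\<^sup>+\<omega>. g \<omega> \<partial>M)" using ge by (intro nn_integral_mono) (auto simp: indicator_def)
  finally have "emeasure M A \<le> ennreal b" using le by simp
  then show ?thesis using le by (simp add: emeasure_eq_measure)
qed

text \<open>Chernoff bound with exponential weight 1: for mean \<open>m\<close> it gives
  \<open>exp (- 3 * m) * exp ((exp 1 - 1) * m)\<close>, and \<open>exp 1 \<le> 3\<close> leaves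
  \<open>exp (- m)\<close>.\<close>

lemma node_count_upper_tail:
  assumes [measurable]: "S \<in> sets borel" and "d > 0"
  shows "measure (poisson_net d) {w. \<not> real (node_count S w) \<le> 3 * (d * measure unif S)}
     \<le> exp (- (d * measure unif S))"
proof -
  interpret prob_space "poisson_net d" by (rule prob_space_poisson_net)
  define m where "m = d * measure unif S"
  have m: "m \<ge> 0" using assms by (simp add: m_def)
  show ?thesis unfolding m_def[symmetric]
  proof (rule prob_le_of_nn_integral)
    show "(\<lambda>w. ennreal (exp (- 3 * m)) * ennreal (exp 1) ^ node_count S w) \<in> borel_measurable (poisson_net d)"
      by measurable
    have "{w \<in> space (poisson_net d). \<not> real (node_count S w) \<le> 3 * m} \<in> sets (poisson_net d)"
      by measurable
    then show "{w. \<not> real (node_count S w) \<le> 3 * m} \<in> sets (poisson_net d)" by simp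
    show "1 \<le> ennreal (exp (- 3 * m)) * ennreal (exp 1) ^ node_count S w"
      if "w \<in> {w. \<not> real (node_count S w) \<le> 3 * m}" for w
      using that by (simp add: ennreal_power ennreal_mult[symmetric] exp_of_nat_mult[symmetric] exp_add[symmetric])
    have "exp (d * (exp 1 - 1) * measure unif S) \<le> exp (2 * m)"
      using m exp_le mult_right_mono[of "exp 1 - 1" 2 m] by (simp add: m_def algebra_simps)
    then have "exp (- 3 * m) * exp (d * (exp 1 - 1) * measure unif S) \<le> exp (- 3 * m) * exp (2 * m)"
      by (rule mult_left_mono) simp
    also have "\<dots> = exp (- m)" by (simp add: exp_add[symmetric])
    finally show "(\<integral>\<^sup>+w. ennreal (exp (- 3 * m)) * ennreal (exp 1) ^ node_count S w \<partial>poisson_net d) \<le> ennreal (exp (- m))"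
      using assms by (subst nn_integral_cmult) (auto simp: node_count_mgf ennreal_mult[symmetric] ennreal_leI)
  qed simp
qed

text \<open>\<open>0 ^ k\<close> is the indicator of \<open>k = 0\<close>, so the generating
  function at 0 is the void probability.\<close>

lemma prob_node_count_eq_0:
  assumes [measurable]: "S \<in> sets borel" and "d > 0"
  shows "measure (poisson_net d) {w. node_count S w = 0} \<le> exp (- (d * measure unif S))"
proof -
  interpret prob_space "poisson_net d" by (rule prob_space_poisson_net)
  show ?thesis
  proof (rule prob_le_of_nn_integral)
    show "(\<lambda>w. ennreal 0 ^ node_count S w) \<in> borel_measurable (poisson_net d)" by measurable
    have "{w \<in> space (poisson_net d). node_count S w = 0} \<in> sets (poisson_net d)"
      by measurable
    then show "{w. node_count S w = 0} \<in> sets (poisson_net d)" by simp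
    show "(\<integral>\<^sup>+w. ennreal 0 ^ node_count S w \<partial>poisson_net d) \<le> ennreal (exp (- (d * measure unif S)))"
      using assms node_count_mgf[of S 0 d] by simp
  qed auto
qed

lemma nn_integral_points_power_pair_card:
  assumes [measurable]: "S \<in> sets borel" "T \<in> sets borel" and "a \<ge> 0"
  shows "(\<integral>\<^sup>+X. ennreal a ^ card {i. i < N \<and> X (2 * i) \<in> S \<and> X (2 * i + 1) \<in> T} \<partial>points) =
    ennreal (1 + (a - 1) * (measure unif S * measure unif T)) ^ N"
proof -
  define m where "m = measure unif S * measure unif T"
  have one: "(\<integral>\<^sup>+X. (if X (2 * i) \<in> S \<and> X (2 * i + 1) \<in> T then ennreal a else 1) \<partial>points) =
     ennreal (1 + (a - 1) * m)" for i
  proof -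
    define A where "A = {X. X (2 * i) \<in> S \<and> X (2 * i + 1) \<in> T}"
    have "{X\<in>space points. X (2 * i) \<in> S \<and> X (2 * i + 1) \<in> T} \<in> sets points" by measurable
    then have A [measurable]: "A \<in> sets points" by (simp add: A_def)
    have B: "UNIV - A \<in> sets points" using sets.compl_sets[OF A] by simp
    have pA: "measure points A = m" unfolding measure_def[of points] m_def A_def
      by (subst prob_points_pair) auto
    have "(\<integral>\<^sup>+X. (if X (2 * i) \<in> S \<and> X (2 * i + 1) \<in> T then ennreal a else 1) \<partial>points) =
      (\<integral>\<^sup>+X. ennreal a * indicator A X + indicator (space points - A) X \<partial>points)"
      by (intro nn_integral_cong) (auto simp: indicator_def A_def)
    also have "\<dots> = ennreal a * emeasure points A + emeasure points (space points - A)"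
      by (subst nn_integral_add) (use B in \<open>auto simp: nn_integral_cmult_indicator\<close>)
    also have "\<dots> = ennreal (a * m + (1 - m))"
    proof -
      have "m \<le> 1" "0 \<le> m" using pA points.P.prob_le_1[of A] measure_nonneg[of points A] by auto
      then show ?thesis
        using assms A unfolding points.P.emeasure_eq_measure points.P.prob_compl[OF A] pA
        by (simp add: ennreal_mult ennreal_plus)
    qed
    also have "a * m + (1 - m) = 1 + (a - 1) * m" by (simp add: algebra_simps)
    finally show ?thesis .
  qed
  show ?thesis unfolding prod_if_power_card[symmetric] m_def[symmetric]
    using one by (subst nn_integral_points_pair_prod
      [where h="\<lambda>x y. if x \<in> S \<and> y \<in> T then ennreal a else 1"]) auto
qed

text \<open>Chernoff bound with base 1/2. Given \<open>N\<close> nodes there are only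
  \<open>N div 2\<close> trials, so the count is not Poisson; comparison with \<open>z ^ N\<close>,
  where \<open>z\<^sup>2 = 1 - m / 2\<close>, brings back the Poisson generating function. From
  \<open>z - 1 \<le> - m / 4\<close> follows \<open>2 * exp (- 2 * b)\<close>, and the weight
  \<open>exp b\<close> for the threshold \<open>b\<close> uses up half of the exponent.\<close>

lemma pair_count_lower_tail:
  assumes [measurable]: "S \<in> sets borel" "T \<in> sets borel" and "d > 0"
  shows "measure (poisson_net d)
      {w. \<not> d * (measure unif S * measure unif T) / 8 \<le> real (pair_count S T w)}
     \<le> 2 * exp (- (d * (measure unif S * measure unif T) / 8))"
proof -
  interpret prob_space "poisson_net d" by (rule prob_space_poisson_net)
  define m where "m = measure unif S * measure unif T"
  define b where "b = d * m / 8"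
  have m: "0 \<le> m" "m \<le> 1" unfolding m_def by (auto intro: mult_le_one)
  have b: "b \<ge> 0" using m assms by (simp add: b_def)
  define z where "z = sqrt (1 - m / 2)"
  have z: "1 / 2 \<le> z" "z \<le> 1 - m / 4"
  proof -
    show "1 / 2 \<le> z" unfolding z_def using m by (intro real_le_rsqrt) (simp add: power2_eq_square)
    show "z \<le> 1 - m / 4" unfolding z_def using m
      by (intro real_le_lsqrt) (auto simp: power2_eq_square algebra_simps)
  qed
  \<comment> \<open>For odd \<open>N\<close> one node is unpaired and one factor \<open>z\<close> is
    missing on the left; \<open>1 \<le> 2 * z\<close> pays for it.\<close>
  have pw: "(1 - m / 2) ^ (N div 2) \<le> 2 * z ^ N" for N
  proof -
    have z2: "z\<^sup>2 = 1 - m / 2" using m by (simp add: z_def)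
    have "(1 - m / 2) ^ (N div 2) = z ^ (2 * (N div 2))" by (simp add: power_mult z2)
    also have "\<dots> \<le> 2 * z ^ N"
    proof (cases "even N")
      case False
      then have "N = Suc (2 * (N div 2))" by presburger
      then have "2 * z ^ N = (2 * z) * z ^ (2 * (N div 2))" by (metis mult.assoc power_Suc)
      then show ?thesis using z mult_right_mono[of 1 "2 * z" "z ^ (2 * (N div 2))"] by simp
    qed (use z in auto)
    finally show ?thesis .
  qed
  have mgf: "(\<integral>\<^sup>+w. ennreal (1 / 2) ^ pair_count S T w \<partial>poisson_net d) \<le> ennreal (2 * exp (- 2 * b))"
  proof -
    have "(\<integral>\<^sup>+w. ennreal (1 / 2) ^ pair_count S T w \<partial>poisson_net d) =
      (\<integral>\<^sup>+N. ennreal (1 + (1 / 2 - 1) * m) ^ (N div 2) \<partial>measure_pmf (poisson_pmf d))"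
      unfolding pair_count_def pos_def num_pairs_def m_def
      by (subst nn_integral_poisson_net)
        (use nn_integral_points_power_pair_card[OF assms(1,2), of "1 / 2"] in auto)
    also have "\<dots> \<le> (\<integral>\<^sup>+N. ennreal 2 * ennreal z ^ N \<partial>measure_pmf (poisson_pmf d))"
      using pw z m by (intro nn_integral_mono)
        (auto simp: ennreal_power ennreal_mult[symmetric] simp del: ennreal_numeral intro!: ennreal_leI)
    also have "\<dots> = ennreal (2 * exp (d * (z - 1)))"
      using z assms by (subst nn_integral_cmult)
        (auto simp: nn_integral_poisson_power ennreal_mult simp del: ennreal_numeral)
    also have "\<dots> \<le> ennreal (2 * exp (- 2 * b))"
      using z assms mult_left_mono[of "z - 1" "- m / 4" d] by (intro ennreal_leI) (simp add: b_def)
    finally show ?thesis .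
  qed
  show ?thesis unfolding m_def[symmetric] unfolding b_def[symmetric]
  proof (rule prob_le_of_nn_integral)
    show "(\<lambda>w. ennreal (exp b) * ennreal (1 / 2) ^ pair_count S T w) \<in> borel_measurable (poisson_net d)"
      by measurable
    have "{w \<in> space (poisson_net d). \<not> b \<le> real (pair_count S T w)} \<in> sets (poisson_net d)"
      by measurable
    then show "{w. \<not> b \<le> real (pair_count S T w)} \<in> sets (poisson_net d)" by simp
    show "1 \<le> ennreal (exp b) * ennreal (1 / 2) ^ pair_count S T w"
      if "w \<in> {w. \<not> b \<le> real (pair_count S T w)}" for w
    proof -
      have "exp (-1) \<le> (1 / 2 :: real)" using exp_ge_add_one_self[of 1] by (simp add: exp_minus field_simps)
      then have "exp (-1) ^ pair_count S T w \<le> (1 / 2 :: real) ^ pair_count S T w"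
        by (rule power_mono) simp
      then have "exp b * exp (- real (pair_count S T w)) \<le> exp b * (1 / 2) ^ pair_count S T w"
        by (simp add: exp_of_nat_mult[symmetric])
      moreover have "1 \<le> exp b * exp (- real (pair_count S T w))"
        using that by (simp add: exp_add[symmetric])
      ultimately have "1 \<le> exp b * (1 / 2) ^ pair_count S T w" by linarith
      then show ?thesis
        by (subst ennreal_power) (auto simp: ennreal_mult[symmetric] simp del: ennreal_half ennreal_numeral)
    qed
    have "ennreal (exp b) * (\<integral>\<^sup>+w. ennreal (1 / 2) ^ pair_count S T w \<partial>poisson_net d) \<le>
        ennreal (exp b) * ennreal (2 * exp (- 2 * b))"
      using mgf by (rule mult_left_mono) simp
    also have "\<dots> = ennreal (2 * exp (- b))"
      by (simp add: ennreal_mult[symmetric] exp_add[symmetric] mult.left_commute)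
    finally show "(\<integral>\<^sup>+w. ennreal (exp b) * ennreal (1 / 2) ^ pair_count S T w \<partial>poisson_net d) \<le> ennreal (2 * exp (- b))"
      by (subst nn_integral_cmult) auto
  qed simp
qed

subsection \<open>Horizontal-then-vertical paths\<close>

definition gap :: "nat \<Rightarrow> nat \<Rightarrow> nat" where
  "gap a b = (if a \<le> b then b - a else a - b)"

definition toward :: "nat \<Rightarrow> nat \<Rightarrow> nat \<Rightarrow> nat" where
  "toward a b k = (if a \<le> b then min (a + k) b else max (a - k) b)"

definition path_len :: "cell \<Rightarrow> cell \<Rightarrow> nat" where
  "path_len a b = gap (fst a) (fst b) + gap (snd a) (snd b)"

text \<open>A closed form for entry \<open>k\<close> of \<open>hv_path\<close>:
  \<open>toward\<close> saturates at its target, and the truncated difference stays 0 during the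
  horizontal leg, so the two legs need no case distinction.\<close>

definition path_cell :: "cell \<Rightarrow> cell \<Rightarrow> nat \<Rightarrow> cell" where
  "path_cell a b k = (toward (fst a) (fst b) k, toward (snd a) (snd b) (k - gap (fst a) (fst b)))"

lemma length_steps: "length (steps a b) = gap a b"
  by (auto simp: steps_def gap_def simp del: upt_Suc)

lemma nth_steps: "k < gap a b \<Longrightarrow> steps a b ! k = toward a b k"
  by (auto simp: steps_def gap_def toward_def rev_nth simp del: upt_Suc split: if_splits)

lemma toward_0 [simp]: "toward a b 0 = a"
  by (simp add: toward_def)

lemma toward_gap: "gap a b \<le> k \<Longrightarrow> toward a b k = b"
  by (auto simp: toward_def gap_def split: if_splits)

lemma hv_path_eq: "hv_path a b = map (path_cell a b) [0..<Suc (path_len a b)]"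
proof (rule nth_equalityI)
  show "length (hv_path a b) = length (map (path_cell a b) [0..<Suc (path_len a b)])"
    by (simp add: hv_path_def length_steps path_len_def)
  fix k assume "k < length (hv_path a b)"
  then have k: "k \<le> gap (fst a) (fst b) + gap (snd a) (snd b)"
    by (simp add: hv_path_def length_steps)
  then have "map (path_cell a b) [0..<Suc (path_len a b)] ! k = path_cell a b k"
    by (simp add: path_len_def del: upt_Suc)
  moreover consider "k < gap (fst a) (fst b)"
    | "gap (fst a) (fst b) \<le> k" "k < gap (fst a) (fst b) + gap (snd a) (snd b)"
    | "k = gap (fst a) (fst b) + gap (snd a) (snd b)" using k by linarith
  then have "hv_path a b ! k = path_cell a b k"
    by cases (auto simp: hv_path_def path_cell_def nth_append length_steps nth_steps toward_gap)
  ultimately show "hv_path a b ! k = map (path_cell a b) [0..<Suc (path_len a b)] ! k" by simp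
qed

lemma nth_hv_path: "k \<le> path_len a b \<Longrightarrow> hv_path a b ! k = path_cell a b k"
  by (simp add: hv_path_eq del: upt_Suc)

lemma length_hv_path: "length (hv_path a b) = Suc (path_len a b)"
  by (simp add: hv_path_eq)

lemma hd_hv_path: "hd (hv_path a b) = a"
  by (subst hd_conv_nth) (simp_all add: hv_path_eq path_cell_def del: upt_Suc)

lemma set_inner_hv_path:
  "set (butlast (tl (hv_path a b))) = path_cell a b ` {1..<path_len a b}"
proof -
  have "butlast (tl [0..<Suc m]) = [1..<m]" for m
    by (cases "m = 0") (auto simp: tl_upt butlast_append)
  then show ?thesis
    by (simp add: hv_path_eq flip: map_tl map_butlast del: upt_Suc)
qed

lemma path_cell_0 [simp]: "path_cell a b 0 = a"
  by (simp add: path_cell_def)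

lemma path_cell_last: "path_cell a b (path_len a b) = b"
  by (simp add: path_cell_def path_len_def toward_gap)

lemma toward_inj:
  "j \<le> gap a b \<Longrightarrow> k \<le> gap a b \<Longrightarrow> toward a b j = toward a b k \<Longrightarrow> j = k"
  by (cases "a \<le> b") (simp_all add: toward_def gap_def)

lemma toward_min_gap: "toward a b k = toward a b (min k (gap a b))"
  by (cases "k \<le> gap a b") (simp_all add: toward_gap)

text \<open>The two coordinates reveal the horizontal progress \<open>min j g\<close> and the
  vertical progress \<open>j - g\<close>, whose sum is \<open>j\<close>. So a path never returns to
  a cell.\<close>

lemma path_cell_inj:
  assumes "j \<le> path_len a b" "k \<le> path_len a b" "path_cell a b j = path_cell a b k"
  shows "j = k"
proof -
  define g where "g = gap (fst a) (fst b)"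
  have 1: "toward (fst a) (fst b) j = toward (fst a) (fst b) k"
    and 2: "toward (snd a) (snd b) (j - g) = toward (snd a) (snd b) (k - g)"
    using assms(3) by (simp_all add: path_cell_def g_def)
  have "min j g = min k g"
  proof (rule toward_inj)
    show "toward (fst a) (fst b) (min j g) = toward (fst a) (fst b) (min k g)"
      using 1 by (simp only: toward_min_gap[symmetric] g_def)
  qed (simp_all add: g_def)
  moreover have "j - g = k - g"
  proof (rule toward_inj)
    show "toward (snd a) (snd b) (j - g) = toward (snd a) (snd b) (k - g)" by (rule 2)
  qed (use assms(1,2) in \<open>simp_all add: path_len_def g_def\<close>)
  ultimately show ?thesis by linarith
qed

text \<open>This holds for every \<open>k\<close>: beyond its end the path stays in the destination
  cell, which covers the single hop of a pair inside one cell.\<close>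

lemma path_cell_step:
  "\<bar>int (fst (path_cell a b (Suc k))) - int (fst (path_cell a b k))\<bar> \<le> 1"
  "\<bar>int (snd (path_cell a b (Suc k))) - int (snd (path_cell a b k))\<bar> \<le> 1"
  by (auto simp: path_cell_def toward_def gap_def)

lemma path_cell_row_or_column: "snd (path_cell a b k) = snd a \<or> fst (path_cell a b k) = fst b"
  by (cases "k \<le> gap (fst a) (fst b)") (auto simp: path_cell_def toward_gap)

lemma path_cell_in_grid:
  assumes "a \<in> {..<q} \<times> {..<q}" "b \<in> {..<q} \<times> {..<q}"
  shows "path_cell a b k \<in> {..<q} \<times> {..<q}"
  using assms by (auto simp: path_cell_def toward_def)

lemma path_len_le:
  assumes "a \<in> {..<q} \<times> {..<q}" "b \<in> {..<q} \<times> {..<q}"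
  shows "path_len a b \<le> 2 * q"
  using assms by (auto simp: path_len_def gap_def)

lemma horizontal_inner:
  assumes "fst a < x" "x < fst b"
  shows "(x, snd a) \<in> set (butlast (tl (hv_path a b)))"
  unfolding set_inner_hv_path
proof
  show "(x, snd a) = path_cell a b (x - fst a)"
    using assms by (auto simp: path_cell_def toward_def gap_def)
  show "x - fst a \<in> {1..<path_len a b}"
    using assms by (auto simp: path_len_def gap_def)
qed

lemma path_cell_1_right:
  assumes "fst a < fst b" shows "path_cell a b 1 = (Suc (fst a), snd a)"
  using assms by (auto simp: path_cell_def toward_def gap_def)

definition src_cell :: "nat \<Rightarrow> net \<Rightarrow> nat \<Rightarrow> cell" where
  "src_cell q w i = cell_of q (pos w (2 * i))"

definition dst_cell :: "nat \<Rightarrow> net \<Rightarrow> nat \<Rightarrow> cell" where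
  "dst_cell q w i = cell_of q (pos w (2 * i + 1))"

lemma route_eq: "route q w i = hv_path (src_cell q w i) (dst_cell q w i)"
  by (simp add: route_def src_cell_def dst_cell_def)

abbreviation route_len :: "nat \<Rightarrow> net \<Rightarrow> nat \<Rightarrow> nat" where
  "route_len q w i \<equiv> path_len (src_cell q w i) (dst_cell q w i)"

lemma hops_eq: "hops q w i = max 1 (route_len q w i)"
  by (simp add: hops_def route_eq length_hv_path)

lemma hops_pos [simp]: "0 < hops q w i"
  by (simp add: hops_eq)

lemma route_len_hop: "k < hops q w i \<Longrightarrow> k \<le> route_len q w i"
  by (auto simp: hops_eq)

lemma nth_route: "k \<le> route_len q w i \<Longrightarrow>
    route q w i ! k = path_cell (src_cell q w i) (dst_cell q w i) k"
  by (simp add: route_eq nth_hv_path)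

lemma set_through:
  "set (through q w c) = {i. i < num_pairs w \<and> (\<exists>k\<in>{1..<route_len q w i}. c = route q w i ! k)}"
  by (auto simp: through_def route_eq set_inner_hv_path nth_hv_path)

lemma set_originating:
  "set (originating q w c) = {i. i < num_pairs w \<and> src_cell q w i = c}"
  by (auto simp: originating_def route_eq hd_hv_path)

lemma length_takeWhile_neq_less: "x \<in> set xs \<Longrightarrow> length (takeWhile (\<lambda>y. y \<noteq> x) xs) < length xs"
  by (induction xs) auto

text \<open>A path does not return to its source cell, so the pair is missing from
  \<open>through\<close> there and its packet slot lies in the part of the list reserved for
  sources. This is the test by which \<open>sender\<close> picks the source instead of the
  relay.\<close>

lemma packet_index_source:
  assumes "i < num_pairs w" "c = route q w i ! 0"
  shows "packet_index q w c i < length (packet_slots q w c)"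
    and "packet_slots q w c ! packet_index q w c i = i"
    and "length (through q w c) \<le> packet_index q w c i"
proof -
  have c: "c = src_cell q w i" using assms by (simp add: nth_route)
  have n: "i \<notin> set (through q w c)"
  proof
    assume "i \<in> set (through q w c)"
    then obtain k where k: "k \<in> {1..<route_len q w i}" "c = route q w i ! k"
      by (auto simp: set_through)
    then have "path_cell (src_cell q w i) (dst_cell q w i) k = path_cell (src_cell q w i) (dst_cell q w i) 0"
      using c by (simp add: nth_route)
    then have "k = 0" using k by (intro path_cell_inj[of k _ _ 0]) auto
    then show False using k by simp
  qed
  have i: "i \<in> set (packet_slots q w c)"
    using assms c by (simp add: packet_slots_def set_originating)
  show "packet_index q w c i < length (packet_slots q w c)"
    unfolding packet_index_def
    using i by (rule length_takeWhile_neq_less)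
  then show "packet_slots q w c ! packet_index q w c i = i"
    unfolding packet_index_def using nth_length_takeWhile by fastforce
  have "takeWhile (\<lambda>i'. i' \<noteq> i) (packet_slots q w c) =
      through q w c @ takeWhile (\<lambda>i'. i' \<noteq> i) (originating q w c)"
    unfolding packet_slots_def using n by (intro takeWhile_append2) auto
  then show "length (through q w c) \<le> packet_index q w c i"
    by (simp add: packet_index_def)
qed

text \<open>The counterpart for later hops: the pair is found within \<open>through\<close>, so
  \<open>sender\<close> picks the relay.\<close>

lemma packet_index_relay:
  assumes "i < num_pairs w" "0 < k" "k < hops q w i" "c = route q w i ! k"
  shows "packet_index q w c i < length (through q w c)"
proof -
  have "i \<in> set (through q w c)"
    using assms by (auto simp: set_through hops_eq)
  then have "takeWhile (\<lambda>i'. i' \<noteq> i) (packet_slots q w c) = takeWhile (\<lambda>i'. i' \<noteq> i) (through q w c)"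
    and "length (takeWhile (\<lambda>i'. i' \<noteq> i) (through q w c)) < length (through q w c)"
    unfolding packet_slots_def by (auto intro: takeWhile_append1 length_takeWhile_neq_less)
  then show ?thesis by (simp add: packet_index_def)
qed

lemma packet_index_le: "packet_index q w c i \<le> length (packet_slots q w c)"
  unfolding packet_index_def by (rule length_takeWhile_le)

lemma packet_index_less:
  assumes "i < num_pairs w" "k < hops q w i" "c = route q w i ! k"
  shows "packet_index q w c i < length (packet_slots q w c)"
  using packet_index_source(1)[of i w c q] packet_index_relay[of i w k q c] assms
  by (cases k) (fastforce simp: packet_slots_def)+

subsection \<open>Slots of the hops\<close>

lemma tdma_slot_less:
  assumes "is_cluster_order ord" shows "tdma_slot ord c < 25"
  using assms bij_betwE unfolding is_cluster_order_def tdma_slot_def by fastforce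

lemma tdma_slot_eqD:
  assumes "is_cluster_order ord" "tdma_slot ord c = tdma_slot ord c'"
  shows "fst c mod 5 = fst c' mod 5" "snd c mod 5 = snd c' mod 5"
proof -
  have "inj_on ord ({..<5} \<times> {..<5})" using assms by (simp add: is_cluster_order_def bij_betw_def)
  from inj_onD[OF this assms(2)[unfolded tdma_slot_def]]
  show "fst c mod 5 = fst c' mod 5" "snd c mod 5 = snd c' mod 5" by simp_all
qed

lemma next_congruent_slot:
  fixes s r :: nat assumes "r < 25"
  defines "T \<equiv> LEAST T. T > s \<and> T mod 25 = r"
  shows "s < T" "T mod 25 = r" "T \<le> s + 25"
proof -
  define k x where "k = Suc s div 25" and "x = Suc s mod 25"
  have s: "Suc s = 25 * k + x" "x < 25" by (simp_all add: k_def x_def)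
  \<comment> \<open>The frame containing slot \<open>Suc s\<close> still offers residue
    \<open>r\<close> exactly if \<open>x \<le> r\<close>; otherwise the next frame does.\<close>
  define T' where "T' = (if x \<le> r then 25 * k + r else 25 * Suc k + r)"
  have "s < T'" "T' \<le> s + 25" using s assms(1) by (auto simp: T'_def)
  moreover have "T' mod 25 = r" using assms(1) by (simp add: T'_def del: mult_Suc_right)
  ultimately have T': "s < T' \<and> T' mod 25 = r" "T' \<le> s + 25" by auto
  from LeastI[of "\<lambda>T. T > s \<and> T mod 25 = r", OF T'(1)]
  show "s < T" "T mod 25 = r" by (simp_all add: T_def)
  from Least_le[of "\<lambda>T. T > s \<and> T mod 25 = r", OF T'(1)] T'(2)
  show "T \<le> s + 25" by (simp add: T_def)
qed

context
  fixes p :: overlay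
  assumes ord: "is_cluster_order (order_p p)"
begin

lemma hop_slot_mod: "hop_slot p n w i j k mod 25 = tdma_slot (order_p p) (route (qp p n) w i ! k)"
  using next_congruent_slot(2)[OF tdma_slot_less[OF ord]] tdma_slot_less[OF ord]
  by (cases k) auto

lemma hop_slot_Suc: "hop_slot p n w i j k < hop_slot p n w i j (Suc k)"
  "hop_slot p n w i j (Suc k) \<le> hop_slot p n w i j k + 25"
  using next_congruent_slot(1,3)[OF tdma_slot_less[OF ord]] by auto

lemma hop_slot_bounds:
  "hop_slot p n w i j 0 + k \<le> hop_slot p n w i j k"
  "hop_slot p n w i j k \<le> hop_slot p n w i j 0 + 25 * k"
proof (induction k)
  case (Suc k)
  case 1 show ?case using Suc hop_slot_Suc[of n w i j k] by linarith
  case 2 show ?case using Suc hop_slot_Suc[of n w i j k] by simp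
qed simp_all

lemma hop_slot_0_bounds: "25 * j \<le> hop_slot p n w i j 0" "hop_slot p n w i j 0 < 25 * j + 25"
  using tdma_slot_less[OF ord] by auto

text \<open>With \<open>h\<close> hops, \<open>h - 1\<close> changes of slot take between 1 and 25
  slots each. The offsets inside the initial and final slot change the delay, in slots, by at least
  -1 and at most 2, whence \<open>h - 2\<close> and \<open>25 * h\<close>.\<close>

lemma packet_delay_bounds:
  assumes t: "slot_len p > 0"
  shows "(real (route_len (qp p n) w i) - 2) * slot_len p \<le> packet_delay p n w i j"
    and "packet_delay p n w i j \<le> 25 * real (hops (qp p n) w i) * slot_len p"
proof -
  define h where "h = hops (qp p n) w i"
  define l where "l k = length (packet_slots (qp p n) w (route (qp p n) w i ! k))" for k
  define x where "x k = packet_index (qp p n) w (route (qp p n) w i ! k) i" for k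
  define D where "D = (real (hop_slot p n w i j (h - 1)) + real (x (h - 1)) / real (l (h - 1)) +
      1 / real (l (h - 1)) - real (hop_slot p n w i j 0) - real (x 0) / real (l 0))"
  have pd: "packet_delay p n w i j = D * slot_len p"
    by (simp add: packet_delay_def hop_end_def hop_start_def Let_def D_def h_def l_def x_def algebra_simps)
  have h1: "h \<ge> 1" by (simp add: h_def hops_eq)
  have x: "real (x k) / real (l k) \<le> 1" for k
    using packet_index_le[of "qp p n" w] by (auto simp: x_def l_def divide_le_eq_1)
  \<comment> \<open>If no pair is served, \<open>l k = 0\<close> and the quotient is 0 by
    convention; the same holds in the preceding bound.\<close>
  have l: "1 / real (l k) \<le> 1" for k by (cases "l k") auto
  have "real (hop_slot p n w i j 0) + real (h - 1) \<le> real (hop_slot p n w i j (h - 1))"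
    using hop_slot_bounds(1)[of n w i j "h - 1"] by linarith
  then have "real h - 2 \<le> D" using x[of 0] h1 by (simp add: D_def of_nat_diff)
      (smt (verit) divide_nonneg_nonneg of_nat_0_le_iff)
  moreover have "real (route_len (qp p n) w i) \<le> real h" by (simp add: h_def hops_eq)
  ultimately show "(real (route_len (qp p n) w i) - 2) * slot_len p \<le> packet_delay p n w i j"
    unfolding pd using t by (intro mult_right_mono) auto
  have "real (hop_slot p n w i j (h - 1)) \<le> real (hop_slot p n w i j 0) + 25 * real (h - 1)"
    using of_nat_mono[OF hop_slot_bounds(2)[of n w i j "h - 1"], where 'a=real] by simp
  then have "D \<le> 25 * real h"
    using x[of "h - 1"] l[of "h - 1"] h1 by (simp add: D_def of_nat_diff)
      (smt (verit) divide_nonneg_nonneg of_nat_0_le_iff)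
  then show "packet_delay p n w i j \<le> 25 * real (hops (qp p n) w i) * slot_len p"
    unfolding pd h_def[symmetric] using t by (intro mult_right_mono) auto
qed

end

subsection \<open>Geometry of the cells\<close>

text \<open>The Chebyshev distance of cell indices, with integer values to avoid truncated
  subtraction.\<close>

definition cell_dist :: "cell \<Rightarrow> cell \<Rightarrow> int" where
  "cell_dist c d = max \<bar>int (fst c) - int (fst d)\<bar> \<bar>int (snd c) - int (snd d)\<bar>"

lemma cell_of_bounds:
  assumes "z \<in> unit_square"
  shows "real (fst (cell_of q z)) \<le> real q * fst z" "real q * fst z < real (fst (cell_of q z)) + 1"
    "real (snd (cell_of q z)) \<le> real q * snd z" "real q * snd z < real (snd (cell_of q z)) + 1"
proof -
  have "0 \<le> real q * fst z" "0 \<le> real q * snd z" using assms by auto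
  then show "real (fst (cell_of q z)) \<le> real q * fst z" "real q * fst z < real (fst (cell_of q z)) + 1"
    "real (snd (cell_of q z)) \<le> real q * snd z" "real q * snd z < real (snd (cell_of q z)) + 1"
    unfolding cell_of_def fst_conv snd_conv by linarith+
qed

lemma cell_of_in_grid:
  assumes "z \<in> unit_square" "q > 0"
  shows "cell_of q z \<in> {..<q} \<times> {..<q}"
proof -
  have "real q * fst z < real q" "real q * snd z < real q" using assms by auto
  then have "real (fst (cell_of q z)) < real q" "real (snd (cell_of q z)) < real q"
    using cell_of_bounds[OF assms(1), of q] by linarith+
  then show ?thesis by (simp add: mem_Times_iff)
qed

text \<open>If the indices differ by \<open>D \<ge> 1\<close> in a coordinate, \<open>D - 1\<close>
  full cells lie between the points. Multiplying by \<open>q\<close> makes the cell side the unit of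
  length, here and in all rate bounds.\<close>

lemma scaled_dist_ge:
  assumes "z \<in> unit_square" "z' \<in> unit_square"
  shows "real_of_int (cell_dist (cell_of q z) (cell_of q z')) - 1 \<le> real q * dist z z'"
proof -
  have f: "real q * \<bar>fst z - fst z'\<bar> \<le> real q * dist z z'"
    using dist_fst_le[of z z'] by (intro mult_left_mono) (auto simp: dist_real_def)
  have s: "real q * \<bar>snd z - snd z'\<bar> \<le> real q * dist z z'"
    using dist_snd_le[of z z'] by (intro mult_left_mono) (auto simp: dist_real_def)
  have f': "real q * \<bar>fst z - fst z'\<bar> = \<bar>real q * fst z - real q * fst z'\<bar>"
    and s': "real q * \<bar>snd z - snd z'\<bar> = \<bar>real q * snd z - real q * snd z'\<bar>"
    by (simp_all add: abs_mult flip: right_diff_distrib)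
  show ?thesis
    using f s cell_of_bounds[OF assms(1), of q] cell_of_bounds[OF assms(2), of q]
    unfolding cell_dist_def f' s' by (simp add: max_def abs_if split: if_splits)
qed

text \<open>In equal or adjacent cells each coordinate differs by at most two cell sides; the sum of
  both bounds the Euclidean distance. The 4 is the largest hop length that enters
  \<open>rate_low\<close>.\<close>

lemma scaled_dist_le:
  assumes "z \<in> unit_square" "z' \<in> unit_square" "cell_dist (cell_of q z) (cell_of q z') \<le> 1"
  shows "real q * dist z z' \<le> 4"
proof -
  have "dist z z' \<le> \<bar>fst z - fst z'\<bar> + \<bar>snd z - snd z'\<bar>"
    using sqrt_sum_squares_le_sum_abs[of "fst z - fst z'" "snd z - snd z'"]
    by (simp add: dist_prod_def dist_real_def)
  then have "real q * dist z z' \<le> real q * (\<bar>fst z - fst z'\<bar> + \<bar>snd z - snd z'\<bar>)"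
    by (rule mult_left_mono) simp
  also have "\<dots> = \<bar>real q * fst z - real q * fst z'\<bar> + \<bar>real q * snd z - real q * snd z'\<bar>"
    by (simp add: abs_mult distrib_left flip: right_diff_distrib)
  also have "\<dots> \<le> 2 + 2"
    using assms(3) cell_of_bounds[OF assms(1), of q] cell_of_bounds[OF assms(2), of q]
    unfolding cell_dist_def by (intro add_mono) linarith+
  finally show ?thesis by simp
qed

lemma cell_dist_triangle: "cell_dist a c \<le> cell_dist a b + cell_dist b c"
  unfolding cell_dist_def by linarith

lemma cell_dist_commute: "cell_dist a b = cell_dist b a"
  unfolding cell_dist_def by (simp add: abs_minus_commute)

text \<open>The effect of \<open>5 \<times> 5\<close> clusters: a nonzero index difference divisible
  by 5 is at least 5.\<close>

lemma cell_dist_congruent: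
  assumes "fst a mod 5 = fst b mod 5" "snd a mod 5 = snd b mod 5" "a \<noteq> b"
  shows "5 \<le> cell_dist a b"
proof -
  have far: "5 \<le> \<bar>int x - int y\<bar>" if "x mod 5 = y mod 5" "x \<noteq> y" for x y :: nat
  proof -
    have "(5::int) dvd int x - int y"
      using that(1) by (metis mod_eq_dvd_iff of_nat_mod of_nat_numeral)
    then show ?thesis using that(2) zdvd_imp_le[of 5 "\<bar>int x - int y\<bar>"] by auto
  qed
  show ?thesis
    using assms far[of "fst a" "fst b"] far[of "snd a" "snd b"]
    by (cases "fst a = fst b") (auto simp: cell_dist_def prod_eq_iff max.coboundedI1 max.coboundedI2)
qed

subsection \<open>Interference\<close>

text \<open>The zeta function at \<alpha>/2. The exponent is halved because each coordinate takes
  half of the decay; \<alpha> > 2 is exactly the condition for convergence.\<close>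

definition lattice_const :: "real \<Rightarrow> real" where
  "lattice_const \<alpha> = (\<Sum>k. real (Suc k) powr (- (\<alpha> / 2)))"

lemma summable_lattice:
  assumes "\<alpha> > 2"
  shows "summable (\<lambda>k. real (Suc k) powr (- (\<alpha> / 2)))"
  using assms summable_real_powr_iff[of "- (\<alpha> / 2)"]
  by (subst summable_Suc_iff[of "\<lambda>k. real k powr (- (\<alpha> / 2))"]) simp

lemma lattice_const_nonneg: "\<alpha> > 2 \<Longrightarrow> 0 \<le> lattice_const \<alpha>"
  unfolding lattice_const_def by (intro suminf_nonneg summable_lattice) auto

text \<open>On either side of \<open>y\<close> the distance to \<open>y\<close> is an injective
  index into the series, hence the factor 2.\<close>

lemma lattice_line_sum:
  assumes "\<alpha> > 2" "finite (A :: nat set)"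
  shows "(\<Sum>x\<in>A. (1 + \<bar>real x - real y\<bar>) powr (- (\<alpha> / 2))) \<le> 2 * lattice_const \<alpha>"
proof -
  let ?g = "\<lambda>k. real (Suc k) powr (- (\<alpha> / 2))"
  have part: "(\<Sum>x\<in>B. (1 + \<bar>real x - real y\<bar>) powr (- (\<alpha> / 2))) \<le> lattice_const \<alpha>"
    if "finite B" "inj_on h B" "\<And>x. x \<in> B \<Longrightarrow> real (h x) = \<bar>real x - real y\<bar>" for B :: "nat set" and h
  proof -
    have "(\<Sum>x\<in>B. (1 + \<bar>real x - real y\<bar>) powr (- (\<alpha> / 2))) = (\<Sum>x\<in>B. ?g (h x))"
      using that by (intro sum.cong) auto
    also have "\<dots> = sum ?g (h ` B)" using that by (simp add: sum.reindex)
    also have "\<dots> \<le> lattice_const \<alpha>"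
      unfolding lattice_const_def using that assms by (intro sum_le_suminf summable_lattice) auto
    finally show ?thesis .
  qed
  have A: "A = {x\<in>A. y \<le> x} \<union> {x\<in>A. x < y}" by auto
  have "(\<Sum>x\<in>A. (1 + \<bar>real x - real y\<bar>) powr (- (\<alpha> / 2))) =
     (\<Sum>x\<in>{x\<in>A. y \<le> x}. (1 + \<bar>real x - real y\<bar>) powr (- (\<alpha> / 2))) +
     (\<Sum>x\<in>{x\<in>A. x < y}. (1 + \<bar>real x - real y\<bar>) powr (- (\<alpha> / 2)))"
    using assms(2) by (subst A, subst sum.union_disjoint) auto
  also have "\<dots> \<le> lattice_const \<alpha> + lattice_const \<alpha>"
  proof (rule add_mono)
    show "(\<Sum>x\<in>{x\<in>A. y \<le> x}. (1 + \<bar>real x - real y\<bar>) powr (- (\<alpha> / 2))) \<le> lattice_const \<alpha>"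
      using assms(2) by (intro part[where h="\<lambda>x. x - y"]) (auto simp: inj_on_def)
    show "(\<Sum>x\<in>{x\<in>A. x < y}. (1 + \<bar>real x - real y\<bar>) powr (- (\<alpha> / 2))) \<le> lattice_const \<alpha>"
      using assms(2) by (intro part[where h="\<lambda>x. y - x"]) (auto simp: inj_on_def)
  qed
  finally show ?thesis by simp
qed

text \<open>
  The kernel is bounded by a product of one-dimensional ones, since the larger of two coordinate
  distances is at least their geometric mean.
\<close>
lemma interference_sum_bound:
  fixes d :: "'a \<Rightarrow> real"
  assumes \<alpha>: "\<alpha> > 2" and P: "P \<ge> 0" and q: "q > 0" and inj: "inj_on \<kappa> S"
    and far: "\<And>x. x \<in> S \<Longrightarrow> (1 + real_of_int (cell_dist (\<kappa> x) c)) / 4 \<le> real q * d x"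
  shows "(\<Sum>x\<in>S. P * cell_area q powr (\<alpha> / 2) * d x powr (- \<alpha>)) \<le> P * 4 powr \<alpha> * (2 * lattice_const \<alpha>)\<^sup>2"
proof (cases "finite S")
  \<comment> \<open>A sum over an infinite set is 0 by convention, so finiteness of the set of
    transmitters need not be shown separately.\<close>
  case False
  then show ?thesis using P by simp
next
  case fin: True
  let ?g = "\<lambda>x y. (1 + \<bar>real x - real y\<bar>) powr (- (\<alpha> / 2))"
  have area: "cell_area q powr (\<alpha> / 2) = real q powr (- \<alpha>)"
  proof -
    have "cell_area q = real q powr (- 2)"
      using q by (simp add: cell_area_def powr_minus divide_inverse powr_numeral)
    then show ?thesis by (simp add: powr_powr)
  qed
  have kernel: "cell_area q powr (\<alpha> / 2) * d x powr (- \<alpha>) \<le>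
      4 powr \<alpha> * (?g (fst (\<kappa> x)) (fst c) * ?g (snd (\<kappa> x)) (snd c))" if x: "x \<in> S" for x
  proof -
    define D where "D = real_of_int (cell_dist (\<kappa> x) c)"
    define a b where "a = \<bar>real (fst (\<kappa> x)) - real (fst c)\<bar>" and "b = \<bar>real (snd (\<kappa> x)) - real (snd c)\<bar>"
    have D: "a \<le> D" "b \<le> D" "0 \<le> a" "0 \<le> b"
      by (auto simp: D_def a_def b_def cell_dist_def)
    have far': "(1 + D) / 4 \<le> real q * d x" using far[OF x] by (simp add: D_def)
    have "0 \<le> (1 + D) / 4" using D by simp
    then have "0 \<le> real q * d x" using far' by (rule order_trans)
    then have d0: "d x \<ge> 0" using q by (simp add: zero_le_mult_iff)
    have "cell_area q powr (\<alpha> / 2) * d x powr (- \<alpha>) = (real q * d x) powr (- \<alpha>)"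
      using d0 by (simp add: area powr_mult)
    also have "\<dots> \<le> ((1 + D) / 4) powr (- \<alpha>)"
      using far' D \<alpha> by (intro powr_mono2') auto
    also have "\<dots> = 4 powr \<alpha> * (1 + D) powr (- \<alpha>)"
      using D by (simp add: powr_divide powr_minus_divide)
    also have "(1 + D) powr (- \<alpha>) = (1 + D) powr (- (\<alpha> / 2)) * (1 + D) powr (- (\<alpha> / 2))"
      by (simp flip: powr_add)
    also have "\<dots> \<le> (1 + a) powr (- (\<alpha> / 2)) * (1 + b) powr (- (\<alpha> / 2))"
      using D \<alpha> by (intro mult_mono powr_mono2') auto
    finally show ?thesis by (simp add: a_def b_def)
  qed
  let ?K = "\<kappa> ` S"
  have "(\<Sum>x\<in>S. P * cell_area q powr (\<alpha> / 2) * d x powr (- \<alpha>)) \<le>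
     (\<Sum>x\<in>S. P * (4 powr \<alpha> * (?g (fst (\<kappa> x)) (fst c) * ?g (snd (\<kappa> x)) (snd c))))"
    unfolding mult.assoc using kernel P by (intro sum_mono mult_left_mono)
  also have "\<dots> = P * 4 powr \<alpha> * (\<Sum>x\<in>S. ?g (fst (\<kappa> x)) (fst c) * ?g (snd (\<kappa> x)) (snd c))"
    by (simp add: sum_distrib_left mult.assoc)
  also have "(\<Sum>x\<in>S. ?g (fst (\<kappa> x)) (fst c) * ?g (snd (\<kappa> x)) (snd c)) =
     (\<Sum>k\<in>?K. ?g (fst k) (fst c) * ?g (snd k) (snd c))"
    using inj by (simp add: sum.reindex)
  \<comment> \<open>Enlarging the set of cells to the product of its projections lets the double sum
    factor.\<close>
  also have "\<dots> \<le> (\<Sum>k\<in>fst ` ?K \<times> snd ` ?K. ?g (fst k) (fst c) * ?g (snd k) (snd c))"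
    using fin by (intro sum_mono2 subset_fst_snd) auto
  also have "\<dots> = (\<Sum>k\<in>fst ` ?K. ?g k (fst c)) * (\<Sum>k\<in>snd ` ?K. ?g k (snd c))"
    by (simp add: sum_product sum.cartesian_product case_prod_beta)
  also have "\<dots> \<le> (2 * lattice_const \<alpha>) * (2 * lattice_const \<alpha>)"
    using fin \<alpha> lattice_const_nonneg by (intro mult_mono lattice_line_sum sum_nonneg) auto
  finally show ?thesis using P by (simp add: power2_eq_square mult_left_mono)
qed

lemma frac_slot_less:
  assumes "l > 0" shows "nat \<lfloor>frac x * real l\<rfloor> < l"
proof -
  have "frac x * real l < real l" using assms frac_lt_1[of x] by simp
  moreover have "0 \<le> frac x * real l" by simp
  ultimately show ?thesis by linarith
qed

lemma sender_in_cell: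
  assumes "sender q w c r k = Some u" "k < length (packet_slots q w c)"
  shows "cell_of q (pos w u) = c"
proof (cases "k < length (through q w c)")
  case True
  then have "nodes_in q w c \<noteq> []" "u = relay q w c r" using assms by (auto simp: sender_def split: if_splits)
  then have "u \<in> set (nodes_in q w c)" by (simp add: relay_def)
  then show ?thesis by (simp add: nodes_in_def)
next
  case False
  then have u: "u = 2 * (packet_slots q w c ! k)" using assms by (simp add: sender_def)
  have "packet_slots q w c ! k \<in> set (originating q w c)"
    using False assms(2) by (simp add: packet_slots_def nth_append)
  then show ?thesis using u by (simp add: set_originating src_cell_def)
qed

text \<open>A sender lies in the cell it serves, so the existentially quantified cell of
  \<open>scheduled\<close> is the one containing \<open>u\<close>.\<close>

lemma scheduledD:
  assumes "u \<in> scheduled ord q w \<tau> R t"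
  defines "s \<equiv> nat \<lfloor>t / \<tau>\<rfloor>" and "c \<equiv> cell_of q (pos w u)"
  shows "s mod 25 = tdma_slot ord c"
    and "sender q w c (R c (s div 25)) (nat \<lfloor>frac (t / \<tau>) * real (length (packet_slots q w c))\<rfloor>) = Some u"
proof -
  obtain c' where c': "s mod 25 = tdma_slot ord c'" "packet_slots q w c' \<noteq> []"
    "sender q w c' (R c' (s div 25)) (nat \<lfloor>frac (t / \<tau>) * real (length (packet_slots q w c'))\<rfloor>) = Some u"
    using assms(1) unfolding scheduled_def s_def Let_def by auto
  then have "c' = c" unfolding c_def
    using sender_in_cell[OF c'(3)] frac_slot_less[of "length (packet_slots q w c')"] by simp
  then show "s mod 25 = tdma_slot ord c"
    "sender q w c (R c (s div 25)) (nat \<lfloor>frac (t / \<tau>) * real (length (packet_slots q w c))\<rfloor>) = Some u"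
    using c' by auto
qed

text \<open>At a given time, the cell determines its relay turn and packet slot, hence the sender.
  Interferers can therefore be counted by cells.\<close>

lemma inj_on_scheduled: "inj_on (\<lambda>u. cell_of q (pos w u)) (scheduled ord q w \<tau> R t)"
proof (rule inj_onI)
  fix x y assume xy: "x \<in> scheduled ord q w \<tau> R t" "y \<in> scheduled ord q w \<tau> R t"
    "cell_of q (pos w x) = cell_of q (pos w y)"
  have "Some x = Some y" using scheduledD(2)[OF xy(1)] scheduledD(2)[OF xy(2)] by (simp only: xy(3))
  then show "x = y" by simp
qed

text \<open>The almost sure part of the assumptions on a network. Since \<open>0 powr x = 0\<close>,
  a receiver at distance 0 would have gain 0 instead of an infinite one; the second clause excludes
  this for a pair inside one cell, the only hop that does not change the cell.\<close>

definition well_placed :: "net \<Rightarrow> bool" where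
  "well_placed w \<longleftrightarrow> (\<forall>u. pos w u \<in> unit_square) \<and> (\<forall>i. pos w (2 * i) \<noteq> pos w (2 * i + 1))"

lemma well_placed_pos: "well_placed w \<Longrightarrow> pos w u \<in> unit_square"
  by (simp add: well_placed_def)

text \<open>Another active cell is at index distance at least 5 from the sender, hence
  \<open>D \<ge> 4\<close> from the receiver, where \<open>D - 1 \<ge> (1 + D) / 4\<close>.\<close>

lemma primary_interference_bound:
  assumes \<alpha>: "path_loss p > 2" and P: "power_p p \<ge> 0" and ord: "is_cluster_order (order_p p)"
    and q: "qp p n > 0" and w: "well_placed w"
    and u: "u \<in> primary_tx p n w t"
    and uv: "cell_dist (cell_of (qp p n) (pos w u)) (cell_of (qp p n) (pos w v)) \<le> 1"
  shows "(\<Sum>x \<in> primary_tx p n w t - {u}. tx_power_p p n * gain p (dist (pos w x) (pos w v)))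
     \<le> power_p p * 4 powr path_loss p * (2 * lattice_const (path_loss p))\<^sup>2"
  unfolding tx_power_p_def gain_def
proof (rule interference_sum_bound[OF \<alpha> P q, where \<kappa>="\<lambda>x. cell_of (qp p n) (pos w x)" and c="cell_of (qp p n) (pos w v)"])
  let ?c = "\<lambda>x. cell_of (qp p n) (pos w x)"
  show inj: "inj_on ?c (primary_tx p n w t - {u})"
    unfolding primary_tx_def by (rule inj_on_subset[OF inj_on_scheduled]) auto
  fix x assume x: "x \<in> primary_tx p n w t - {u}"
  have "?c x \<noteq> ?c u"
    using x u inj_on_scheduled unfolding primary_tx_def inj_on_def by blast
  moreover have "tdma_slot (order_p p) (?c x) = tdma_slot (order_p p) (?c u)"
    using x u unfolding primary_tx_def by (metis DiffD1 scheduledD(1))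
  ultimately have "5 \<le> cell_dist (?c x) (?c u)"
    by (intro cell_dist_congruent tdma_slot_eqD[OF ord])
  then have "4 \<le> cell_dist (?c x) (?c v)"
    using cell_dist_triangle[of "?c x" "?c u" "?c v"] cell_dist_commute[of "?c v" "?c u"] uv by linarith
  then have "4 \<le> real_of_int (cell_dist (?c x) (?c v))" by linarith
  then show "(1 + real_of_int (cell_dist (?c x) (?c v))) / 4 \<le> real (qp p n) * dist (pos w x) (pos w v)"
    using scaled_dist_ge[OF well_placed_pos[OF w, of x] well_placed_pos[OF w, of v], of "qp p n"] by argo
qed

text \<open>The preservation square reaches beyond the active cell and its neighbours, hence beyond
  the receiver, by half a secondary cell side. This margin handles interferers in cells at index
  distance at most 1 from the receiver; for the others the cell geometry suffices. The quotient 4 in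
  the kernel bound is chosen to fit both cases.\<close>

lemma secondary_interference_bound:
  assumes \<alpha>: "path_loss p > 2" and P: "power_s p \<ge> 0"
    and q: "qp p n > 0" "qs p n > 0" and w: "well_placed (fst \<omega>)" "well_placed (snd \<omega>)"
    and c: "nat \<lfloor>t / slot_len p\<rfloor> mod 25 = tdma_slot (order_p p) c" "packet_slots (qp p n) (fst \<omega>) c \<noteq> []"
    and cv: "cell_dist c (cell_of (qp p n) (pos (fst \<omega>) v)) \<le> 1"
  shows "(\<Sum>x \<in> secondary_tx p n \<omega> t. tx_power_s p n * gain p (dist (pos (snd \<omega>) x) (pos (fst \<omega>) v)))
     \<le> power_s p * 4 powr path_loss p * (2 * lattice_const (path_loss p))\<^sup>2"
  unfolding tx_power_s_def gain_def
proof (rule interference_sum_bound[OF \<alpha> P q(2), where \<kappa>="\<lambda>x. cell_of (qs p n) (pos (snd \<omega>) x)"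
      and c="cell_of (qs p n) (pos (fst \<omega>) v)"])
  let ?c = "\<lambda>x. cell_of (qs p n) (pos (snd \<omega>) x)"
  show inj: "inj_on ?c (secondary_tx p n \<omega> t)"
    unfolding secondary_tx_def by (rule inj_on_subset[OF inj_on_scheduled]) auto
  fix x assume x: "x \<in> secondary_tx p n \<omega> t"
  define z where "z = pos (snd \<omega>) x"
  define y where "y = pos (fst \<omega>) v"
  define Q where "Q = real (qp p n)"
  define R where "R = real (qs p n)"
  have QR: "Q > 0" "R > 0" using q by (simp_all add: Q_def R_def)
  have zy: "z \<in> unit_square" "y \<in> unit_square" using w well_placed_pos by (simp_all add: z_def y_def)
  define h where "h = real (region_cells p n) * sqrt (cell_area (qs p n)) / 2"
  define b where "b = cell_centre (qp p n) c"
  have "\<not> preserved p n (fst \<omega>) (nat \<lfloor>t / slot_len p\<rfloor>) z"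
    using x by (simp add: secondary_tx_def z_def)
  then have out: "h < \<bar>fst z - fst b\<bar> \<or> h < \<bar>snd z - snd b\<bar>"
    using c unfolding preserved_def Let_def h_def b_def not_le[symmetric] by blast
  have sq: "sqrt (cell_area (qs p n)) = 1 / R" "sqrt (cell_area (qp p n) / cell_area (qs p n)) = R / Q"
    using QR by (simp_all add: cell_area_def Q_def R_def real_sqrt_divide)
  \<comment> \<open>The floor loses less than 1 of the added 2; the rest is the margin of half a
    secondary cell side at either end.\<close>
  have "3 * (R / Q) + 1 \<le> real (region_cells p n)"
    unfolding region_cells_def sq using QR by (simp add: le_nat_floor) linarith
  then have "(3 * (R / Q) + 1) * (1 / R) \<le> real (region_cells p n) * (1 / R)"
    using QR by (intro mult_right_mono) auto
  then have h: "3 / (2 * Q) + 1 / (2 * R) \<le> h" using QR by (simp add: h_def sq field_simps)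
  \<comment> \<open>A point of a neighbouring cell is at most 3/2 primary cell sides from the
    centre, in each coordinate.\<close>
  have near: "\<bar>s - (real a + 1 / 2) / Q\<bar> \<le> 3 / (2 * Q)"
    if "real e \<le> Q * s" "Q * s < real e + 1" "\<bar>int a - int e\<bar> \<le> 1" for s a e
  proof -
    have "Q * (s - (real a + 1 / 2) / Q) = Q * s - (real a + 1 / 2)"
      using QR by (simp add: right_diff_distrib)
    then have "Q * \<bar>s - (real a + 1 / 2) / Q\<bar> = \<bar>Q * s - (real a + 1 / 2)\<bar>"
      using QR by (metis abs_mult abs_of_pos)
    also have "\<dots> \<le> 3 / 2" using that by linarith
    finally show ?thesis using QR by (simp add: field_simps)
  qed
  define e where "e = cell_of (qp p n) y"
  have ce: "\<bar>int (fst c) - int (fst e)\<bar> \<le> 1" "\<bar>int (snd c) - int (snd e)\<bar> \<le> 1"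
    using cv unfolding cell_dist_def e_def y_def by simp_all
  note ye = cell_of_bounds[OF zy(2), of "qp p n", folded e_def Q_def]
  have "\<bar>fst y - fst b\<bar> \<le> 3 / (2 * Q)" "\<bar>snd y - snd b\<bar> \<le> 3 / (2 * Q)"
    using near[OF ye(1,2) ce(1)] near[OF ye(3,4) ce(2)] by (simp_all add: b_def cell_centre_def Q_def)
  then have "1 / (2 * R) < \<bar>fst z - fst y\<bar> \<or> 1 / (2 * R) < \<bar>snd z - snd y\<bar>"
    using out h by linarith
  then have "1 / (2 * R) < dist z y"
    using dist_fst_le[of z y] dist_snd_le[of z y] by (auto simp: dist_real_def)
  then have half: "1 / 2 < R * dist z y" using QR by (simp add: field_simps)
  have "real_of_int (cell_dist (cell_of (qs p n) z) (cell_of (qs p n) y)) - 1 \<le> R * dist z y"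
    unfolding R_def by (rule scaled_dist_ge[OF zy])
  moreover define D where "D = cell_dist (cell_of (qs p n) z) (cell_of (qs p n) y)"
  ultimately have D: "real_of_int D - 1 \<le> R * dist z y" by simp
  have "(1 + real_of_int D) / 4 \<le> R * dist z y"
  proof (cases "D \<le> 1")
    case True
    then have "(1 + real_of_int D) / 4 \<le> 1 / 2" by simp
    then show ?thesis using half by (meson less_imp_le order_trans)
  next
    case False
    then have "2 \<le> real_of_int D" by simp
    then have "(1 + real_of_int D) / 4 \<le> real_of_int D - 1" by simp
    then show ?thesis using D by (rule order_trans)
  qed
  then show "(1 + real_of_int (cell_dist (?c x) (cell_of (qs p n) (pos (fst \<omega>) v)))) / 4 \<le>
     real (qs p n) * dist (pos (snd \<omega>) x) (pos (fst \<omega>) v)"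
    by (simp add: D_def R_def z_def y_def)
qed

subsection \<open>Rates on the hops\<close>

text \<open>Signal over a hop of 4 cell sides, against noise and the lattice sum bounds for the
  interference of both networks.\<close>

definition rate_low :: "overlay \<Rightarrow> real" where
  "rate_low p = log 2 (1 + power_p p * 4 powr (- path_loss p) /
     (noise p + (power_p p + power_s p) * 4 powr path_loss p * (2 * lattice_const (path_loss p))\<^sup>2))"

text \<open>Signal over half a cell side, against noise alone.\<close>

definition rate_high :: "overlay \<Rightarrow> real" where
  "rate_high p = log 2 (1 + power_p p * 2 powr path_loss p / noise p)"

lemma rate_low_pos:
  assumes noise: "noise p > 0" and powers: "power_p p > 0" "power_s p > 0"
  shows "0 < rate_low p"
proof -
  have "0 < noise p + (power_p p + power_s p) * 4 powr path_loss p * (2 * lattice_const (path_loss p))\<^sup>2"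
    using noise powers by (intro add_pos_nonneg mult_nonneg_nonneg) auto
  then have "0 < power_p p * 4 powr (- path_loss p) /
     (noise p + (power_p p + power_s p) * 4 powr path_loss p * (2 * lattice_const (path_loss p))\<^sup>2)"
    using powers by (intro divide_pos_pos mult_pos_pos) auto
  then show ?thesis unfolding rate_low_def by (subst zero_less_log_cancel_iff) simp_all
qed

lemma rate_high_pos:
  assumes noise: "noise p > 0" and powers: "power_p p > 0"
  shows "0 < rate_high p"
proof -
  have "0 < power_p p * 2 powr path_loss p / noise p"
    using powers noise by (intro divide_pos_pos mult_pos_pos) auto
  then show ?thesis unfolding rate_high_def by (subst zero_less_log_cancel_iff) simp_all
qed

text \<open>The transmit power compensates the cell size: only the distance measured in cell sides
  matters. Hence the rate bounds do not depend on \<open>n\<close>.\<close>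

lemma received_power_eq:
  assumes "qp p n > 0" "r \<ge> 0"
  shows "tx_power_p p n * gain p r = power_p p * (real (qp p n) * r) powr (- path_loss p)"
proof -
  have "cell_area (qp p n) = real (qp p n) powr (- 2)"
    using assms by (simp add: cell_area_def powr_minus divide_inverse powr_numeral)
  then show ?thesis using assms by (simp add: tx_power_p_def gain_def powr_powr powr_mult)
qed

lemma interference_nonneg:
  assumes "power_p p > 0" "power_s p > 0"
  shows "0 \<le> interference p n \<omega> u v t"
  unfolding interference_def tx_power_p_def tx_power_s_def gain_def
  using assms by (intro add_nonneg_nonneg sum_nonneg mult_nonneg_nonneg) auto

text \<open>Translates the time window of a hop into the floor expressions by which
  \<open>scheduled\<close> selects slot and packet slot.\<close>

lemma slot_arithmetic:
  fixes hs idx l :: nat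
  assumes "l > 0" "idx < l" "real hs + real idx / real l \<le> x" "x < real hs + real idx / real l + 1 / real l"
  shows "nat \<lfloor>x\<rfloor> = hs" "nat \<lfloor>frac x * real l\<rfloor> = idx"
proof -
  have "real idx / real l + 1 / real l \<le> 1" using assms(1,2) by (simp flip: add_divide_distrib)
  then have x: "real hs \<le> x" "x < real hs + 1" using assms(3,4) 
    by (smt (verit) divide_nonneg_nonneg of_nat_0_le_iff)+
  then have fl: "\<lfloor>x\<rfloor> = int hs" by (simp add: floor_eq_iff)
  then show "nat \<lfloor>x\<rfloor> = hs" by simp
  have "real idx \<le> frac x * real l" "frac x * real l < real idx + 1"
    using assms by (simp_all add: frac_def fl field_simps)
  then have "\<lfloor>frac x * real l\<rfloor> = int idx" by (simp add: floor_eq_iff)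
  then show "nat \<lfloor>frac x * real l\<rfloor> = idx" by simp
qed

section \<open>The primary protocol in one fixed outcome\<close>

definition grid :: "nat \<Rightarrow> cell set" where
  "grid q = {..<q} \<times> {..<q}"

locale running =
  fixes p :: overlay and n :: nat and \<omega> :: "net \<times> net"
  assumes path_loss: "path_loss p > 2" and noise: "noise p > 0"
    and powers: "power_p p > 0" "power_s p > 0" and slot: "slot_len p > 0"
    and ord: "is_cluster_order (order_p p)"
    and q: "qp p n > 0" "qs p n > 0"
    and placed: "well_placed (fst \<omega>)" "well_placed (snd \<omega>)"
begin

abbreviation "w \<equiv> fst \<omega>"

abbreviation load :: "nat \<Rightarrow> nat \<Rightarrow> nat" where
  "load i k \<equiv> length (packet_slots (qp p n) w (route (qp p n) w i ! k))"

lemma route_in_grid: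
  assumes "k < hops (qp p n) w i" shows "route (qp p n) w i ! k \<in> grid (qp p n)"
  unfolding nth_route[OF route_len_hop[OF assms]] grid_def
  using cell_of_in_grid[OF well_placed_pos[OF placed(1)] q(1)]
  by (intro path_cell_in_grid) (auto simp: src_cell_def dst_cell_def)

lemma cell_of_relay:
  assumes "nodes_in (qp p n) w c \<noteq> []"
  shows "cell_of (qp p n) (pos w (relay (qp p n) w c r)) = c"
proof -
  have "relay (qp p n) w c r \<in> set (nodes_in (qp p n) w c)" using assms by (simp add: relay_def)
  then show ?thesis by (simp add: nodes_in_def)
qed

lemma cell_of_next_holder:
  assumes "k < hops (qp p n) w i"
    and "Suc k < hops (qp p n) w i \<Longrightarrow> nodes_in (qp p n) w (route (qp p n) w i ! Suc k) \<noteq> []"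
  shows "cell_of (qp p n) (pos w (holder p n w i j (Suc k))) =
     path_cell (src_cell (qp p n) w i) (dst_cell (qp p n) w i) (Suc k)"
proof (cases "Suc k = hops (qp p n) w i")
  case True
  then have "cell_of (qp p n) (pos w (holder p n w i j (Suc k))) = dst_cell (qp p n) w i"
    by (simp add: holder_def dst_cell_def)
  moreover have "path_cell (src_cell (qp p n) w i) (dst_cell (qp p n) w i) (Suc k) = dst_cell (qp p n) w i"
  proof (cases "route_len (qp p n) w i = 0")
    \<comment> \<open>The pair stays in one cell; index 1 lies beyond the end of its path but still
      yields the destination cell.\<close>
    case True
    then show ?thesis by (auto simp: path_cell_def path_len_def toward_gap)
  next
    case False
    then have "Suc k = route_len (qp p n) w i"
      using \<open>Suc k = _\<close> by (simp add: hops_eq)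
    then show ?thesis by (simp only: path_cell_last)
  qed
  ultimately show ?thesis by simp
next
  case False
  then have k: "Suc k < hops (qp p n) w i" using assms by simp
  then show ?thesis using assms(2) route_len_hop[OF k]
    by (simp add: holder_def cell_of_relay nth_route[symmetric])
qed

text \<open>The holder of the packet has to be identified with the scheduled sender of its cell:
  \<open>interference\<close> omits only this node, and only then do all other primary transmitters
  sit in other cells of the same slot.\<close>

lemma rate_ge:
  assumes nodes: "\<And>c. c \<in> grid (qp p n) \<Longrightarrow> nodes_in (qp p n) w c \<noteq> []"
    and i: "i < num_pairs w" and k: "k < hops (qp p n) w i"
    and t: "hop_start p n w i j k \<le> t" "t < hop_end p n w i j k"
  shows "rate_low p \<le> rate p n \<omega> (holder p n w i j k) (holder p n w i j (Suc k)) t"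
proof -
  define c where "c = route (qp p n) w i ! k"
  define u where "u = holder p n w i j k"
  define v where "v = holder p n w i j (Suc k)"
  define l where "l = length (packet_slots (qp p n) w c)"
  define idx where "idx = packet_index (qp p n) w c i"
  define hs where "hs = hop_slot p n w i j k"
  have cp: "c = path_cell (src_cell (qp p n) w i) (dst_cell (qp p n) w i) k"
    using nth_route route_len_hop[OF k] by (simp add: c_def)
  have idx: "idx < l" unfolding idx_def l_def by (rule packet_index_less[OF i k c_def])
  have "real hs + real idx / real l \<le> t / slot_len p" "t / slot_len p < real hs + real idx / real l + 1 / real l"
    using t slot unfolding hop_end_def hop_start_def Let_def c_def[symmetric] hs_def[symmetric]
      idx_def[symmetric] l_def[symmetric] by (simp_all add: field_simps)
  then have sl: "nat \<lfloor>t / slot_len p\<rfloor> = hs" "nat \<lfloor>frac (t / slot_len p) * real l\<rfloor> = idx"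
    using slot_arithmetic[of l idx hs] idx by auto
  have active: "hs mod 25 = tdma_slot (order_p p) c"
    unfolding hs_def c_def by (rule hop_slot_mod[OF ord])
  have nc: "nodes_in (qp p n) w c \<noteq> []" unfolding c_def by (intro nodes route_in_grid k)
  have snd: "sender (qp p n) w c (hs div 25) idx = Some u"
  proof (cases "k = 0")
    case True
    then have "idx < l" "packet_slots (qp p n) w c ! idx = i" "length (through (qp p n) w c) \<le> idx"
      unfolding idx_def l_def using packet_index_source[OF i, of c "qp p n"] by (auto simp: c_def)
    then show ?thesis using True by (simp add: sender_def u_def holder_def)
  next
    case False
    then have "idx < length (through (qp p n) w c)"
      unfolding idx_def by (intro packet_index_relay[OF i _ k c_def]) simp
    then show ?thesis using False k nc by (simp add: sender_def u_def holder_def c_def hs_def)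
  qed
  have cu: "cell_of (qp p n) (pos w u) = c"
    using sender_in_cell[OF snd] idx by (simp add: l_def)
  have ptx: "u \<in> primary_tx p n w t"
    unfolding primary_tx_def scheduled_def Let_def sl(1)
    using active snd idx sl(2) by (intro CollectI exI[of _ c]) (auto simp: l_def)
  have cv: "cell_of (qp p n) (pos w v) = path_cell (src_cell (qp p n) w i) (dst_cell (qp p n) w i) (Suc k)"
    unfolding v_def using k by (intro cell_of_next_holder nodes route_in_grid) auto
  have d: "cell_dist c (cell_of (qp p n) (pos w v)) \<le> 1"
    unfolding cv unfolding cp cell_dist_def
    using path_cell_step[of "src_cell (qp p n) w i" "dst_cell (qp p n) w i" k]
    by (simp add: abs_minus_commute)
  \<comment> \<open>Without a positive distance the gain would be 0. Different cells provide it,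
    except for a pair inside one cell.\<close>
  have ne: "pos w u \<noteq> pos w v"
  proof (cases "route_len (qp p n) w i = 0")
    case True
    then have "k = 0" "hops (qp p n) w i = 1" using k by (simp_all add: hops_eq)
    then show ?thesis using placed(1) by (simp add: u_def v_def holder_def well_placed_def)
  next
    case False
    then have "Suc k \<le> route_len (qp p n) w i" using k by (simp add: hops_eq)
    then have "c \<noteq> cell_of (qp p n) (pos w v)"
      unfolding cv cp using path_cell_inj[of k "src_cell (qp p n) w i" "dst_cell (qp p n) w i" "Suc k"] by auto
    then show ?thesis using cu by auto
  qed
  define C where "C = 4 powr path_loss p * (2 * lattice_const (path_loss p))\<^sup>2"
  have "interference p n \<omega> u v t \<le> power_p p * C + power_s p * C"
    unfolding interference_def C_def mult.assoc[symmetric]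
  proof (rule add_mono)
    show "(\<Sum>x \<in> primary_tx p n w t - {u}. tx_power_p p n * gain p (dist (pos w x) (pos w v)))
      \<le> power_p p * 4 powr path_loss p * (2 * lattice_const (path_loss p))\<^sup>2"
      using powers d by (intro primary_interference_bound path_loss ord q placed ptx) (simp_all add: cu)
    show "(\<Sum>x \<in> secondary_tx p n \<omega> t. tx_power_s p n * gain p (dist (pos (snd \<omega>) x) (pos w v)))
      \<le> power_s p * 4 powr path_loss p * (2 * lattice_const (path_loss p))\<^sup>2"
      using powers d idx active
      by (intro secondary_interference_bound[where c=c] path_loss q placed) (auto simp: sl l_def)
  qed
  then have int: "noise p + interference p n \<omega> u v t \<le> noise p + (power_p p + power_s p) * C"
    by (simp add: algebra_simps)
  have dist: "0 < real (qp p n) * dist (pos w u) (pos w v)" "real (qp p n) * dist (pos w u) (pos w v) \<le> 4"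
    using ne q scaled_dist_le[OF well_placed_pos[OF placed(1)] well_placed_pos[OF placed(1)], of "qp p n" u v] d
    by (auto simp: cu)
  have "power_p p * 4 powr (- path_loss p) \<le> tx_power_p p n * gain p (dist (pos w u) (pos w v))"
    using dist powers path_loss q by (simp add: received_power_eq powr_mono2')
  then have "power_p p * 4 powr (- path_loss p) / (noise p + (power_p p + power_s p) * C)
     \<le> tx_power_p p n * gain p (dist (pos w u) (pos w v)) / (noise p + interference p n \<omega> u v t)"
    using int powers noise interference_nonneg[OF powers, of n \<omega> u v t]
    by (intro frac_le) (auto intro: mult_nonneg_nonneg order_trans[rotated])
  moreover have "0 \<le> power_p p * 4 powr (- path_loss p) / (noise p + (power_p p + power_s p) * C)"
    using powers noise by (intro divide_nonneg_nonneg mult_nonneg_nonneg add_nonneg_nonneg) (auto simp: C_def)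
  ultimately show ?thesis
    unfolding rate_low_def rate_def u_def[symmetric] v_def[symmetric] using C_def
    by (simp add: mult.assoc)
qed

lemma hop_okI:
  assumes nodes: "\<And>c. c \<in> grid (qp p n) \<Longrightarrow> nodes_in (qp p n) w c \<noteq> []"
    and i: "i < num_pairs w" and k: "k < hops (qp p n) w i"
    and L: "L * real (load i k) \<le> rate_low p * slot_len p"
  shows "hop_ok p n \<omega> L i j k"
  unfolding hop_ok_def
proof (intro conjI impI)
  show "nodes_in (qp p n) w (route (qp p n) w i ! Suc k) \<noteq> []" if "Suc k < hops (qp p n) w i"
    using that by (intro nodes route_in_grid)
  have l: "load i k > 0" using packet_index_less[OF i k refl] by linarith
  let ?I = "{hop_start p n w i j k..<hop_end p n w i j k}"
  have "ennreal L \<le> ennreal (rate_low p * (slot_len p / real (load i k)))"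
    using L l by (intro ennreal_leI) (simp add: field_simps)
  also have "\<dots> = ennreal (rate_low p) * emeasure lborel ?I"
    using rate_low_pos[OF noise powers] slot by (simp add: hop_end_def ennreal_mult[symmetric])
  also have "\<dots> = (\<integral>\<^sup>+t\<in>?I. ennreal (rate_low p) \<partial>lborel)"
    by (simp add: nn_integral_cmult_indicator)
  also have "\<dots> \<le> (\<integral>\<^sup>+t\<in>?I. ennreal (rate p n \<omega> (holder p n w i j k) (holder p n w i j (Suc k)) t) \<partial>lborel)"
    using rate_ge[OF nodes i k] by (intro nn_integral_mono) (auto simp: indicator_def intro!: ennreal_leI)
  finally show "ennreal L \<le> (\<integral>\<^sup>+t\<in>?I. ennreal (rate p n \<omega> (holder p n w i j k) (holder p n w i j (Suc k)) t) \<partial>lborel)" .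
qed

text \<open>All packets arrive and each frame of 25 slots emits one, so up to a constant delay
  \<open>t / 25\<close> packets are delivered by slot \<open>t\<close>.\<close>

lemma liminf_bits_ge:
  assumes nodes: "\<And>c. c \<in> grid (qp p n) \<Longrightarrow> nodes_in (qp p n) w c \<noteq> []"
    and i: "i < num_pairs w" and L0: "0 \<le> L"
    and L: "\<And>k. k < hops (qp p n) w i \<Longrightarrow> L * real (load i k) \<le> rate_low p * slot_len p"
  shows "ereal (L / 25) \<le> liminf (\<lambda>t. ereal (bits p n \<omega> L i t / real t))"
proof -
  define h where "h = hops (qp p n) w i - 1"
  \<comment> \<open>The first hop of packet \<open>j\<close> is before slot
    \<open>25 * j + 25\<close>, the last one at most \<open>25 * h\<close> slots later; so the
    packet counts once \<open>25 * j + B \<le> t\<close>.\<close>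
  define B where "B = 26 + 25 * h"
  have del: "delivered p n \<omega> L i j" for j
    unfolding delivered_def using hop_okI[OF nodes i _ L] by blast
  have card: "real t / 25 - real B \<le> real (card {j. delivered p n \<omega> L i j \<and> hop_slot p n w i j h < t})" for t
  proof -
    \<comment> \<open>Essential for a lower bound, because \<open>card\<close> of an infinite set is
      0.\<close>
    have fin: "finite {j. delivered p n \<omega> L i j \<and> hop_slot p n w i j h < t}"
    proof (rule finite_subset)
      show "{j. delivered p n \<omega> L i j \<and> hop_slot p n w i j h < t} \<subseteq> {..t}"
      proof
        fix j assume "j \<in> {j. delivered p n \<omega> L i j \<and> hop_slot p n w i j h < t}"
        then have "hop_slot p n w i j h < t" by simp
        then show "j \<in> {..t}"
          using hop_slot_bounds(1)[OF ord, of n w i j h] hop_slot_0_bounds(1)[OF ord, of j n w i] by simp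
      qed
    qed simp
    have "{j. 25 * j + B \<le> t} \<subseteq> {j. delivered p n \<omega> L i j \<and> hop_slot p n w i j h < t}"
    proof safe
      fix j assume "25 * j + B \<le> t"
      then show "hop_slot p n w i j h < t"
        using hop_slot_bounds(2)[OF ord, of n w i j h] hop_slot_0_bounds(2)[OF ord, of n w i j]
        by (simp add: B_def)
    qed (rule del)
    then have le: "card {j. 25 * j + B \<le> t} \<le> card {j. delivered p n \<omega> L i j \<and> hop_slot p n w i j h < t}"
      by (rule card_mono[OF fin])
    have "real t / 25 - real B \<le> real (card {j. 25 * j + B \<le> t})"
    proof (cases "B \<le> t")
      case True
      have "{j. 25 * j + B \<le> t} = {..(t - B) div 25}" using True by auto
      then have "card {j. 25 * j + B \<le> t} = Suc ((t - B) div 25)" by simp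
      moreover have "t < 25 * Suc ((t - B) div 25) + B"
      proof -
        obtain m where m: "t = m + B" using True le_Suc_ex by (metis add.commute)
        show ?thesis using dividend_less_div_times[of 25 m] by (simp add: m)
      qed
      then have "real t < 25 * real (Suc ((t - B) div 25)) + real B" by linarith
      ultimately show ?thesis by simp
    qed (simp add: field_simps)
    then show ?thesis using le by linarith
  qed
  have "(\<lambda>t. L / 25 - L * real B / real t) \<longlonglongrightarrow> L / 25 - 0"
    by (intro tendsto_diff tendsto_const lim_const_over_n)
  then have "(\<lambda>t. ereal (L / 25 - L * real B / real t)) \<longlonglongrightarrow> ereal (L / 25)" by simp
  then have "ereal (L / 25) = liminf (\<lambda>t. ereal (L / 25 - L * real B / real t))"
    by (rule lim_imp_Liminf[symmetric, rotated]) simp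
  also have "\<dots> \<le> liminf (\<lambda>t. ereal (bits p n \<omega> L i t / real t))"
  proof (rule Liminf_mono)
    show "\<forall>\<^sub>F t in sequentially. ereal (L / 25 - L * real B / real t) \<le> ereal (bits p n \<omega> L i t / real t)"
      using eventually_gt_at_top[of 0]
    proof eventually_elim
      case (elim t)
      have "L * (real t / 25 - real B) \<le> bits p n \<omega> L i t"
        unfolding bits_def h_def[symmetric] using card L0 by (intro mult_left_mono)
      then have "L * (real t / 25 - real B) / real t \<le> bits p n \<omega> L i t / real t"
        by (intro divide_right_mono) auto
      moreover have "L * (real t / 25 - real B) / real t = L / 25 - L * real B / real t"
        using elim by (simp add: field_simps)
      ultimately show ?case by simp
    qed
  qed
  finally show ?thesis .
qed

lemma rate_le:
  assumes "1 / 2 \<le> real (qp p n) * dist (pos w u) (pos w v)"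
  shows "rate p n \<omega> u v t \<le> rate_high p"
proof -
  have "tx_power_p p n * gain p (dist (pos w u) (pos w v)) \<le> power_p p * (1 / 2) powr (- path_loss p)"
    using assms powers path_loss q by (simp add: received_power_eq powr_mono2')
  also have "(1 / 2) powr (- path_loss p) = 2 powr path_loss p"
    by (simp add: powr_minus_divide powr_divide)
  finally have "tx_power_p p n * gain p (dist (pos w u) (pos w v)) / (noise p + interference p n \<omega> u v t)
      \<le> power_p p * 2 powr path_loss p / noise p"
    using noise powers interference_nonneg[OF powers, of n \<omega> u v t] by (intro frac_le) auto
  moreover have "0 \<le> tx_power_p p n * gain p (dist (pos w u) (pos w v)) / (noise p + interference p n \<omega> u v t)"
    using noise powers interference_nonneg[OF powers, of n \<omega> u v t]
    by (auto simp: tx_power_p_def gain_def intro!: divide_nonneg_nonneg mult_nonneg_nonneg)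
  ultimately show ?thesis unfolding rate_def rate_high_def by simp
qed

text \<open>
  A source in the left half of its cell whose packets leave to the right is at least half a cell side
  away from every receiver of its first hop, so the rate of this hop is bounded.
\<close>
lemma packet_size_le:
  assumes i: "i < num_pairs w"
    and left: "real (qp p n) * fst (pos w (2 * i)) \<le> real (fst (src_cell (qp p n) w i)) + 1 / 2"
    and right: "fst (src_cell (qp p n) w i) < fst (dst_cell (qp p n) w i)"
    and L: "hop_ok p n \<omega> L i j 0"
  shows "L * real (load i 0) \<le> rate_high p * slot_len p"
proof -
  have l: "load i 0 > 0" using packet_index_less[OF i hops_pos[of "qp p n"] refl] by linarith
  define v where "v = holder p n w i j (Suc 0)"
  have h0: "holder p n w i j 0 = 2 * i" by (simp add: holder_def)
  have "cell_of (qp p n) (pos w v) = path_cell (src_cell (qp p n) w i) (dst_cell (qp p n) w i) 1"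
    using L unfolding v_def hop_ok_def by (subst cell_of_next_holder) auto
  then have "fst (cell_of (qp p n) (pos w v)) = Suc (fst (src_cell (qp p n) w i))"
    using path_cell_1_right[OF right] by simp
  then have "1 / 2 \<le> real (qp p n) * fst (pos w v) - real (qp p n) * fst (pos w (2 * i))"
    using left cell_of_bounds(1)[OF well_placed_pos[OF placed(1), of v], of "qp p n"] by simp
  also have "\<dots> = real (qp p n) * (fst (pos w v) - fst (pos w (2 * i)))" by (simp add: right_diff_distrib)
  also have "\<dots> \<le> real (qp p n) * dist (pos w (2 * i)) (pos w v)"
    using dist_fst_le[of "pos w (2 * i)" "pos w v"] by (intro mult_left_mono) (auto simp: dist_real_def)
  finally have far: "1 / 2 \<le> real (qp p n) * dist (pos w (2 * i)) (pos w v)" .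
  let ?I = "{hop_start p n w i j 0..<hop_end p n w i j 0}"
  have "ennreal L \<le> (\<integral>\<^sup>+t\<in>?I. ennreal (rate p n \<omega> (2 * i) v t) \<partial>lborel)"
    using L unfolding hop_ok_def h0 v_def by simp
  also have "\<dots> \<le> (\<integral>\<^sup>+t\<in>?I. ennreal (rate_high p) \<partial>lborel)"
    using rate_le[OF far] by (intro nn_integral_mono) (auto simp: indicator_def intro!: ennreal_leI)
  also have "\<dots> = ennreal (rate_high p) * emeasure lborel ?I"
    by (simp add: nn_integral_cmult_indicator)
  also have "\<dots> = ennreal (rate_high p * (slot_len p / real (load i 0)))"
    using rate_high_pos[OF noise powers(1)] slot by (simp add: hop_end_def ennreal_mult[symmetric])
  finally have "L \<le> rate_high p * (slot_len p / real (load i 0))"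
    using rate_high_pos[OF noise powers(1)] slot by (subst (asm) ennreal_le_iff) auto
  then show ?thesis using l by (simp add: field_simps)
qed

end

subsection \<open>Growth of the number of cells\<close>

lemma cells_per_side_at_top:
  assumes lim: "(\<lambda>n. k n * ln (d n) / d n) \<longlonglongrightarrow> 0"
    and pos: "\<forall>\<^sub>F n in sequentially. 0 < k n * ln (d n) / d n"
  shows "filterlim (\<lambda>n. cells_per_side (k n) (d n)) at_top sequentially"
proof -
  have "filterlim (\<lambda>n. sqrt (k n * ln (d n) / d n)) (at_right 0) sequentially"
    unfolding filterlim_at
    using tendsto_real_sqrt[OF lim] pos by (auto elim: eventually_mono)
  then have "filterlim (\<lambda>n. 1 / sqrt (k n * ln (d n) / d n)) at_top sequentially"
    unfolding inverse_eq_divide[symmetric] by (rule filterlim_compose[OF filterlim_inverse_at_top_right])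
  then have "filterlim (\<lambda>n. nat \<lfloor>1 / sqrt (k n * ln (d n) / d n)\<rfloor>) at_top sequentially"
    by (intro filterlim_compose[OF filterlim_nat_sequentially] filterlim_compose[OF filterlim_floor_sequentially])
  then show ?thesis by (simp add: cells_per_side_def)
qed

text \<open>A cell contains at least \<open>ln d\<close> nodes on average. Rounding the number of
  cells down only enlarges the cells.\<close>

lemma cells_per_side_sq_le:
  assumes "k \<ge> 1" "ln d > 0" "d > 0"
  shows "(real (cells_per_side k d))\<^sup>2 * ln d \<le> d"
proof -
  define x where "x = k * ln d / d"
  have x: "x > 0" "ln d / d \<le> x" using assms by (auto simp: x_def divide_right_mono)
  have "real (cells_per_side k d) \<le> 1 / sqrt x"
    unfolding cells_per_side_def x_def[symmetric] using x by (simp add: of_nat_floor)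
  then have "(real (cells_per_side k d))\<^sup>2 \<le> (1 / sqrt x)\<^sup>2" by (rule power_mono) simp
  also have "\<dots> = 1 / x" using x by (simp add: power_divide)
  also have "\<dots> \<le> 1 / (ln d / d)" using x assms by (intro divide_left_mono) auto
  finally show ?thesis using assms by (simp add: field_simps)
qed

subsection \<open>Strips and cells of the unit square\<close>

definition row_strip :: "nat \<Rightarrow> nat \<Rightarrow> point set" where
  "row_strip q y = {0..<1} \<times> {real y / real q..<(real y + 1) / real q}"

definition column_strip :: "nat \<Rightarrow> nat \<Rightarrow> point set" where
  "column_strip q x = {real x / real q..<(real x + 1) / real q} \<times> {0..<1}"

definition cell_set :: "nat \<Rightarrow> cell \<Rightarrow> point set" where
  "cell_set q c = {real (fst c) / real q..<(real (fst c) + 1) / real q} \<times>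
     {real (snd c) / real q..<(real (snd c) + 1) / real q}"

definition left_part :: "point set" where
  "left_part = {0..<1/4} \<times> {0..<1}"

definition right_part :: "point set" where
  "right_part = {3/4..<1} \<times> {0..<1}"

definition left_row :: "nat \<Rightarrow> nat \<Rightarrow> point set" where
  "left_row q y = {0..<1/4} \<times> {real y / real q..<(real y + 1) / real q}"

text \<open>The left half of the column \<open>q div 2\<close>, where the sources for
  \<open>packet_size_le\<close> are sought.\<close>

definition middle_strip :: "nat \<Rightarrow> point set" where
  "middle_strip q = {real (q div 2) / real q..<(real (q div 2) + 1 / 2) / real q} \<times> {0..<1}"

lemma regions_in_sets [measurable]:
  "row_strip q y \<in> sets borel" "column_strip q y \<in> sets borel" "cell_set q c \<in> sets borel"
  "left_part \<in> sets borel" "right_part \<in> sets borel" "left_row q y \<in> sets borel"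
  "middle_strip q \<in> sets borel"
  unfolding row_strip_def column_strip_def cell_set_def left_part_def right_part_def left_row_def middle_strip_def
  by (rule rect_in_borel)+

lemma slab_bounds:
  assumes "y < q" "0 \<le> e" "e \<le> 1"
  shows "0 \<le> real y / real q" "real y / real q \<le> (real y + e) / real q" "(real y + e) / real q \<le> 1"
    "(real y + e) / real q - real y / real q = e / real q"
proof -
  have "real y + e \<le> real q" using assms by linarith
  then show "(real y + e) / real q \<le> 1" using assms by (simp add: divide_le_eq_1)
qed (use assms in \<open>auto simp: divide_right_mono add_divide_distrib\<close>)

lemma measure_regions:
  "y < q \<Longrightarrow> measure unif (row_strip q y) = 1 / real q"
  "y < q \<Longrightarrow> measure unif (column_strip q y) = 1 / real q"
  "c \<in> grid q \<Longrightarrow> measure unif (cell_set q c) = 1 / (real q)\<^sup>2"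
  "measure unif left_part = 1 / 4"
  "measure unif right_part = 1 / 4"
  "y < q \<Longrightarrow> measure unif (left_row q y) = 1 / (4 * real q)"
  "0 < q \<Longrightarrow> measure unif (middle_strip q) = 1 / (2 * real q)"
  "measure unif unit_square = 1"
proof -
  note slab = slab_bounds[OF _ zero_le_one order_refl]
  show "measure unif (row_strip q y) = 1 / real q" "measure unif (column_strip q y) = 1 / real q" if "y < q"
    unfolding row_strip_def column_strip_def using slab[OF that] by (simp_all add: measure_unif_rect)
  show "measure unif (left_row q y) = 1 / (4 * real q)" if "y < q"
    unfolding left_row_def using slab[OF that] by (simp add: measure_unif_rect)
  show "measure unif (cell_set q c) = 1 / (real q)\<^sup>2" if "c \<in> grid q"
    using slab[of "fst c" q] slab[of "snd c" q] that unfolding cell_set_def grid_def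
    by (simp add: measure_unif_rect mem_Times_iff power2_eq_square)
  show "measure unif (middle_strip q) = 1 / (2 * real q)" if "0 < q"
    unfolding middle_strip_def using slab_bounds[of "q div 2" q "1/2"] that
    by (simp add: measure_unif_rect)
qed (simp_all add: left_part_def right_part_def measure_unif_rect)

abbreviation net_space :: "nat \<Rightarrow> net measure" where
  "net_space n \<equiv> poisson_net (real n)"

lemma net_sets:
  assumes [measurable]: "S \<in> sets borel" "T \<in> sets borel"
  shows "{w \<in> space (poisson_net d). \<not> P (node_count S w)} \<in> sets (poisson_net d)"
    and "{w \<in> space (poisson_net d). \<not> P (pair_count S T w)} \<in> sets (poisson_net d)"
  by measurable

text \<open>Turns error terms in \<open>n / q\<close> into functions of \<open>q\<close> alone,
  whose limits follow from \<open>qp_at_top\<close>.\<close>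

lemma exp_qp_le:
  assumes "(real q)\<^sup>2 \<le> x" "0 < q" "0 < a"
  shows "exp (- (x / (a * real q))) \<le> exp (- (real q / a))"
proof -
  have "real q / a \<le> x / (a * real q)" using assms by (simp add: field_simps power2_eq_square)
  then show ?thesis by simp
qed

locale scaling =
  fixes p :: overlay
  assumes density: "density_exp p > 1" and cell_const: "\<And>n. cell_const p n \<ge> 1"
    and cell_limit: "(\<lambda>n. cell_const p n * ln (real n) / real n) \<longlonglongrightarrow> 0"
begin

lemma eventually_ln_ge_1: "\<forall>\<^sub>F n in sequentially. 1 \<le> ln (real n)"
  by real_asymp

lemma qp_at_top: "filterlim (qp p) at_top sequentially"
  unfolding qp_def
proof (rule cells_per_side_at_top[OF cell_limit])
  show "\<forall>\<^sub>F n in sequentially. 0 < cell_const p n * ln (real n) / real n"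
    using eventually_ln_ge_1 eventually_gt_at_top[of 0]
  proof eventually_elim
    case (elim n)
    have "0 < cell_const p n" "0 < ln (real n)" "0 < real n" using cell_const[of n] elim by linarith+
    then show ?case by (intro divide_pos_pos mult_pos_pos)
  qed
qed

text \<open>The secondary density is at least \<open>n\<close> and its logarithm is \<beta> times
  that of \<open>n\<close>, so the secondary cell area before rounding is at most \<beta> times the
  primary one.\<close>

lemma qs_at_top: "filterlim (qs p) at_top sequentially"
  unfolding qs_def
proof (rule cells_per_side_at_top)
  let ?x = "\<lambda>n. cell_const p n * ln (secondary_density p n) / secondary_density p n"
  have ev: "\<forall>\<^sub>F n in sequentially. 0 < ?x n \<and> ?x n \<le> density_exp p * (cell_const p n * ln (real n) / real n)"
    using eventually_ln_ge_1 eventually_gt_at_top[of 0]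
  proof eventually_elim
    case (elim n)
    define N where "N = real n"
    have N: "N \<ge> 1" "ln N \<ge> 1" using elim by (simp_all add: N_def)
    have k: "cell_const p n > 0" using cell_const[of n] by linarith
    have l: "ln (secondary_density p n) = density_exp p * ln N"
      using N by (simp add: secondary_density_def N_def ln_powr)
    have m: "N \<le> secondary_density p n"
      using N density powr_mono[of 1 "density_exp p" N] by (simp add: secondary_density_def N_def)
    have pos: "0 < cell_const p n * (density_exp p * ln N)" using k N density by (intro mult_pos_pos) linarith+
    then have "cell_const p n * (density_exp p * ln N) / secondary_density p n \<le>
        cell_const p n * (density_exp p * ln N) / N"
      using N m by (intro divide_left_mono) auto
    then show ?case unfolding l N_def[symmetric] using pos m N by (auto simp: mult_ac)
  qed
  then show "\<forall>\<^sub>F n in sequentially. 0 < ?x n" by (rule eventually_mono) simp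
  show "?x \<longlonglongrightarrow> 0"
  proof (rule tendsto_sandwich[of "\<lambda>_. 0"])
    show "(\<lambda>n. density_exp p * (cell_const p n * ln (real n) / real n)) \<longlonglongrightarrow> 0"
      using tendsto_mult_right_zero[OF cell_limit] .
    show "\<forall>\<^sub>F n in sequentially. ?x n \<le> density_exp p * (cell_const p n * ln (real n) / real n)"
      using ev by (rule eventually_mono) simp
    show "\<forall>\<^sub>F n in sequentially. 0 \<le> ?x n" using ev by (rule eventually_mono) simp
  qed simp
qed

lemma eventually_q:
  "\<forall>\<^sub>F n in sequentially. m \<le> qp p n \<and> 0 < qs p n \<and> 0 < n \<and> 1 \<le> ln (real n) \<and>
     (real (qp p n))\<^sup>2 * ln (real n) \<le> real n \<and> (real (qp p n))\<^sup>2 \<le> real n"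
proof -
  have "\<forall>\<^sub>F n in sequentially. m \<le> qp p n" "\<forall>\<^sub>F n in sequentially. 1 \<le> qs p n"
    using qp_at_top qs_at_top unfolding filterlim_at_top by blast+
  then show ?thesis using eventually_ln_ge_1 eventually_gt_at_top[of 0]
  proof eventually_elim
    case (elim n)
    then have *: "(real (qp p n))\<^sup>2 * ln (real n) \<le> real n"
      unfolding qp_def using cell_const[of n] by (intro cells_per_side_sq_le) linarith+
    have "(real (qp p n))\<^sup>2 * 1 \<le> (real (qp p n))\<^sup>2 * ln (real n)"
      using elim by (intro mult_left_mono) auto
    then show ?case using elim * by linarith
  qed
qed

lemma real_qp_at_top: "filterlim (\<lambda>n. real (qp p n)) at_top sequentially"
  by (rule filterlim_compose[OF filterlim_real_sequentially qp_at_top])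

subsection \<open>Typical networks\<close>

text \<open>A cell is empty with probability at most \<open>1 / n\<close>, and there are at most
  \<open>n / ln n\<close> cells; the union bound leaves \<open>1 / ln n\<close>.\<close>

lemma whp_cells_occupied:
  "whp net_space (\<lambda>n w. \<forall>c\<in>grid (qp p n). node_count (cell_set (qp p n) c) w \<noteq> 0)"
proof (rule whp_union_bound[where b="\<lambda>n. 1 / real n"])
  show "\<forall>\<^sub>F n in sequentially. \<forall>c\<in>grid (qp p n).
     measure (net_space n) {w \<in> space (net_space n). \<not> node_count (cell_set (qp p n) c) w \<noteq> 0} \<le> 1 / real n"
    using eventually_q[of 1]
  proof eventually_elim
    case (elim n)
    show ?case
    proof
      fix c assume c: "c \<in> grid (qp p n)"
      have "ln (real n) \<le> real n * (1 / (real (qp p n))\<^sup>2)" using elim by (simp add: field_simps)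
      then have "exp (- (real n * (1 / (real (qp p n))\<^sup>2))) \<le> exp (- ln (real n))" by simp
      also have "\<dots> = 1 / real n" using elim by (simp add: exp_minus inverse_eq_divide)
      finally show "measure (net_space n) {w \<in> space (net_space n). \<not> node_count (cell_set (qp p n) c) w \<noteq> 0} \<le> 1 / real n"
        using prob_node_count_eq_0[of "cell_set (qp p n) c" "real n"] elim by (simp add: measure_regions(3)[OF c])
    qed
  qed
  have lim: "(\<lambda>n. 1 / ln (real n)) \<longlonglongrightarrow> 0" by real_asymp
  have le: "\<forall>\<^sub>F n in sequentially. real (card (grid (qp p n))) * (1 / real n) \<le> 1 / ln (real n)"
    using eventually_q[of 1]
  proof eventually_elim
    case (elim n)
    then have "0 < ln (real n)" by linarith
    then have "(real (qp p n))\<^sup>2 \<le> real n / ln (real n)" using elim by (subst pos_le_divide_eq) auto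
    then have "(real (qp p n))\<^sup>2 / real n \<le> real n / ln (real n) / real n" by (rule divide_right_mono) simp
    then show ?case using elim by (simp add: grid_def power2_eq_square)
  qed
  show "(\<lambda>n. real (card (grid (qp p n))) * (1 / real n)) \<longlonglongrightarrow> 0"
    by (rule tendsto_sandwich[OF _ le tendsto_const lim]) simp
  show "{w \<in> space (net_space n). \<not> node_count (cell_set (qp p n) c) w \<noteq> 0} \<in> sets (net_space n)" for n c
    by (rule net_sets(1)) measurable
qed (simp_all add: prob_space_poisson_net grid_def)

lemma tendsto_qp_exp:
  assumes "a > 0" shows "(\<lambda>n. real (qp p n) * (b * exp (- (real (qp p n) / a)))) \<longlonglongrightarrow> 0"
proof -
  have "((\<lambda>x. x * (b * exp (- (x / a)))) \<longlongrightarrow> 0) at_top" using assms by real_asymp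
  then show ?thesis by (rule filterlim_compose[OF _ real_qp_at_top])
qed

text \<open>Stated for any strips of area \<open>1 / q\<close>, to serve rows and columns alike; the
  total error is at most \<open>q * exp (- q)\<close>.\<close>

lemma whp_strips:
  assumes S: "\<And>q y. S q y \<in> sets borel" and m: "\<And>q y. y < q \<Longrightarrow> measure unif (S q y) = 1 / real q"
  shows "whp net_space (\<lambda>n w. \<forall>y\<in>{..<qp p n}. real (node_count (S (qp p n) y) w) \<le> 3 * (real n / real (qp p n)))"
proof (rule whp_union_bound[where b="\<lambda>n. exp (- real (qp p n))"])
  show "\<forall>\<^sub>F n in sequentially. \<forall>y\<in>{..<qp p n}.
     measure (net_space n) {w \<in> space (net_space n).
       \<not> real (node_count (S (qp p n) y) w) \<le> 3 * (real n / real (qp p n))} \<le> exp (- real (qp p n))"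
    using eventually_q[of 1]
  proof eventually_elim
    case (elim n)
    show ?case
    proof
      fix y assume y: "y \<in> {..<qp p n}"
      have e: "real n * measure unif (S (qp p n) y) = real n / real (qp p n)" using m y by simp
      have "measure (net_space n) {w \<in> space (net_space n).
          \<not> real (node_count (S (qp p n) y) w) \<le> 3 * (real n / real (qp p n))} \<le> exp (- (real n / real (qp p n)))"
        using node_count_upper_tail[OF S[of "qp p n" y], of "real n"] elim unfolding e by simp
      also have "\<dots> \<le> exp (- real (qp p n))"
        using exp_qp_le[of "qp p n" "real n" 1] elim by simp
      finally show "measure (net_space n) {w \<in> space (net_space n).
          \<not> real (node_count (S (qp p n) y) w) \<le> 3 * (real n / real (qp p n))} \<le> exp (- real (qp p n))" .
    qed
  qed
  show "(\<lambda>n. real (card {..<qp p n}) * exp (- real (qp p n))) \<longlonglongrightarrow> 0"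
    using tendsto_qp_exp[of 1 1] by simp
  show "{w \<in> space (net_space n). \<not> real (node_count (S (qp p n) y) w) \<le> 3 * (real n / real (qp p n))}
    \<in> sets (net_space n)" for n y
    using net_sets(1)[OF S S] .
qed (simp_all add: prob_space_poisson_net)

text \<open>The regions have measure \<open>1 / (4 * q)\<close> and \<open>1 / 4\<close>, and the
  tail bound costs a factor 8; hence 128.\<close>

lemma whp_left_rows:
  "whp net_space (\<lambda>n w. \<forall>y\<in>{..<qp p n}.
     real n / (128 * real (qp p n)) \<le> real (pair_count (left_row (qp p n) y) right_part w))"
proof (rule whp_union_bound[where b="\<lambda>n. 2 * exp (- (real (qp p n) / 128))"])
  show "\<forall>\<^sub>F n in sequentially. \<forall>y\<in>{..<qp p n}.
     measure (net_space n) {w \<in> space (net_space n).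
       \<not> real n / (128 * real (qp p n)) \<le> real (pair_count (left_row (qp p n) y) right_part w)}
       \<le> 2 * exp (- (real (qp p n) / 128))"
    using eventually_q[of 1]
  proof eventually_elim
    case (elim n)
    show ?case
    proof
      fix y assume y: "y \<in> {..<qp p n}"
      have e: "real n * (measure unif (left_row (qp p n) y) * measure unif right_part) / 8 =
          real n / (128 * real (qp p n))" using y by (simp add: measure_regions)
      have "measure (net_space n) {w \<in> space (net_space n).
         \<not> real n / (128 * real (qp p n)) \<le> real (pair_count (left_row (qp p n) y) right_part w)}
         \<le> 2 * exp (- (real n / (128 * real (qp p n))))"
        using pair_count_lower_tail[of "left_row (qp p n) y" right_part "real n"] elim unfolding e by simp
      also have "\<dots> \<le> 2 * exp (- (real (qp p n) / 128))"
        using exp_qp_le[of "qp p n" "real n" 128] elim by simp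
      finally show "measure (net_space n) {w \<in> space (net_space n).
         \<not> real n / (128 * real (qp p n)) \<le> real (pair_count (left_row (qp p n) y) right_part w)}
         \<le> 2 * exp (- (real (qp p n) / 128))" .
    qed
  qed
  show "(\<lambda>n. real (card {..<qp p n}) * (2 * exp (- (real (qp p n) / 128)))) \<longlonglongrightarrow> 0"
    using tendsto_qp_exp[of 128 2] by simp
  show "{w \<in> space (net_space n). \<not> real n / (128 * real (qp p n)) \<le> real (pair_count (left_row (qp p n) y) right_part w)}
    \<in> sets (net_space n)" for n y
    by (rule net_sets(2)) measurable
qed (simp_all add: prob_space_poisson_net)

text \<open>Only existence is of interest, so a positive lower bound suffices; the regions of
  measure \<open>1 / (2 * q)\<close> and \<open>1 / 4\<close> give 64.\<close>

lemma whp_middle_source: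
  "whp net_space (\<lambda>n w. 0 < pair_count (middle_strip (qp p n)) right_part w)"
proof (rule whp_single_bound[where b="\<lambda>n. 2 * exp (- (real (qp p n) / 64))"])
  show "\<forall>\<^sub>F n in sequentially. measure (net_space n) {w \<in> space (net_space n).
       \<not> 0 < pair_count (middle_strip (qp p n)) right_part w} \<le> 2 * exp (- (real (qp p n) / 64))"
    using eventually_q[of 1]
  proof eventually_elim
    case (elim n)
    interpret prob_space "net_space n" by (rule prob_space_poisson_net)
    have pos: "0 < real n / (64 * real (qp p n))" using elim by simp
    have "measure (net_space n) {w \<in> space (net_space n). \<not> 0 < pair_count (middle_strip (qp p n)) right_part w}
        \<le> measure (net_space n) {w \<in> space (net_space n).
            \<not> real n / (64 * real (qp p n)) \<le> real (pair_count (middle_strip (qp p n)) right_part w)}"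
      using pos by (intro finite_measure_mono net_sets(2)) auto
    also have "\<dots> \<le> 2 * exp (- (real n / (64 * real (qp p n))))"
      using pair_count_lower_tail[of "middle_strip (qp p n)" right_part "real n"] elim
      by (simp add: measure_regions)
    also have "\<dots> \<le> 2 * exp (- (real (qp p n) / 64))"
      using exp_qp_le[of "qp p n" "real n" 64] elim by simp
    finally show ?case .
  qed
  have "((\<lambda>x. 2 * exp (- (x / 64)) :: real) \<longlongrightarrow> 0) at_top" by real_asymp
  then show "(\<lambda>n. 2 * exp (- (real (qp p n) / 64))) \<longlonglongrightarrow> 0"
    by (rule filterlim_compose[OF _ real_qp_at_top])
  show "{w \<in> space (net_space n). \<not> 0 < pair_count (middle_strip (qp p n)) right_part w} \<in> sets (net_space n)" for n
    by (rule net_sets(2)) measurable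
qed (rule prob_space_poisson_net)

lemma whp_left_right:
  "whp net_space (\<lambda>n w. real n / 128 \<le> real (pair_count left_part right_part w))"
proof (rule whp_single_bound[where b="\<lambda>n. 2 * exp (- (real n / 128))"])
  show "\<forall>\<^sub>F n in sequentially. measure (net_space n) {w \<in> space (net_space n).
       \<not> real n / 128 \<le> real (pair_count left_part right_part w)} \<le> 2 * exp (- (real n / 128))"
    using eventually_gt_at_top[of 0]
    by eventually_elim
      (use pair_count_lower_tail[of left_part right_part] in \<open>simp add: measure_regions\<close>)
  show "(\<lambda>n. 2 * exp (- (real n / 128))) \<longlonglongrightarrow> 0" by real_asymp
  show "{w \<in> space (net_space n). \<not> real n / 128 \<le> real (pair_count left_part right_part w)} \<in> sets (net_space n)" for n
    by (rule net_sets(2)) measurable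
qed (rule prob_space_poisson_net)

lemma whp_node_number:
  "whp net_space (\<lambda>n w. real (node_count unit_square w) \<le> 3 * real n)"
proof (rule whp_single_bound[where b="\<lambda>n. exp (- real n)"])
  show "\<forall>\<^sub>F n in sequentially. measure (net_space n) {w \<in> space (net_space n).
       \<not> real (node_count unit_square w) \<le> 3 * real n} \<le> exp (- real n)"
    using eventually_gt_at_top[of 0]
  proof eventually_elim
    case (elim n)
    then show ?case
      using node_count_upper_tail[of unit_square "real n", OF rect_in_borel] unfolding measure_regions by simp
  qed
  show "(\<lambda>n. exp (- real n)) \<longlonglongrightarrow> 0" by real_asymp
  show "{w \<in> space (net_space n). \<not> real (node_count unit_square w) \<le> 3 * real n} \<in> sets (net_space n)" for n
    by (rule net_sets(1)) measurable
qed (rule prob_space_poisson_net)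

end

section \<open>Transfer to the overlaid networks; loads of cells in terms of counts in
  strips\<close>

lemma AE_pair_fst_snd:
  assumes "prob_space M" "prob_space N"
  shows "AE x in M. P x \<Longrightarrow> AE z in M \<Otimes>\<^sub>M N. P (fst z)"
    and "AE y in N. Q y \<Longrightarrow> AE z in M \<Otimes>\<^sub>M N. Q (snd z)"
proof -
  interpret N: prob_space N by fact
  interpret M: prob_space M by fact
  show "AE z in M \<Otimes>\<^sub>M N. P (fst z)" if ae: "AE x in M. P x"
  proof -
    obtain A where A: "{x \<in> space M. \<not> P x} \<subseteq> A" "emeasure M A = 0" "A \<in> sets M" using ae by (rule AE_E)
    show ?thesis
    proof (rule AE_I)
      show "{z \<in> space (M \<Otimes>\<^sub>M N). \<not> P (fst z)} \<subseteq> A \<times> space N" using A by (auto simp: space_pair_measure)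
    qed (use A in \<open>auto simp: N.emeasure_pair_measure_Times\<close>)
  qed
  show "AE z in M \<Otimes>\<^sub>M N. Q (snd z)" if ae: "AE y in N. Q y"
  proof -
    obtain A where A: "{x \<in> space N. \<not> Q x} \<subseteq> A" "emeasure N A = 0" "A \<in> sets N" using ae by (rule AE_E)
    show ?thesis
    proof (rule AE_I)
      show "{z \<in> space (M \<Otimes>\<^sub>M N). \<not> Q (snd z)} \<subseteq> space M \<times> A" using A by (auto simp: space_pair_measure)
    qed (use A in \<open>auto simp: N.emeasure_pair_measure_Times\<close>)
  qed
qed

lemma AE_well_placed: "AE w in poisson_net d. well_placed w"
proof -
  have 1: "AE X in points. X u \<in> unit_square" for u
    using AE_unif by (intro points.AE_component) auto
  have 2: "AE X in points. X (2 * i) \<noteq> X (2 * i + 1)" for i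
    by (rule AE_points_distinct) simp
  have "AE X in points. (\<forall>u. X u \<in> unit_square) \<and> (\<forall>i. X (2 * i) \<noteq> X (2 * i + 1))"
    using 1 2 by (simp only: AE_conj_iff AE_all_countable simp_thms)
  then have "AE w in poisson_net d. (\<forall>u. snd w u \<in> unit_square) \<and> (\<forall>i. snd w (2 * i) \<noteq> snd w (2 * i + 1))"
    unfolding poisson_net_def unif_def[symmetric]
    by (intro AE_pair_fst_snd(2) prob_space_measure_pmf points.P.prob_space_axioms)
  then show ?thesis by (simp only: well_placed_def pos_def)
qed

lemma AE_overlay_well_placed:
  "AE \<omega> in overlay_space p n. well_placed (fst \<omega>) \<and> well_placed (snd \<omega>)"
  unfolding overlay_space_def
  by (intro AE_conjI AE_pair_fst_snd prob_space_poisson_net AE_well_placed)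

text \<open>Of the secondary network only an almost sure property is kept, because its interference
  is bounded for every placement of its nodes in the square.\<close>

lemma whp_overlay:
  assumes "whp (\<lambda>n. poisson_net (real n)) Q"
  shows "whp (overlay_space p) (\<lambda>n \<omega>. Q n (fst \<omega>) \<and> well_placed (fst \<omega>) \<and> well_placed (snd \<omega>))"
proof (rule whp_conj)
  show "whp (overlay_space p) (\<lambda>n \<omega>. Q n (fst \<omega>))"
    using whp_pair_fst[OF prob_space_poisson_net prob_space_poisson_net assms]
    unfolding overlay_space_def .
  show "whp (overlay_space p) (\<lambda>n \<omega>. well_placed (fst \<omega>) \<and> well_placed (snd \<omega>))"
    by (intro whp_AE prob_space_overlay AE_overlay_well_placed)
qed (rule prob_space_overlay)

lemma slab_mem_iff:
  assumes "q > 0"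
  shows "t \<in> {real a / real q..<(real a + e) / real q} \<longleftrightarrow> real a \<le> real q * t \<and> real q * t < real a + e"
  using assms by (auto simp: field_simps)

lemma cell_of_eqI:
  assumes "z \<in> cell_set q c" "q > 0"
  shows "cell_of q z = c"
proof -
  have "real (fst c) \<le> real q * fst z" "real q * fst z < real (fst c) + 1"
    "real (snd c) \<le> real q * snd z" "real q * snd z < real (snd c) + 1"
    using assms slab_mem_iff[OF assms(2), of _ _ 1] by (auto simp: cell_set_def mem_Times_iff)
  then have "\<lfloor>real q * fst z\<rfloor> = int (fst c)" "\<lfloor>real q * snd z\<rfloor> = int (snd c)"
    by (simp_all add: floor_eq_iff)
  then show ?thesis by (simp add: cell_of_def)
qed

lemma mem_row_iff:
  assumes "z \<in> unit_square" "q > 0"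
  shows "z \<in> row_strip q y \<longleftrightarrow> snd (cell_of q z) = y"
proof -
  have "snd z \<in> {real y / real q..<(real y + 1) / real q} \<longleftrightarrow> snd (cell_of q z) = y"
    unfolding slab_mem_iff[OF assms(2)] using cell_of_bounds(3,4)[OF assms(1), of q] by auto
  then show ?thesis using assms(1) by (simp add: row_strip_def mem_Times_iff)
qed

lemma mem_column_iff:
  assumes "z \<in> unit_square" "q > 0"
  shows "z \<in> column_strip q x \<longleftrightarrow> fst (cell_of q z) = x"
proof -
  have "fst z \<in> {real x / real q..<(real x + 1) / real q} \<longleftrightarrow> fst (cell_of q z) = x"
    unfolding slab_mem_iff[OF assms(2)] using cell_of_bounds(1,2)[OF assms(1), of q] by auto
  then show ?thesis using assms(1) by (simp add: column_strip_def mem_Times_iff)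
qed

lemma mem_left_row_iff:
  assumes "z \<in> unit_square" "q > 0"
  shows "z \<in> left_row q y \<longleftrightarrow> fst z < 1 / 4 \<and> snd (cell_of q z) = y"
proof -
  have "z \<in> left_row q y \<longleftrightarrow> fst z < 1 / 4 \<and> z \<in> row_strip q y"
    using assms(1) by (auto simp: left_row_def row_strip_def mem_Times_iff)
  then show ?thesis using mem_row_iff[OF assms] by simp
qed

lemma nodes_in_nonempty:
  assumes "node_count (cell_set q c) w \<noteq> 0" "q > 0"
  shows "nodes_in q w c \<noteq> []"
proof -
  have "{u. u < fst w \<and> pos w u \<in> cell_set q c} \<noteq> {}"
    using assms(1) unfolding node_count_def by (metis card.empty)
  then obtain u where "u < fst w" "cell_of q (pos w u) = c"
    using cell_of_eqI assms(2) by blast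
  then show ?thesis by (auto simp: nodes_in_def filter_empty_conv)
qed

lemma card_pairs_le_node_count:
  assumes "q > 0" "well_placed w"
  shows "card {i. i < num_pairs w \<and> snd (src_cell q w i) = y} \<le> node_count (row_strip q y) w"
    and "card {i. i < num_pairs w \<and> fst (dst_cell q w i) = x} \<le> node_count (column_strip q x) w"
proof -
  show "card {i. i < num_pairs w \<and> snd (src_cell q w i) = y} \<le> node_count (row_strip q y) w"
    unfolding node_count_def
    by (rule card_inj_on_le[where f="\<lambda>i. 2 * i"])
      (auto simp: inj_on_def src_cell_def num_pairs_def mem_row_iff[OF well_placed_pos[OF assms(2)] assms(1)])
  show "card {i. i < num_pairs w \<and> fst (dst_cell q w i) = x} \<le> node_count (column_strip q x) w"
    unfolding node_count_def
    by (rule card_inj_on_le[where f="\<lambda>i. 2 * i + 1"])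
      (auto simp: inj_on_def dst_cell_def num_pairs_def mem_column_iff[OF well_placed_pos[OF assms(2)] assms(1)])
qed

text \<open>The row counts twice: its sources may have paths through the cell, or start in
  it.\<close>

lemma packet_slots_le:
  assumes "q > 0" "well_placed w"
  shows "length (packet_slots q w c) \<le> 2 * node_count (row_strip q (snd c)) w + node_count (column_strip q (fst c)) w"
proof -
  let ?A = "{i. i < num_pairs w \<and> snd (src_cell q w i) = snd c}"
  let ?B = "{i. i < num_pairs w \<and> fst (dst_cell q w i) = fst c}"
  have "length (through q w c) = card (set (through q w c))"
    by (rule distinct_card[symmetric]) (simp add: through_def)
  also have "\<dots> \<le> card (?A \<union> ?B)"
  proof (rule card_mono)
    show "set (through q w c) \<subseteq> ?A \<union> ?B"
    proof
      fix i assume "i \<in> set (through q w c)"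
      then obtain k where "i < num_pairs w" "c = path_cell (src_cell q w i) (dst_cell q w i) k"
        by (auto simp: set_through nth_route)
      then show "i \<in> ?A \<union> ?B"
        using path_cell_row_or_column[of "src_cell q w i" "dst_cell q w i" k] by auto
    qed
  qed simp
  also have "\<dots> \<le> card ?A + card ?B" by (rule card_Un_le)
  finally have t: "length (through q w c) \<le> card ?A + card ?B" .
  have "length (originating q w c) = card (set (originating q w c))"
    by (rule distinct_card[symmetric]) (simp add: originating_def)
  also have "\<dots> \<le> card ?A" by (rule card_mono) (auto simp: set_originating)
  finally have "length (packet_slots q w c) \<le> 2 * card ?A + card ?B"
    using t by (simp add: packet_slots_def)
  then show ?thesis using card_pairs_le_node_count(1)[OF assms, of "snd c"] card_pairs_le_node_count(2)[OF assms, of "fst c"]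
    by linarith
qed

text \<open>Every pair counted here crosses the middle column horizontally, in the row of the cell.\<close>
lemma packet_slots_ge:
  assumes q: "q \<ge> 4" and w: "well_placed w" and c: "fst c = q div 2"
  shows "pair_count (left_row q (snd c)) right_part w \<le> length (packet_slots q w c)"
proof -
  have "{i. i < num_pairs w \<and> pos w (2 * i) \<in> left_row q (snd c) \<and> pos w (2 * i + 1) \<in> right_part}
     \<subseteq> set (through q w c)"
  proof
    fix i assume "i \<in> {i. i < num_pairs w \<and> pos w (2 * i) \<in> left_row q (snd c) \<and> pos w (2 * i + 1) \<in> right_part}"
    then have i: "i < num_pairs w" "pos w (2 * i) \<in> left_row q (snd c)" "pos w (2 * i + 1) \<in> right_part" by auto
    have l: "fst (pos w (2 * i)) < 1 / 4" "snd (src_cell q w i) = snd c"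
      using i(2) mem_left_row_iff[OF well_placed_pos[OF w]] q by (auto simp: src_cell_def)
    have r: "3 / 4 \<le> fst (pos w (2 * i + 1))" using i(3) by (auto simp: right_part_def mem_Times_iff)
    have "real q * fst (pos w (2 * i)) \<le> real q * (1 / 4)" "real q * (3 / 4) \<le> real q * fst (pos w (2 * i + 1))"
      using l r by (intro mult_left_mono; simp)+
    then have "real (fst (src_cell q w i)) \<le> real q / 4" "real q * 3 / 4 - 1 < real (fst (dst_cell q w i))"
      using cell_of_bounds(1)[OF well_placed_pos[OF w, of "2 * i"], of q]
        cell_of_bounds(2)[OF well_placed_pos[OF w, of "2 * i + 1"], of q]
      unfolding src_cell_def dst_cell_def by linarith+
    moreover have "real q / 2 - 1 / 2 \<le> real (q div 2)" "real (q div 2) \<le> real q / 2" by linarith+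
    \<comment> \<open>\<open>q \<ge> 4\<close> is what makes
      \<open>3 * q / 4 - 1 \<ge> q / 2\<close>.\<close>
    ultimately have "fst (src_cell q w i) < fst c" "fst c < fst (dst_cell q w i)"
      using q unfolding c by linarith+
    then have "(fst c, snd (src_cell q w i)) \<in> set (butlast (tl (route q w i)))"
      unfolding route_eq by (rule horizontal_inner)
    then show "i \<in> set (through q w c)" using i(1) l(2) by (simp add: through_def)
  qed
  then have "pair_count (left_row q (snd c)) right_part w \<le> card (set (through q w c))"
    unfolding pair_count_def by (intro card_mono) auto
  also have "\<dots> \<le> length (through q w c)" by (rule card_length)
  finally show ?thesis by (simp add: packet_slots_def)
qed

locale primary_overlay = scaling p for p :: overlay +
  assumes path_loss: "path_loss p > 2" and noise: "noise p > 0"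
    and powers: "power_p p > 0" "power_s p > 0" and slot: "slot_len p > 0"
    and ord: "is_cluster_order (order_p p)"
begin

lemma runningI:
  assumes "0 < qp p n" "0 < qs p n" "well_placed (fst \<omega>)" "well_placed (snd \<omega>)"
  shows "running p n \<omega>"
  using assms path_loss noise powers slot ord by unfold_locales

subsection \<open>Throughput\<close>

text \<open>\<open>225 = 9 * 25\<close>: a load is at most three strip counts of
  \<open>3 * n / q\<close>, and one packet is sent per 25 slots. The latter also explains the factor
  \<open>K = 25\<close> between packet size and throughput.\<close>

lemma achievable_cells_over_nodes:
  "achievable p (\<lambda>n. rate_low p * slot_len p / 225 * (real (qp p n) / real n))"
  unfolding achievable_def
proof (intro conjI exI[of _ "25::real"])
  have pos: "0 < rate_low p * slot_len p / 225 * (real (qp p n) / real n)"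
    if "0 < qp p n" "0 < n" for n
    using rate_low_pos[OF noise powers] slot that by simp
  show "\<forall>\<^sub>F n in sequentially. 0 < rate_low p * slot_len p / 225 * (real (qp p n) / real n)"
    using eventually_q[of 1] by eventually_elim (use pos in auto)
  define Q where "Q n w \<longleftrightarrow> (\<forall>c\<in>grid (qp p n). node_count (cell_set (qp p n) c) w \<noteq> 0) \<and>
     (\<forall>y\<in>{..<qp p n}. real (node_count (row_strip (qp p n) y) w) \<le> 3 * (real n / real (qp p n))) \<and>
     (\<forall>y\<in>{..<qp p n}. real (node_count (column_strip (qp p n) y) w) \<le> 3 * (real n / real (qp p n)))" for n w
  have "whp net_space Q"
    unfolding Q_def
    by (intro whp_conj prob_space_poisson_net whp_cells_occupied whp_strips measure_regions) auto
  then have "whp (overlay_space p) (\<lambda>n \<omega>. Q n (fst \<omega>) \<and> well_placed (fst \<omega>) \<and> well_placed (snd \<omega>))"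
    by (rule whp_overlay)
  then show "whp (overlay_space p) (\<lambda>n \<omega>. ereal (rate_low p * slot_len p / 225 * (real (qp p n) / real n))
     \<le> (INF i\<in>{..<num_pairs (fst \<omega>)}. liminf (\<lambda>t. ereal (bits p n \<omega>
           (25 * (rate_low p * slot_len p / 225 * (real (qp p n) / real n))) i t / real t))))"
  proof (rule whp_mono)
    show "\<forall>\<^sub>F n in sequentially. \<forall>\<omega>\<in>space (overlay_space p n).
       Q n (fst \<omega>) \<and> well_placed (fst \<omega>) \<and> well_placed (snd \<omega>) \<longrightarrow>
       ereal (rate_low p * slot_len p / 225 * (real (qp p n) / real n))
       \<le> (INF i\<in>{..<num_pairs (fst \<omega>)}. liminf (\<lambda>t. ereal (bits p n \<omega>
           (25 * (rate_low p * slot_len p / 225 * (real (qp p n) / real n))) i t / real t)))"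
      using eventually_q[of 1]
    proof eventually_elim
      case (elim n)
      show ?case
      proof (intro ballI impI, elim conjE)
        fix \<omega> assume Qn: "Q n (fst \<omega>)" and wp: "well_placed (fst \<omega>)" "well_placed (snd \<omega>)"
        interpret running p n \<omega> using elim wp by (intro runningI) auto
        define L where "L = 25 * (rate_low p * slot_len p / 225 * (real (qp p n) / real n))"
        have L25: "L / 25 = rate_low p * slot_len p / 225 * (real (qp p n) / real n)" by (simp add: L_def)
        have L0: "0 \<le> L" using pos[of n] elim unfolding L_def by linarith
        have nodes: "nodes_in (qp p n) w c \<noteq> []" if "c \<in> grid (qp p n)" for c
          using Qn that q unfolding Q_def by (intro nodes_in_nonempty) auto
        have load: "L * real (load i k) \<le> rate_low p * slot_len p" if "k < hops (qp p n) w i" for i k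
        proof -
          define c where "c = route (qp p n) w i ! k"
          have "c \<in> grid (qp p n)" unfolding c_def using that by (rule route_in_grid)
          then have "real (node_count (row_strip (qp p n) (snd c)) w) \<le> 3 * (real n / real (qp p n))"
            "real (node_count (column_strip (qp p n) (fst c)) w) \<le> 3 * (real n / real (qp p n))"
            using Qn by (auto simp: Q_def grid_def)
          then have "real (load i k) \<le> 9 * (real n / real (qp p n))"
            using packet_slots_le[OF q(1) placed(1), of c] by (simp add: c_def)
          then have "L * real (load i k) \<le> L * (9 * (real n / real (qp p n)))"
            using L0 by (rule mult_left_mono)
          also have "\<dots> = rate_low p * slot_len p" using elim by (simp add: L_def)
          finally show ?thesis .
        qed
        have "ereal (L / 25) \<le> (INF i\<in>{..<num_pairs w}. liminf (\<lambda>t. ereal (bits p n \<omega> L i t / real t)))"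
          by (rule INF_greatest) (use liminf_bits_ge[OF nodes _ L0 load] in auto)
        then show "ereal (rate_low p * slot_len p / 225 * (real (qp p n) / real n))
          \<le> (INF i\<in>{..<num_pairs w}. liminf (\<lambda>t. ereal (bits p n \<omega>
           (25 * (rate_low p * slot_len p / 225 * (real (qp p n) / real n))) i t / real t)))"
          unfolding L_def[symmetric] unfolding L25[symmetric] .
      qed
    qed
  qed
qed simp

lemma cells_over_nodes_bigo:
  assumes "is_primary_throughput p lam"
  shows "(\<lambda>n. real (qp p n) / real n) \<in> O(lam)"
proof -
  have "(\<lambda>n. rate_low p * slot_len p / 225 * (real (qp p n) / real n)) \<in> O(lam)"
    using assms achievable_cells_over_nodes by (simp add: is_primary_throughput_def)
  moreover have "rate_low p * slot_len p / 225 \<noteq> 0"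
    using rate_low_pos[OF noise powers] slot by simp
  ultimately show ?thesis by (subst (asm) landau_o.big.cmult_in_iff) auto
qed

text \<open>One delivered packet is all the upper bound on the throughput requires: it shows that a
  packet of size \<open>L\<close> fits through every hop.\<close>

lemma delivered_of_liminf_pos:
  assumes "0 < liminf (\<lambda>t. ereal (bits p n \<omega> L i t / real t))"
  obtains j where "delivered p n \<omega> L i j"
proof -
  have "\<exists>j. delivered p n \<omega> L i j"
  proof (rule ccontr)
    assume "\<nexists>j. delivered p n \<omega> L i j"
    then have "bits p n \<omega> L i t = 0" for t by (simp add: bits_def)
    then have "liminf (\<lambda>t. ereal (bits p n \<omega> L i t / real t)) = 0" by (simp add: Liminf_const zero_ereal_def[symmetric])
    then show False using assms by simp
  qed
  then show ?thesis using that by blast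
qed

text \<open>The argument bounds the packet size \<open>K * lam n\<close> instead of the number of
  packets; the unknown \<open>K\<close> disappears in the constant of the \<open>O\<close>.\<close>

lemma achievable_bigo:
  assumes ach: "achievable p lam"
  shows "lam \<in> O(\<lambda>n. real (qp p n) / real n)"
proof -
  from ach obtain K where K: "K > 0" "whp (overlay_space p)
        (\<lambda>n \<omega>. (INF i\<in>{..<num_pairs (fst \<omega>)}.
                   liminf (\<lambda>t. ereal (bits p n \<omega> (K * lam n) i t / real t))) \<ge> ereal (lam n))"
    and pos: "\<forall>\<^sub>F n in sequentially. lam n > 0" unfolding achievable_def by blast
  define Q where "Q n w \<longleftrightarrow> (\<forall>y\<in>{..<qp p n}. real n / (128 * real (qp p n))
        \<le> real (pair_count (left_row (qp p n) y) right_part w)) \<and>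
     0 < pair_count (middle_strip (qp p n)) right_part w" for n w
  have "whp net_space Q"
    unfolding Q_def by (intro whp_conj prob_space_poisson_net whp_left_rows whp_middle_source)
  then have "whp (overlay_space p) (\<lambda>n \<omega>. Q n (fst \<omega>) \<and> well_placed (fst \<omega>) \<and> well_placed (snd \<omega>))"
    by (rule whp_overlay)
  from whp_conj[OF prob_space_overlay this K(2)]
  have ex: "\<forall>\<^sub>F n in sequentially. \<exists>\<omega>\<in>space (overlay_space p n).
     (Q n (fst \<omega>) \<and> well_placed (fst \<omega>) \<and> well_placed (snd \<omega>)) \<and>
     (INF i\<in>{..<num_pairs (fst \<omega>)}. liminf (\<lambda>t. ereal (bits p n \<omega> (K * lam n) i t / real t))) \<ge> ereal (lam n)"
    by (rule whp_eventually_ex)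
  show ?thesis
  proof (rule landau_o.bigI)
    show "0 < 128 * rate_high p * slot_len p / K"
      using rate_high_pos[OF noise powers(1)] slot K(1) by simp
    show "\<forall>\<^sub>F n in sequentially. norm (lam n) \<le>
       (128 * rate_high p * slot_len p / K) * norm (real (qp p n) / real n)"
      using ex pos eventually_q[of 4]
    proof eventually_elim
      case (elim n)
      then obtain \<omega> where Qn: "Q n (fst \<omega>)" and wp: "well_placed (fst \<omega>)" "well_placed (snd \<omega>)"
        and inf: "ereal (lam n) \<le> (INF i\<in>{..<num_pairs (fst \<omega>)}. liminf (\<lambda>t. ereal (bits p n \<omega> (K * lam n) i t / real t)))"
        by blast
      interpret running p n \<omega> using elim wp by (intro runningI) auto
      define m where "m = qp p n"
      have m: "m \<ge> 4" using elim by (simp add: m_def)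
      have "{i. i < num_pairs w \<and> pos w (2 * i) \<in> middle_strip m \<and> pos w (2 * i + 1) \<in> right_part} \<noteq> {}"
        using Qn unfolding Q_def pair_count_def m_def[symmetric] by (metis card.empty less_numeral_extra(3))
      then obtain i where i: "i < num_pairs w" "pos w (2 * i) \<in> middle_strip m" "pos w (2 * i + 1) \<in> right_part"
        by blast
      define c where "c = src_cell m w i"
      have "fst (pos w (2 * i)) \<in> {real (m div 2) / real m..<(real (m div 2) + 1 / 2) / real m}"
        using i(2) by (auto simp: middle_strip_def)
      then have s: "real (m div 2) \<le> real m * fst (pos w (2 * i))" "real m * fst (pos w (2 * i)) < real (m div 2) + 1 / 2"
        using slab_mem_iff[of m _ "m div 2" "1 / 2"] m by auto
      note b = cell_of_bounds[OF well_placed_pos[OF placed(1), of "2 * i"], of m]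
      \<comment> \<open>The chosen source thus shares its slot with the many paths counted by
        \<open>packet_slots_ge\<close>.\<close>
      have fc: "fst c = m div 2"
        using s b(1,2) unfolding c_def src_cell_def by linarith
      have "real m * (3 / 4) \<le> real m * fst (pos w (2 * i + 1))"
        using i(3) by (intro mult_left_mono) (auto simp: right_part_def mem_Times_iff)
      then have "real m * 3 / 4 - 1 < real (fst (dst_cell m w i))"
        using cell_of_bounds(2)[OF well_placed_pos[OF placed(1), of "2 * i + 1"], of m]
        unfolding dst_cell_def by linarith
      moreover have "real (m div 2) \<le> real m / 2" by linarith
      ultimately have right: "fst (src_cell m w i) < fst (dst_cell m w i)"
        using m fc unfolding c_def by linarith
      have "ereal (lam n) \<le> liminf (\<lambda>t. ereal (bits p n \<omega> (K * lam n) i t / real t))"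
        using inf i(1) by (meson INF_lower lessThan_iff order_trans)
      then have "0 < liminf (\<lambda>t. ereal (bits p n \<omega> (K * lam n) i t / real t))"
        using elim by (metis ereal_less(2) order_less_le_trans)
      then obtain j where "delivered p n \<omega> (K * lam n) i j" by (rule delivered_of_liminf_pos)
      then have "hop_ok p n \<omega> (K * lam n) i j 0" by (simp add: delivered_def)
      then have size: "K * lam n * real (load i 0) \<le> rate_high p * slot_len p"
        using s(2) fc right i(1) by (intro packet_size_le) (simp_all add: c_def m_def)
      have "snd c < m"
        using cell_of_in_grid[OF well_placed_pos[OF placed(1)], of m "2 * i"] m
        by (auto simp: c_def src_cell_def mem_Times_iff)
      then have "real n / (128 * real m) \<le> real (pair_count (left_row m (snd c)) right_part w)"
        using Qn by (simp add: Q_def m_def)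
      also have "\<dots> \<le> real (length (packet_slots m w c))"
        using packet_slots_ge[OF m placed(1) fc] by simp
      also have "c = route m w i ! 0" by (simp add: c_def nth_route)
      finally have "real n / (128 * real m) \<le> real (load i 0)" by (simp add: m_def)
      then have "K * lam n * (real n / (128 * real m)) \<le> K * lam n * real (load i 0)"
        using K(1) elim by (intro mult_left_mono) auto
      then have "K * lam n * (real n / (128 * real m)) \<le> rate_high p * slot_len p" using size by linarith
      then have "lam n \<le> (128 * rate_high p * slot_len p / K) * (real m / real n)"
        using K(1) elim m by (simp add: field_simps)
      then show ?case using elim by (simp add: m_def)
    qed
  qed
qed

end

section \<open>From packet delays to averages over packets and pairs\<close>

lemma pair_delay_le:
  assumes "\<And>j. packet_delay p n w i j \<le> B" "0 \<le> B"
  shows "pair_delay p n w i \<le> ennreal B"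
  unfolding pair_delay_def
proof (rule Limsup_bounded, rule always_eventually, rule allI)
  fix k
  have "(\<Sum>j<k. packet_delay p n w i j) \<le> (\<Sum>j<k. B)" using assms(1) by (intro sum_mono)
  then have "(\<Sum>j<k. packet_delay p n w i j) / real k \<le> real k * B / real k"
    by (intro divide_right_mono) auto
  \<comment> \<open>Only an inequality, since the quotient is 0 for \<open>k = 0\<close>.\<close>
  also have "\<dots> \<le> B" using assms(2) by simp
  finally show "ennreal ((\<Sum>j<k. packet_delay p n w i j) / real k) \<le> ennreal B" by (rule ennreal_leI)
qed

lemma pair_delay_ge:
  assumes "\<And>j. b \<le> packet_delay p n w i j"
  shows "ennreal b \<le> pair_delay p n w i"
  unfolding pair_delay_def
proof (rule le_Limsup)
  show "\<forall>\<^sub>F k in sequentially. ennreal b \<le> ennreal ((\<Sum>j<k. packet_delay p n w i j) / real k)"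
    using eventually_gt_at_top[of 0]
  proof eventually_elim
    case (elim k)
    have "(\<Sum>j<k. b) \<le> (\<Sum>j<k. packet_delay p n w i j)" using assms by (intro sum_mono)
    then have "real k * b / real k \<le> (\<Sum>j<k. packet_delay p n w i j) / real k"
      by (intro divide_right_mono) auto
    then show ?case using elim by (intro ennreal_leI) simp
  qed
qed simp

text \<open>Needed to condition on \<open>operable\<close>. For a fixed number of nodes, occupancy
  of the finitely many cells is a finite combination of conditions on single points.\<close>

lemma operable_in_sets: "operable p n \<in> sets (overlay_space p n)"
proof -
  define runs where "runs w \<longleftrightarrow> num_pairs w > 0 \<and>
     (\<forall>c \<in> {..<qp p n} \<times> {..<qp p n}. nodes_in (qp p n) w c \<noteq> [])" for w
  have eq: "runs w \<longleftrightarrow> num_pairs w > 0 \<and> (\<forall>c \<in> {..<qp p n} \<times> {..<qp p n}. \<exists>u<fst w.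
       nat \<lfloor>real (qp p n) * fst (snd w u)\<rfloor> = fst c \<and> nat \<lfloor>real (qp p n) * snd (snd w u)\<rfloor> = snd c)" for w
    by (simp add: nodes_in_def filter_empty_conv cell_of_def pos_def prod_eq_iff Bex_def runs_def)
  have X: "(\<lambda>X. X u) \<in> measurable points borel" for u :: nat
    by measurable
  have fst_snd: "(fst :: point \<Rightarrow> real) \<in> borel_measurable borel" "(snd :: point \<Rightarrow> real) \<in> borel_measurable borel"
    unfolding borel_prod[symmetric] by measurable
  have [measurable]: "(\<lambda>X. fst (X u)) \<in> borel_measurable points" "(\<lambda>X. snd (X u)) \<in> borel_measurable points" for u :: nat
    using measurable_compose[OF X fst_snd(1)] measurable_compose[OF X fst_snd(2)] by simp_all
  have "runs \<in> measurable (poisson_net (real n)) (count_space UNIV)"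
    unfolding eq[abs_def] num_pairs_def
    by (rule measurable_poisson_net) (simp only: fst_conv snd_conv, measurable)
  then have "(\<lambda>\<omega>. runs (fst \<omega>)) \<in> measurable (overlay_space p n) (count_space UNIV)"
    unfolding overlay_space_def by (rule measurable_compose[OF measurable_fst])
  then have "{\<omega> \<in> space (overlay_space p n). runs (fst \<omega>)} \<in> sets (overlay_space p n)"
    by (simp add: pred_def)
  then show ?thesis by (simp add: operable_def runs_def)
qed

lemma avg_le:
  assumes "0 < N" "\<And>i. i < N \<Longrightarrow> f i \<le> ennreal B"
  shows "(\<Sum>i<N. f i) / of_nat N \<le> ennreal B"
proof -
  have "(\<Sum>i<N. f i) \<le> (\<Sum>i<N. ennreal B)" using assms(2) by (intro sum_mono) auto
  then have "(\<Sum>i<N. f i) / of_nat N \<le> (of_nat N * ennreal B) / of_nat N"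
    by (intro divide_right_mono_ennreal) simp
  also have "\<dots> = ennreal B"
    by (subst mult.commute) (use assms(1) in \<open>simp add: ennreal_mult_divide_eq of_nat_less_top\<close>)
  finally show ?thesis .
qed

lemma avg_ge:
  assumes N: "0 < N" and I: "I \<subseteq> {..<N}" "\<And>i. i \<in> I \<Longrightarrow> ennreal b \<le> f i" "0 \<le> b"
    and ratio: "r * real N \<le> real (card I)" "0 \<le> r"
  shows "ennreal (r * b) \<le> (\<Sum>i<N. f i) / of_nat N"
proof -
  have "ennreal (r * b) = ennreal (r * real N * b) / of_nat N"
    using N I ratio by (simp add: ennreal_of_nat_eq_real_of_nat divide_ennreal)
  also have "\<dots> \<le> ennreal (real (card I) * b) / of_nat N"
    using ratio I by (intro divide_right_mono_ennreal ennreal_leI mult_right_mono)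
  also have "ennreal (real (card I) * b) = (\<Sum>i\<in>I. ennreal b)"
    using I(3) by (simp add: ennreal_mult ennreal_of_nat_eq_real_of_nat)
  also have "\<dots> / of_nat N \<le> (\<Sum>i\<in>I. f i) / of_nat N"
    using I by (intro divide_right_mono_ennreal sum_mono)
  also have "\<dots> \<le> (\<Sum>i<N. f i) / of_nat N"
    using I by (intro divide_right_mono_ennreal sum_mono2) auto
  finally show ?thesis .
qed

context primary_overlay
begin

subsection \<open>Delay\<close>

lemma pair_delay_upper:
  assumes "well_placed w" "0 < qp p n"
  shows "pair_delay p n w i \<le> ennreal (50 * slot_len p * real (qp p n))"
proof (rule pair_delay_le)
  have "route_len (qp p n) w i \<le> 2 * qp p n"
    using cell_of_in_grid[OF well_placed_pos[OF assms(1)] assms(2)]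
    by (intro path_len_le) (auto simp: src_cell_def dst_cell_def)
  then have h: "real (hops (qp p n) w i) \<le> 2 * real (qp p n)"
    using assms(2) by (simp add: hops_eq)
  show "packet_delay p n w i j \<le> 50 * slot_len p * real (qp p n)" for j
  proof -
    have "packet_delay p n w i j \<le> 25 * real (hops (qp p n) w i) * slot_len p"
      by (rule packet_delay_bounds(2)[OF ord slot])
    also have "\<dots> \<le> 25 * (2 * real (qp p n)) * slot_len p"
      using h slot by (intro mult_right_mono mult_left_mono) auto
    finally show ?thesis by (simp add: mult_ac)
  qed
qed (use slot in simp)

lemma pair_delay_lower:
  assumes w: "well_placed w" and q: "12 \<le> qp p n"
    and i: "pos w (2 * i) \<in> left_part" "pos w (2 * i + 1) \<in> right_part"
  shows "ennreal (slot_len p / 4 * real (qp p n)) \<le> pair_delay p n w i"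
proof (rule pair_delay_ge)
  fix j
  define m where "m = qp p n"
  have "real m * fst (pos w (2 * i)) \<le> real m * (1 / 4)" "real m * (3 / 4) \<le> real m * fst (pos w (2 * i + 1))"
    using i by (intro mult_left_mono; force simp: left_part_def right_part_def)+
  then have "real (fst (src_cell m w i)) \<le> real m / 4" "real m * 3 / 4 - 1 < real (fst (dst_cell m w i))"
    using cell_of_bounds(1)[OF well_placed_pos[OF w, of "2 * i"], of m]
      cell_of_bounds(2)[OF well_placed_pos[OF w, of "2 * i + 1"], of m]
    unfolding src_cell_def dst_cell_def by linarith+
  moreover have "real (fst (dst_cell m w i)) - real (fst (src_cell m w i)) \<le> real (route_len m w i)"
    by (simp add: path_len_def gap_def)
  \<comment> \<open>The horizontal leg exceeds \<open>m / 2 - 1\<close>, and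
    \<open>m / 2 - 3 \<ge> m / 4\<close> as soon as \<open>m \<ge> 12\<close>.\<close>
  ultimately have "real m / 4 \<le> real (route_len m w i) - 2" using q unfolding m_def by linarith
  then have "real m / 4 * slot_len p \<le> (real (route_len m w i) - 2) * slot_len p"
    using slot by (intro mult_right_mono) auto
  also have "\<dots> \<le> packet_delay p n w i j"
    unfolding m_def by (rule packet_delay_bounds(1)[OF ord slot])
  finally show "slot_len p / 4 * real (qp p n) \<le> packet_delay p n w i j" by (simp add: m_def mult_ac)
qed

abbreviation mean_delay :: "nat \<Rightarrow> net \<Rightarrow> ennreal" where
  "mean_delay n w \<equiv> (\<Sum>i<num_pairs w. pair_delay p n w i) / of_nat (num_pairs w)"

text \<open>At least \<open>n / 128\<close> of at most \<open>3 * n / 2\<close> pairs are long, a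
  fraction of 1/192; with the delay bound \<open>slot_len p / 4 * q\<close> of a long pair this
  gives 768.\<close>

lemma mean_delay_lower:
  assumes w: "well_placed w" and q: "12 \<le> qp p n" and n: "0 < n"
    and pairs: "real n / 128 \<le> real (pair_count left_part right_part w)"
    and nodes: "real (node_count unit_square w) \<le> 3 * real n"
  shows "ennreal (slot_len p / 768 * real (qp p n)) \<le> mean_delay n w"
proof -
  let ?I = "{i. i < num_pairs w \<and> pos w (2 * i) \<in> left_part \<and> pos w (2 * i + 1) \<in> right_part}"
  have "{u. u < fst w \<and> pos w u \<in> unit_square} = {..<fst w}" using well_placed_pos[OF w] by blast
  then have "real (fst w) \<le> 3 * real n" using nodes by (simp add: node_count_def)
  moreover have "2 * real (num_pairs w) \<le> real (fst w)" unfolding num_pairs_def by linarith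
  ultimately have N: "2 * real (num_pairs w) \<le> 3 * real n" by linarith
  have card: "real n / 128 \<le> real (card ?I)" using pairs by (simp add: pair_count_def)
  have N0: "0 < num_pairs w"
  proof (rule ccontr)
    assume "\<not> 0 < num_pairs w"
    then have "?I = {}" by auto
    then have "real (card ?I) = 0" by (simp only: card.empty of_nat_0)
    then show False using card n by linarith
  qed
  have "ennreal (1 / 192 * (slot_len p / 4 * real (qp p n))) \<le> mean_delay n w"
  proof (rule avg_ge[OF N0])
    show "1 / 192 * real (num_pairs w) \<le> real (card ?I)" using N card by linarith
  qed (use pair_delay_lower[OF w q] slot in auto)
  then show ?thesis by simp
qed

lemma whp_operable:
  "whp (overlay_space p) (\<lambda>n \<omega>. \<omega> \<in> operable p n \<and>
     ennreal (slot_len p / 768 * real (qp p n)) \<le> mean_delay n (fst \<omega>))"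
proof -
  define Q where "Q n w \<longleftrightarrow> (\<forall>c\<in>grid (qp p n). node_count (cell_set (qp p n) c) w \<noteq> 0) \<and>
     real n / 128 \<le> real (pair_count left_part right_part w) \<and>
     real (node_count unit_square w) \<le> 3 * real n" for n w
  have "whp net_space Q"
    unfolding Q_def by (intro whp_conj prob_space_poisson_net whp_cells_occupied whp_left_right whp_node_number)
  then have "whp (overlay_space p) (\<lambda>n \<omega>. Q n (fst \<omega>) \<and> well_placed (fst \<omega>) \<and> well_placed (snd \<omega>))"
    by (rule whp_overlay)
  then show ?thesis
  proof (rule whp_mono)
    show "\<forall>\<^sub>F n in sequentially. \<forall>\<omega>\<in>space (overlay_space p n).
       Q n (fst \<omega>) \<and> well_placed (fst \<omega>) \<and> well_placed (snd \<omega>) \<longrightarrow>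
       \<omega> \<in> operable p n \<and> ennreal (slot_len p / 768 * real (qp p n)) \<le> mean_delay n (fst \<omega>)"
      using eventually_q[of 12]
    proof eventually_elim
      case (elim n)
      show ?case
      proof (intro ballI impI, elim conjE, intro conjI)
        fix \<omega> assume sp: "\<omega> \<in> space (overlay_space p n)" and Qn: "Q n (fst \<omega>)" and wp: "well_placed (fst \<omega>)"
        have "\<forall>c\<in>{..<qp p n} \<times> {..<qp p n}. nodes_in (qp p n) (fst \<omega>) c \<noteq> []"
          using Qn elim nodes_in_nonempty[of "qp p n" _ "fst \<omega>"] unfolding Q_def grid_def by force
        moreover have "num_pairs (fst \<omega>) > 0"
        proof (rule ccontr)
          assume "\<not> num_pairs (fst \<omega>) > 0"
          then have "pair_count left_part right_part (fst \<omega>) = 0" by (simp add: pair_count_def)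
          then show False using Qn elim by (simp add: Q_def)
        qed
        ultimately show "\<omega> \<in> operable p n" using sp by (simp add: operable_def)
        show "ennreal (slot_len p / 768 * real (qp p n)) \<le> mean_delay n (fst \<omega>)"
          using Qn elim wp unfolding Q_def by (intro mean_delay_lower) auto
      qed
    qed
  qed
qed

text \<open>Only monotonicity of the integral is used: the mean delay lies almost everywhere below a
  constant, and above a multiple of the indicator of the measurable event
  \<open>E n\<close>.\<close>

lemma primary_delay_bounds:
  "\<forall>\<^sub>F n in sequentially. slot_len p / 1536 * real (qp p n) \<le> primary_delay p n \<and>
     primary_delay p n \<le> 50 * slot_len p * real (qp p n)"
proof -
  obtain E where E: "\<And>n. E n \<in> sets (overlay_space p n)" "\<And>n \<omega>. \<omega> \<in> E n \<Longrightarrow> \<omega> \<in> operable p n"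
    "\<And>n \<omega>. \<omega> \<in> E n \<Longrightarrow> ennreal (slot_len p / 768 * real (qp p n)) \<le> mean_delay n (fst \<omega>)"
    "(\<lambda>n. measure (overlay_space p n) (E n)) \<longlonglongrightarrow> 1"
    using whp_operable unfolding whp_def by blast
  have "\<forall>\<^sub>F n in sequentially. 1 / 2 < measure (overlay_space p n) (E n)"
    using E(4) by (rule order_tendstoD) simp
  then show ?thesis using eventually_q[of 1]
  proof eventually_elim
    case (elim n)
    interpret O: prob_space "overlay_space p n" by (rule prob_space_overlay)
    let ?A = "operable p n" and ?U = "uniform_measure (overlay_space p n) (operable p n)"
    define B where "B = 50 * slot_len p * real (qp p n)"
    define b where "b = slot_len p / 768 * real (qp p n)"
    have B0: "0 \<le> B" "0 \<le> b" using slot by (simp_all add: B_def b_def)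
    have "O.prob (E n) \<le> O.prob ?A" using E operable_in_sets by (intro O.finite_measure_mono) auto
    then have A: "1 / 2 < O.prob ?A" using elim by linarith
    then have A0: "emeasure (overlay_space p n) ?A \<noteq> 0" "emeasure (overlay_space p n) ?A \<noteq> \<infinity>"
      by (auto simp: O.emeasure_eq_measure)
    interpret U: prob_space ?U by (rule prob_space_uniform_measure[OF A0])
    define I where "I = (\<integral>\<^sup>+\<omega>. mean_delay n (fst \<omega>) \<partial>?U)"
    have "I \<le> (\<integral>\<^sup>+\<omega>. ennreal B \<partial>?U)"
      unfolding I_def
    proof (rule nn_integral_mono_AE, rule AE_uniform_measureI[OF operable_in_sets])
      show "AE \<omega> in overlay_space p n. \<omega> \<in> ?A \<longrightarrow> mean_delay n (fst \<omega>) \<le> ennreal B"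
        using AE_overlay_well_placed
      proof eventually_elim
        case (elim \<omega>)
        then show ?case
          using \<open>1 \<le> qp p n \<and> _\<close> unfolding B_def
          by (auto simp: operable_def intro!: avg_le pair_delay_upper)
      qed
    qed
    also have "\<dots> = ennreal B" using U.emeasure_space_1 by simp
    finally have up: "I \<le> ennreal B" .
    \<comment> \<open>Conditioning on an event that contains \<open>E n\<close> can only raise its
      probability. The 1/2 turns 768 into 1536.\<close>
    have "1 / 2 \<le> U.prob (E n)"
    proof -
      have "U.prob (E n) = O.prob (?A \<inter> E n) / O.prob ?A"
        by (rule measure_uniform_measure[OF A0 E(1)])
      also have "?A \<inter> E n = E n" using E(2) by auto
      finally have "U.prob (E n) = O.prob (E n) / O.prob ?A" .
      moreover have "O.prob (E n) / 1 \<le> O.prob (E n) / O.prob ?A"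
        using A by (intro divide_left_mono) auto
      ultimately show ?thesis using elim by linarith
    qed
    then have "ennreal (b / 2) \<le> ennreal b * emeasure ?U (E n)"
      using B0 mult_left_mono[of "1 / 2" "U.prob (E n)" b]
      by (simp add: U.emeasure_eq_measure ennreal_mult[symmetric] ennreal_leI)
    also have "\<dots> = (\<integral>\<^sup>+\<omega>. ennreal b * indicator (E n) \<omega> \<partial>?U)"
      using E(1) by (simp add: nn_integral_cmult_indicator)
    also have "\<dots> \<le> I"
      unfolding I_def b_def using E(3) by (intro nn_integral_mono) (auto simp: indicator_def)
    finally have low: "ennreal (b / 2) \<le> I" .
    have pd: "primary_delay p n = enn2real I" by (simp add: primary_delay_def I_def)
    \<comment> \<open>\<open>enn2real\<close> maps infinity to 0, so the lower bound survives it
      only because the upper bound makes the integral finite.\<close>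
    have fin: "I < top" using up by (rule order_le_less_trans) simp
    have "b / 2 \<le> enn2real I" using enn2real_mono[OF low fin] B0 by simp
    moreover have "enn2real I \<le> B" using enn2real_mono[OF up] B0 by simp
    ultimately show ?case unfolding pd by (simp add: b_def B_def)
  qed
qed

lemma primary_delay_bigtheta: "primary_delay p \<in> \<Theta>(\<lambda>n. real (qp p n))"
proof (rule bigthetaI)
  show "primary_delay p \<in> O(\<lambda>n. real (qp p n))"
  proof (rule landau_o.bigI)
    show "0 < 50 * slot_len p" using slot by simp
    show "\<forall>\<^sub>F n in sequentially. norm (primary_delay p n) \<le> 50 * slot_len p * norm (real (qp p n))"
      using primary_delay_bounds by eventually_elim (simp add: primary_delay_def)
  qed
  show "primary_delay p \<in> \<Omega>(\<lambda>n. real (qp p n))"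
  proof (rule landau_omega.bigI)
    show "0 < slot_len p / 1536" using slot by simp
    show "\<forall>\<^sub>F n in sequentially. slot_len p / 1536 * norm (real (qp p n)) \<le> norm (primary_delay p n)"
      using primary_delay_bounds by eventually_elim (simp add: primary_delay_def)
  qed
qed

lemma primary_throughput_bigtheta:
  assumes "is_primary_throughput p lam"
  shows "lam \<in> \<Theta>(\<lambda>n. real (qp p n) / real n)"
  using assms achievable_bigo[of lam] cells_over_nodes_bigo[OF assms]
  by (auto simp: is_primary_throughput_def bigomega_iff_bigo intro: bigthetaI)

end

theorem theorem3:
  fixes p :: overlay and lam_p :: "nat \<Rightarrow> real"
  assumes "path_loss p > 2" and "density_exp p > 1"
    and "noise p > 0" and "power_p p > 0" and "power_s p > 0" and "slot_len p > 0"
    and "\<And>n. cell_const p n \<ge> 1"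
    and "(\<lambda>n. cell_const p n * ln (real n) / real n) \<longlonglongrightarrow> 0"
    and "is_cluster_order (order_p p)" and "is_cluster_order (order_s p)"
    and "is_primary_throughput p lam_p"
    and "lam_p \<in> O(\<lambda>n. 1 / sqrt (real n * ln (real n)))"
  shows "primary_delay p \<in> \<Theta>(\<lambda>n. real n * lam_p n)"
proof -
  interpret primary_overlay p using assms by unfold_locales auto
  have "(\<lambda>n. real n * lam_p n) \<in> \<Theta>(\<lambda>n. real n * (real (qp p n) / real n))"
    using primary_throughput_bigtheta[OF assms(11)] by (intro landau_theta.mult) auto
  also have "(\<lambda>n. real n * (real (qp p n) / real n)) \<in> \<Theta>(\<lambda>n. real (qp p n))"
    by (intro bigthetaI_cong eventually_mono[OF eventually_gt_at_top[of 0]]) simp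
  finally have "(\<lambda>n. real (qp p n)) \<in> \<Theta>(\<lambda>n. real n * lam_p n)"
    by (simp add: bigtheta_sym)
  with primary_delay_bigtheta show ?thesis by (rule landau_theta.trans)
qed

end
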